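(* Let $\mathbb{C}$ be a regular category. The category $\mathrm{Equiv}(\mathbb{C})$ of equivalence relations in $\mathbb{C}$ is a Goursat category whenever $\mathbb{C}$ is a Goursat category.
   Context: A category is regular if it is finitely complete, regular epimorphisms are stable under pullbacks, and kernel pairs have coequalisers. A relation from $X$ to $Y$ is a subobject $\langle r_1,r_2\rangle : R \rightarrowtail X\times Y$; in a regular category the composite $SR$ of $R\rightarrowtail X\times Y$ and $S\rightarrowtail Y\times Z$ is the image of $(r_1 p_1, s_2 p_2): R\times_Y S\to X\times Z$, where $R\times_Y S$ (with projections $p_1,p_2$) is the pullback of $r_2$ along $s_1$. An equivalence relation on $X$ is a relation from $X$ to $X$ that is (internally) reflexive, symmetric and transitive. A Goursat category is a regular category in which $RSR=SRS$ for any pair of equivalence relations $R,S$ on the same object. The category $\mathrm{Equiv}(\mathbb{C})$ has as objects the equivalence relations in $\mathbb{C}$; an arrow from $\langle r_1,r_2\rangle:R\rightarrowtail X\times X$ to $\langle s_1,s_2\rangle:S\rightarrowtail Y\times Y$ is a pair $(f,g)$ of arrows $f:X\to Y$, $g:R\to S$ in $\mathbb{C}$ with $s_i g=f r_i$ for $i=1,2$. *)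

theory Defs
  imports Main
begin

section \<open>Categories\<close>

record ('o, 'a) cat =
  Obj :: "'o set"
  Arr :: "'a set"
  Dom :: "'a \<Rightarrow> 'o"
  Cod :: "'a \<Rightarrow> 'o"
  Ident :: "'o \<Rightarrow> 'a"
  Comp :: "'a \<Rightarrow> 'a \<Rightarrow> 'a"  (infixr "\<cdot>\<index>" 70)

definition hom :: "('o, 'a) cat \<Rightarrow> 'o \<Rightarrow> 'o \<Rightarrow> 'a set" where
  "hom C X Y = {f \<in> Arr C. Dom C f = X \<and> Cod C f = Y}"

locale category =
  fixes C :: "('o, 'a) cat"  (structure)
  assumes Dom_in: "f \<in> Arr C \<Longrightarrow> Dom C f \<in> Obj C"
    and Cod_in: "f \<in> Arr C \<Longrightarrow> Cod C f \<in> Obj C"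
    and Ident_hom: "X \<in> Obj C \<Longrightarrow> Ident C X \<in> hom C X X"
    and Comp_hom: "f \<in> hom C X Y \<Longrightarrow> g \<in> hom C Y Z \<Longrightarrow> g \<cdot> f \<in> hom C X Z"
    and Comp_Ident: "f \<in> hom C X Y \<Longrightarrow> f \<cdot> Ident C X = f"
    and Ident_Comp: "f \<in> hom C X Y \<Longrightarrow> Ident C Y \<cdot> f = f"
    and Comp_assoc: "f \<in> hom C W X \<Longrightarrow> g \<in> hom C X Y \<Longrightarrow> h \<in> hom C Y Z \<Longrightarrow>
                     (h \<cdot> g) \<cdot> f = h \<cdot> (g \<cdot> f)"

definition monic :: "('o, 'a) cat \<Rightarrow> 'a \<Rightarrow> bool" where
  "monic C m \<longleftrightarrow> m \<in> Arr C \<and>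
     (\<forall>Z. \<forall>a \<in> hom C Z (Dom C m). \<forall>b \<in> hom C Z (Dom C m).
        m \<cdot>\<^bsub>C\<^esub> a = m \<cdot>\<^bsub>C\<^esub> b \<longrightarrow> a = b)"

definition isomorphism :: "('o, 'a) cat \<Rightarrow> 'a \<Rightarrow> bool" where
  "isomorphism C f \<longleftrightarrow> f \<in> Arr C \<and>
     (\<exists>g \<in> hom C (Cod C f) (Dom C f).
        g \<cdot>\<^bsub>C\<^esub> f = Ident C (Dom C f) \<and> f \<cdot>\<^bsub>C\<^esub> g = Ident C (Cod C f))"

section \<open>Limits and coequalisers\<close>

definition is_functor ::
  "('j, 'u) cat \<Rightarrow> ('o, 'a) cat \<Rightarrow> ('j \<Rightarrow> 'o) \<Rightarrow> ('u \<Rightarrow> 'a) \<Rightarrow> bool" where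
  "is_functor J C Fo Fa \<longleftrightarrow>
     (\<forall>j \<in> Obj J. Fo j \<in> Obj C \<and> Fa (Ident J j) = Ident C (Fo j)) \<and>
     (\<forall>u \<in> Arr J. Fa u \<in> hom C (Fo (Dom J u)) (Fo (Cod J u))) \<and>
     (\<forall>u \<in> Arr J. \<forall>v \<in> Arr J. Cod J u = Dom J v \<longrightarrow>
        Fa (v \<cdot>\<^bsub>J\<^esub> u) = Fa v \<cdot>\<^bsub>C\<^esub> Fa u)"

definition is_cone ::
  "('j, 'u) cat \<Rightarrow> ('o, 'a) cat \<Rightarrow> ('j \<Rightarrow> 'o) \<Rightarrow> ('u \<Rightarrow> 'a) \<Rightarrow> 'o \<Rightarrow> ('j \<Rightarrow> 'a) \<Rightarrow> bool" where
  "is_cone J C Fo Fa L \<pi> \<longleftrightarrow> L \<in> Obj C \<and>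
     (\<forall>j \<in> Obj J. \<pi> j \<in> hom C L (Fo j)) \<and>
     (\<forall>u \<in> Arr J. Fa u \<cdot>\<^bsub>C\<^esub> \<pi> (Dom J u) = \<pi> (Cod J u))"

definition is_limit ::
  "('j, 'u) cat \<Rightarrow> ('o, 'a) cat \<Rightarrow> ('j \<Rightarrow> 'o) \<Rightarrow> ('u \<Rightarrow> 'a) \<Rightarrow> 'o \<Rightarrow> ('j \<Rightarrow> 'a) \<Rightarrow> bool" where
  "is_limit J C Fo Fa L \<pi> \<longleftrightarrow> is_cone J C Fo Fa L \<pi> \<and>
     (\<forall>M \<mu>. is_cone J C Fo Fa M \<mu> \<longrightarrow>
        (\<exists>!h. h \<in> hom C M L \<and> (\<forall>j \<in> Obj J. \<pi> j \<cdot>\<^bsub>C\<^esub> h = \<mu> j)))"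

text \<open>Every finite category is isomorphic to one whose objects and arrows are natural
  numbers, so fixing the type of the index categories loses no generality.\<close>

definition finitely_complete :: "('o, 'a) cat \<Rightarrow> bool" where
  "finitely_complete C \<longleftrightarrow>
     (\<forall>(J :: (nat, nat) cat) Fo Fa.
        category J \<and> finite (Obj J) \<and> finite (Arr J) \<and> is_functor J C Fo Fa \<longrightarrow>
        (\<exists>L \<pi>. is_limit J C Fo Fa L \<pi>))"

definition is_product :: "('o, 'a) cat \<Rightarrow> 'o \<Rightarrow> 'o \<Rightarrow> 'a \<Rightarrow> 'a \<Rightarrow> bool" where
  "is_product C X Y p q \<longleftrightarrow>
     p \<in> Arr C \<and> q \<in> Arr C \<and> Dom C p = Dom C q \<and> Cod C p = X \<and> Cod C q = Y \<and>
     (\<forall>Z. \<forall>a \<in> hom C Z X. \<forall>b \<in> hom C Z Y.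
        \<exists>!h. h \<in> hom C Z (Dom C p) \<and> p \<cdot>\<^bsub>C\<^esub> h = a \<and> q \<cdot>\<^bsub>C\<^esub> h = b)"

text \<open>In \<open>is_pullback C f g p q\<close>, \<open>p\<close> is the projection to the domain of \<open>f\<close> and \<open>q\<close> the
  projection to the domain of \<open>g\<close>.\<close>

definition is_pullback :: "('o, 'a) cat \<Rightarrow> 'a \<Rightarrow> 'a \<Rightarrow> 'a \<Rightarrow> 'a \<Rightarrow> bool" where
  "is_pullback C f g p q \<longleftrightarrow>
     f \<in> Arr C \<and> g \<in> Arr C \<and> Cod C f = Cod C g \<and>
     p \<in> Arr C \<and> q \<in> Arr C \<and> Dom C p = Dom C q \<and>
     Cod C p = Dom C f \<and> Cod C q = Dom C g \<and>
     f \<cdot>\<^bsub>C\<^esub> p = g \<cdot>\<^bsub>C\<^esub> q \<and>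
     (\<forall>Z. \<forall>a \<in> hom C Z (Dom C f). \<forall>b \<in> hom C Z (Dom C g).
        f \<cdot>\<^bsub>C\<^esub> a = g \<cdot>\<^bsub>C\<^esub> b \<longrightarrow>
        (\<exists>!h. h \<in> hom C Z (Dom C p) \<and> p \<cdot>\<^bsub>C\<^esub> h = a \<and> q \<cdot>\<^bsub>C\<^esub> h = b))"

definition is_coequaliser :: "('o, 'a) cat \<Rightarrow> 'a \<Rightarrow> 'a \<Rightarrow> 'a \<Rightarrow> bool" where
  "is_coequaliser C u v e \<longleftrightarrow>
     u \<in> Arr C \<and> v \<in> Arr C \<and> Dom C u = Dom C v \<and> Cod C u = Cod C v \<and>
     e \<in> Arr C \<and> Dom C e = Cod C u \<and> e \<cdot>\<^bsub>C\<^esub> u = e \<cdot>\<^bsub>C\<^esub> v \<and>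
     (\<forall>Z. \<forall>k \<in> hom C (Cod C u) Z. k \<cdot>\<^bsub>C\<^esub> u = k \<cdot>\<^bsub>C\<^esub> v \<longrightarrow>
        (\<exists>!h. h \<in> hom C (Cod C e) Z \<and> h \<cdot>\<^bsub>C\<^esub> e = k))"

definition regular_epi :: "('o, 'a) cat \<Rightarrow> 'a \<Rightarrow> bool" where
  "regular_epi C e \<longleftrightarrow> (\<exists>u v. is_coequaliser C u v e)"

section \<open>Regular categories and relations\<close>

locale regular_category = category C for C :: "('o, 'a) cat"  (structure) +
  assumes finitely_complete: "finitely_complete C"
    and regular_epi_stable: "regular_epi C f \<Longrightarrow> is_pullback C f g p q \<Longrightarrow> regular_epi C q"
    and kernel_pair_coequaliser: "is_pullback C f f p q \<Longrightarrow> \<exists>e. is_coequaliser C p q e"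

text \<open>A relation is represented by the pair \<open>(r1, r2)\<close> of its legs. Binary products are not
  chosen, so the condition is that the arrow induced by the legs into a product is monic.\<close>

definition is_relation :: "('o, 'a) cat \<Rightarrow> 'o \<Rightarrow> 'o \<Rightarrow> 'a \<times> 'a \<Rightarrow> bool" where
  "is_relation C X Y = (\<lambda>(r1, r2).
     \<exists>p q m. is_product C X Y p q \<and> monic C m \<and> Cod C m = Dom C p \<and>
       r1 = p \<cdot>\<^bsub>C\<^esub> m \<and> r2 = q \<cdot>\<^bsub>C\<^esub> m)"

text \<open>Equality of relations as subobjects, i.e. isomorphism of the representing monomorphisms.\<close>

definition rel_eq :: "('o, 'a) cat \<Rightarrow> 'a \<times> 'a \<Rightarrow> 'a \<times> 'a \<Rightarrow> bool" where
  "rel_eq C = (\<lambda>(r1, r2) (s1, s2).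
     \<exists>i \<in> hom C (Dom C r1) (Dom C s1). isomorphism C i \<and>
       s1 \<cdot>\<^bsub>C\<^esub> i = r1 \<and> s2 \<cdot>\<^bsub>C\<^esub> i = r2)"

definition is_image :: "('o, 'a) cat \<Rightarrow> 'a \<Rightarrow> 'a \<Rightarrow> bool" where
  "is_image C f m \<longleftrightarrow> monic C m \<and>
     (\<exists>e. regular_epi C e \<and> Cod C e = Dom C m \<and> m \<cdot>\<^bsub>C\<^esub> e = f)"

definition is_rel_comp :: "('o, 'a) cat \<Rightarrow> 'a \<times> 'a \<Rightarrow> 'a \<times> 'a \<Rightarrow> 'a \<times> 'a \<Rightarrow> bool" where
  "is_rel_comp C = (\<lambda>(s1, s2) (r1, r2) (t1, t2).
     \<exists>p1 p2 x z k m.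
       is_pullback C r2 s1 p1 p2 \<and>
       is_product C (Cod C r1) (Cod C s2) x z \<and>
       k \<in> hom C (Dom C p1) (Dom C x) \<and>
       x \<cdot>\<^bsub>C\<^esub> k = r1 \<cdot>\<^bsub>C\<^esub> p1 \<and> z \<cdot>\<^bsub>C\<^esub> k = s2 \<cdot>\<^bsub>C\<^esub> p2 \<and>
       is_image C k m \<and> t1 = x \<cdot>\<^bsub>C\<^esub> m \<and> t2 = z \<cdot>\<^bsub>C\<^esub> m)"

text \<open>A representative of the composite \<open>SR\<close> (first \<open>R\<close>, then \<open>S\<close>). In a regular category one
  exists and is unique up to \<open>rel_eq\<close>, so any property invariant under \<open>rel_eq\<close> is independent
  of the choice.\<close>

definition rel_comp :: "('o, 'a) cat \<Rightarrow> 'a \<times> 'a \<Rightarrow> 'a \<times> 'a \<Rightarrow> 'a \<times> 'a" where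
  "rel_comp C s r = (SOME t. is_rel_comp C s r t)"

definition reflexive_rel :: "('o, 'a) cat \<Rightarrow> 'o \<Rightarrow> 'a \<times> 'a \<Rightarrow> bool" where
  "reflexive_rel C X = (\<lambda>(r1, r2).
     \<exists>d \<in> hom C X (Dom C r1). r1 \<cdot>\<^bsub>C\<^esub> d = Ident C X \<and> r2 \<cdot>\<^bsub>C\<^esub> d = Ident C X)"

definition symmetric_rel :: "('o, 'a) cat \<Rightarrow> 'a \<times> 'a \<Rightarrow> bool" where
  "symmetric_rel C = (\<lambda>(r1, r2).
     \<exists>s \<in> hom C (Dom C r1) (Dom C r1). r1 \<cdot>\<^bsub>C\<^esub> s = r2 \<and> r2 \<cdot>\<^bsub>C\<^esub> s = r1)"

definition transitive_rel :: "('o, 'a) cat \<Rightarrow> 'a \<times> 'a \<Rightarrow> bool" where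
  "transitive_rel C = (\<lambda>(r1, r2).
     \<exists>p1 p2. is_pullback C r2 r1 p1 p2 \<and>
       (\<exists>t \<in> hom C (Dom C p1) (Dom C r1).
          r1 \<cdot>\<^bsub>C\<^esub> t = r1 \<cdot>\<^bsub>C\<^esub> p1 \<and> r2 \<cdot>\<^bsub>C\<^esub> t = r2 \<cdot>\<^bsub>C\<^esub> p2))"

definition equivalence_rel :: "('o, 'a) cat \<Rightarrow> 'o \<Rightarrow> 'a \<times> 'a \<Rightarrow> bool" where
  "equivalence_rel C X r \<longleftrightarrow> is_relation C X X r \<and>
     reflexive_rel C X r \<and> symmetric_rel C r \<and> transitive_rel C r"

text \<open>Composition of relations in a regular category is associative, so the bracketing chosen
  for \<open>RSR\<close> and \<open>SRS\<close> is immaterial.\<close>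

locale goursat_category = regular_category C for C :: "('o, 'a) cat"  (structure) +
  assumes three_permutable:
    "equivalence_rel C X r \<Longrightarrow> equivalence_rel C X s \<Longrightarrow>
       rel_eq C (rel_comp C r (rel_comp C s r)) (rel_comp C s (rel_comp C r s))"

section \<open>The category of equivalence relations\<close>

text \<open>An arrow carries its domain and codomain: \<open>(r, (f, g), s)\<close> is the arrow \<open>(f, g)\<close> from
  \<open>r\<close> to \<open>s\<close>. The object \<open>X\<close> underlying \<open>r = (r1, r2)\<close> is the codomain of \<open>r1\<close>, and \<open>R\<close> its
  domain.\<close>

type_synonym 'a equiv_arr = "('a \<times> 'a) \<times> ('a \<times> 'a) \<times> ('a \<times> 'a)"

definition Equiv :: "('o, 'a) cat \<Rightarrow> ('a \<times> 'a, 'a equiv_arr) cat" where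
  "Equiv C = \<lparr>
     Obj = {r. \<exists>X \<in> Obj C. equivalence_rel C X r},
     Arr = {((r1, r2), (f, g), (s1, s2)) | r1 r2 f g s1 s2.
              (\<exists>X \<in> Obj C. equivalence_rel C X (r1, r2)) \<and>
              (\<exists>Y \<in> Obj C. equivalence_rel C Y (s1, s2)) \<and>
              f \<in> hom C (Cod C r1) (Cod C s1) \<and> g \<in> hom C (Dom C r1) (Dom C s1) \<and>
              s1 \<cdot>\<^bsub>C\<^esub> g = f \<cdot>\<^bsub>C\<^esub> r1 \<and> s2 \<cdot>\<^bsub>C\<^esub> g = f \<cdot>\<^bsub>C\<^esub> r2},
     Dom = (\<lambda>(r, _, s). r),
     Cod = (\<lambda>(r, _, s). s),
     Ident = (\<lambda>(r1, r2). ((r1, r2), (Ident C (Cod C r1), Ident C (Dom C r1)), (r1, r2))),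
     Comp = (\<lambda>(_, (f', g'), t) (r, (f, g), _).
               (r, (f' \<cdot>\<^bsub>C\<^esub> f, g' \<cdot>\<^bsub>C\<^esub> g), t))\<rparr>"

end

theory Submission
  imports Defs
begin

text \<open>
  Relations are handled through generalised elements: in a regular category, \<open>(x, z)\<close> belongs to a
  composite \<open>SR\<close> iff, after pulling back along some regular epimorphism, there is \<open>y\<close> with
  \<open>(x, y)\<close> in \<open>R\<close> and \<open>(y, z)\<close> in \<open>S\<close>.

  Limits in \<open>Equiv(C)\<close> are computed separately on the objects \<open>X\<close> and \<open>R\<close> of a relation
  \<open>R \<rightarrowtail> X \<times> X\<close>. In a Goursat category the image of an equivalence relation under a regular
  epimorphism is again an equivalence relation. This provides image factorisations in
  \<open>Equiv(C)\<close>, and with them an arrow \<open>(f, g)\<close> is a regular epimorphism iff both \<open>f\<close> and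
  \<open>g\<close> are. Hence \<open>Equiv(C)\<close> is regular, and the two functors \<open>R \<mapsto> X\<close> and \<open>R \<mapsto> R\<close> to \<open>C\<close>
  preserve equivalence relations and their composites. So \<open>RSR\<close> and \<open>SRS\<close> agree in both
  components because they do in \<open>C\<close>, and such componentwise comparisons lift to \<open>Equiv(C)\<close>.
\<close>

section \<open>Arrows and factorisations\<close>

text \<open>Without the Goursat condition the image of an equivalence relation along a regular
  epimorphism may fail to be transitive, and the levelwise factorisation of an arrow of Equiv(C)
  would have no middle object. This is where permutability enters the proof of regularity; it
  returns at the end, once on each level. Two facts make the levelwise method work. An arrow
  \<open>(f, g)\<close> of Equiv(C) is determined by \<open>f\<close>, because the legs of its
  target are jointly monic. And a missing component \<open>g\<close> exists as soon as it exists
  after composition with a regular epimorphism. Hence a coequaliser in Equiv(C) is tested on X only,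
  while on R a regular epimorphism is enough. Products are not chosen, so relations are treated as
  jointly monic pairs of legs and equality of subobjects as mutual membership. A functor need not
  carry chosen composites to chosen composites, so permutability is put into a form valid for every
  representative of a composite.\<close>

context category
begin

lemma comp_arr [simp]:
  assumes "f \<in> Arr C" "g \<in> Arr C" "Dom C g = Cod C f"
  shows "g \<cdot> f \<in> Arr C" "Dom C (g \<cdot> f) = Dom C f" "Cod C (g \<cdot> f) = Cod C g"
  using Comp_hom[of f "Dom C f" "Cod C f" g "Cod C g"] assms by (auto simp: hom_def)

lemma comp_assoc [simp]:
  assumes "f \<in> Arr C" "g \<in> Arr C" "h \<in> Arr C" "Dom C g = Cod C f" "Dom C h = Cod C g"
  shows "(h \<cdot> g) \<cdot> f = h \<cdot> (g \<cdot> f)"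
  using Comp_assoc[of f "Dom C f" "Cod C f" g "Cod C g" h "Cod C h"] assms by (auto simp: hom_def)

lemma ident_arr [simp]:
  assumes "X \<in> Obj C"
  shows "Ident C X \<in> Arr C" "Dom C (Ident C X) = X" "Cod C (Ident C X) = X"
  using Ident_hom[OF assms] by (auto simp: hom_def)

lemma comp_ident [simp]: "f \<in> Arr C \<Longrightarrow> Dom C f = X \<Longrightarrow> f \<cdot> Ident C X = f"
  using Comp_Ident[of f] by (auto simp: hom_def)

lemma ident_comp [simp]: "f \<in> Arr C \<Longrightarrow> Cod C f = X \<Longrightarrow> Ident C X \<cdot> f = f"
  using Ident_Comp[of f] by (auto simp: hom_def)

lemma obj_arr [simp]: "f \<in> Arr C \<Longrightarrow> Dom C f \<in> Obj C" "f \<in> Arr C \<Longrightarrow> Cod C f \<in> Obj C"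
  using Dom_in Cod_in by auto

text \<open>Composites are kept associated to the right, so \<open>a \<cdot> b\<close> does not
  occur in \<open>a \<cdot> (b \<cdot> x)\<close>; an equation between composites therefore has to
  be restated with a trailing arrow before it can be used there.\<close>

lemma comp_eq_extend:
  assumes "a \<cdot> b = c \<cdot> d"
    and "a \<in> Arr C" "b \<in> Arr C" "c \<in> Arr C" "d \<in> Arr C" "x \<in> Arr C"
    and "Dom C a = Cod C b" "Dom C c = Cod C d" "Cod C x = Dom C b" "Cod C x = Dom C d"
  shows "a \<cdot> (b \<cdot> x) = c \<cdot> (d \<cdot> x)"
proof -
  have "a \<cdot> (b \<cdot> x) = (a \<cdot> b) \<cdot> x"
    using assms(2-) by simp
  also have "\<dots> = c \<cdot> (d \<cdot> x)"
    unfolding assms(1) using assms(2-) by simp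
  finally show ?thesis .
qed

lemma comp_eq_extend1:
  assumes "a \<cdot> b = c"
    and "a \<in> Arr C" "b \<in> Arr C" "x \<in> Arr C" "Dom C a = Cod C b" "Cod C x = Dom C b"
  shows "a \<cdot> (b \<cdot> x) = c \<cdot> x"
  unfolding assms(1)[symmetric] using assms(2-) by simp

end

text \<open>This is monicity of the induced arrow into a product, expressed on the legs alone
  because products are not chosen; \<open>product_pair_monic\<close> and
  \<open>is_relation_iff\<close> make the link.\<close>

definition jointly_monic :: "('o, 'a) cat \<Rightarrow> 'a \<times> 'a \<Rightarrow> bool" where
  "jointly_monic C r \<longleftrightarrow> fst r \<in> Arr C \<and> snd r \<in> Arr C \<and> Dom C (fst r) = Dom C (snd r) \<and>
     (\<forall>Z. \<forall>a \<in> hom C Z (Dom C (fst r)). \<forall>b \<in> hom C Z (Dom C (fst r)).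
        fst r \<cdot>\<^bsub>C\<^esub> a = fst r \<cdot>\<^bsub>C\<^esub> b \<longrightarrow> snd r \<cdot>\<^bsub>C\<^esub> a = snd r \<cdot>\<^bsub>C\<^esub> b \<longrightarrow> a = b)"

text \<open>Membership of the pair \<open>(x, y)\<close> of generalised elements in the relation \<open>r\<close>.\<close>

definition mem :: "('o, 'a) cat \<Rightarrow> 'a \<times> 'a \<Rightarrow> 'a \<Rightarrow> 'a \<Rightarrow> bool" where
  "mem C r x y \<longleftrightarrow>
     (\<exists>h \<in> hom C (Dom C x) (Dom C (fst r)). fst r \<cdot>\<^bsub>C\<^esub> h = x \<and> snd r \<cdot>\<^bsub>C\<^esub> h = y)"

lemma jointly_monicD:
  assumes "jointly_monic C r"
  shows "fst r \<in> Arr C" "snd r \<in> Arr C" "Dom C (snd r) = Dom C (fst r)"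
  using assms by (auto simp: jointly_monic_def)

lemma jointly_monic_cancel:
  assumes "jointly_monic C r" "fst r \<cdot>\<^bsub>C\<^esub> a = fst r \<cdot>\<^bsub>C\<^esub> b" "snd r \<cdot>\<^bsub>C\<^esub> a = snd r \<cdot>\<^bsub>C\<^esub> b"
    and "a \<in> Arr C" "b \<in> Arr C" "Dom C a = Dom C b"
    and "Cod C a = Dom C (fst r)" "Cod C b = Dom C (fst r)"
  shows "a = b"
  using assms unfolding jointly_monic_def hom_def by blast

lemma monic_cancel:
  assumes "monic C m" "m \<cdot>\<^bsub>C\<^esub> a = m \<cdot>\<^bsub>C\<^esub> b" "a \<in> Arr C" "b \<in> Arr C" "Dom C a = Dom C b"
    "Cod C a = Dom C m" "Cod C b = Dom C m"
  shows "a = b"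
  using assms unfolding monic_def hom_def by blast

lemma memI:
  assumes "h \<in> Arr C" "Dom C h = Dom C x" "Cod C h = Dom C (fst r)"
    "fst r \<cdot>\<^bsub>C\<^esub> h = x" "snd r \<cdot>\<^bsub>C\<^esub> h = y"
  shows "mem C r x y"
  using assms by (auto simp: mem_def hom_def)

lemma memE:
  assumes "mem C r x y"
  obtains h where "h \<in> Arr C" "Dom C h = Dom C x" "Cod C h = Dom C (fst r)"
    "fst r \<cdot>\<^bsub>C\<^esub> h = x" "snd r \<cdot>\<^bsub>C\<^esub> h = y"
  using assms by (auto simp: mem_def hom_def)

lemma is_pullbackD:
  assumes "is_pullback C f g p q"
  shows "f \<in> Arr C" "g \<in> Arr C" "Cod C g = Cod C f" "p \<in> Arr C" "q \<in> Arr C"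
    "Dom C q = Dom C p" "Cod C p = Dom C f" "Cod C q = Dom C g" "f \<cdot>\<^bsub>C\<^esub> p = g \<cdot>\<^bsub>C\<^esub> q"
  using assms by (auto simp: is_pullback_def)

lemma pullback_factor:
  assumes "is_pullback C f g p q" "a \<in> Arr C" "b \<in> Arr C" "Dom C b = Dom C a"
    "Cod C a = Dom C f" "Cod C b = Dom C g" "f \<cdot>\<^bsub>C\<^esub> a = g \<cdot>\<^bsub>C\<^esub> b"
  obtains h where "h \<in> Arr C" "Dom C h = Dom C a" "Cod C h = Dom C p"
    "p \<cdot>\<^bsub>C\<^esub> h = a" "q \<cdot>\<^bsub>C\<^esub> h = b"
proof -
  have "a \<in> hom C (Dom C a) (Dom C f)" "b \<in> hom C (Dom C a) (Dom C g)"
    using assms by (auto simp: hom_def)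
  then have "\<exists>!h. h \<in> hom C (Dom C a) (Dom C p) \<and> p \<cdot>\<^bsub>C\<^esub> h = a \<and> q \<cdot>\<^bsub>C\<^esub> h = b"
    using assms(1,7) unfolding is_pullback_def by blast
  then show thesis
    using that by (auto simp: hom_def)
qed

lemma (in category) pullback_jointly_monic:
  assumes "is_pullback C f g p q"
  shows "jointly_monic C (p, q)"
proof -
  note [simp] = is_pullbackD[OF assms]
  have "a = b" if "a \<in> hom C Z (Dom C p)" "b \<in> hom C Z (Dom C p)"
    "p \<cdot> a = p \<cdot> b" "q \<cdot> a = q \<cdot> b" for Z a b
  proof -
    have [simp]: "a \<in> Arr C" "b \<in> Arr C" "Dom C a = Z" "Dom C b = Z"
      "Cod C a = Dom C p" "Cod C b = Dom C p"
      using that by (auto simp: hom_def)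
    have "p \<cdot> a \<in> hom C Z (Dom C f)" "q \<cdot> a \<in> hom C Z (Dom C g)"
      by (auto simp: hom_def)
    moreover have "f \<cdot> (p \<cdot> a) = g \<cdot> (q \<cdot> a)"
      by (rule comp_eq_extend) auto
    ultimately have "\<exists>!h. h \<in> hom C Z (Dom C p) \<and> p \<cdot> h = p \<cdot> a \<and> q \<cdot> h = q \<cdot> a"
      using assms unfolding is_pullback_def by blast
    then show ?thesis
      using that by metis
  qed
  then show ?thesis
    by (auto simp: jointly_monic_def)
qed

text \<open>Uniqueness of the mediating arrow is supplied by joint monicity of the projections and
  existence by membership, the two forms in which later constructions provide them.\<close>

lemma (in category) is_pullbackI:
  assumes "f \<in> Arr C" "g \<in> Arr C" "Cod C f = Cod C g"
    and "Cod C p = Dom C f" "Cod C q = Dom C g" "f \<cdot> p = g \<cdot> q"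
    and mono: "jointly_monic C (p, q)"
    and ex: "\<And>a b. \<lbrakk>a \<in> Arr C; b \<in> Arr C; Dom C b = Dom C a; Cod C a = Dom C f;
      Cod C b = Dom C g; f \<cdot> a = g \<cdot> b\<rbrakk> \<Longrightarrow> mem C (p, q) a b"
  shows "is_pullback C f g p q"
proof -
  have "\<exists>!h. h \<in> hom C Z (Dom C p) \<and> p \<cdot> h = a \<and> q \<cdot> h = b"
    if ab: "a \<in> hom C Z (Dom C f)" "b \<in> hom C Z (Dom C g)" "f \<cdot> a = g \<cdot> b" for Z a b
  proof -
    have "mem C (p, q) a b"
      using that ex by (auto simp: hom_def)
    then obtain h where "h \<in> hom C Z (Dom C p)" "p \<cdot> h = a" "q \<cdot> h = b"
      using ab(1) by (auto simp: mem_def hom_def)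
    then show ?thesis
      using mono unfolding jointly_monic_def by (intro ex1I[of _ h]) auto
  qed
  then show ?thesis
    using assms jointly_monicD[OF mono] by (auto simp: is_pullback_def)
qed

lemma (in category) isomorphismE:
  assumes "isomorphism C i"
  obtains j where "j \<in> Arr C" "Dom C j = Cod C i" "Cod C j = Dom C i"
    "j \<cdot> i = Ident C (Dom C i)" "i \<cdot> j = Ident C (Cod C i)"
  using assms by (auto simp: isomorphism_def hom_def)

text \<open>Together with \<open>pullback_iso\<close>, this transfers what is known of one
  constructed pullback to an arbitrary pullback of the same arrows.\<close>

lemma (in category) pullback_unique:
  assumes pb: "is_pullback C f g p q" and pb': "is_pullback C f g p' q'"
  obtains i where "isomorphism C i" "Dom C i = Dom C p'" "Cod C i = Dom C p"
    "p \<cdot> i = p'" "q \<cdot> i = q'"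
proof -
  note [simp] = is_pullbackD[OF pb] is_pullbackD(4-8)[OF pb']
  have eq': "f \<cdot> p' = g \<cdot> q'"
    using is_pullbackD(9)[OF pb'] .
  obtain i where i [simp]: "i \<in> Arr C" "Dom C i = Dom C p'" "Cod C i = Dom C p"
    and i_eq: "p \<cdot> i = p'" "q \<cdot> i = q'"
    by (rule pullback_factor[OF pb, of p' q']) (use eq' in simp_all)
  obtain j where j [simp]: "j \<in> Arr C" "Dom C j = Dom C p" "Cod C j = Dom C p'"
    and j_eq: "p' \<cdot> j = p" "q' \<cdot> j = q"
    by (rule pullback_factor[OF pb', of p q]) simp_all
  have "p \<cdot> (i \<cdot> j) = p" "q \<cdot> (i \<cdot> j) = q"
    using comp_eq_extend1[OF i_eq(1), of j] comp_eq_extend1[OF i_eq(2), of j] j_eq by simp_all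
  then have ij: "i \<cdot> j = Ident C (Dom C p)"
    by - (rule jointly_monic_cancel[OF pullback_jointly_monic[OF pb]], auto)
  have "p' \<cdot> (j \<cdot> i) = p'" "q' \<cdot> (j \<cdot> i) = q'"
    using comp_eq_extend1[OF j_eq(1), of i] comp_eq_extend1[OF j_eq(2), of i] i_eq by simp_all
  then have ji: "j \<cdot> i = Ident C (Dom C p')"
    by - (rule jointly_monic_cancel[OF pullback_jointly_monic[OF pb']], auto)
  have "isomorphism C i"
    unfolding isomorphism_def using ij ji by (intro conjI bexI[of _ j]) (auto simp: hom_def)
  then show thesis
    using that i i_eq by blast
qed

lemma (in category) pullback_iso:
  assumes pb: "is_pullback C f g p q" and iso: "isomorphism C i" and cod: "Cod C i = Dom C p"
  shows "is_pullback C f g (p \<cdot> i) (q \<cdot> i)"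
proof -
  note [simp] = is_pullbackD[OF pb] cod
  have [simp]: "i \<in> Arr C"
    using iso by (simp add: isomorphism_def)
  obtain j where j [simp]: "j \<in> Arr C" "Dom C j = Cod C i" "Cod C j = Dom C i"
    and ji: "j \<cdot> i = Ident C (Dom C i)" and ij: "i \<cdot> j = Ident C (Cod C i)"
    using isomorphismE[OF iso] .
  show ?thesis
  proof (rule is_pullbackI)
    show "f \<cdot> (p \<cdot> i) = g \<cdot> (q \<cdot> i)"
      by (rule comp_eq_extend) auto
    have "a = b" if "a \<in> hom C Z (Dom C i)" "b \<in> hom C Z (Dom C i)"
      "(p \<cdot> i) \<cdot> a = (p \<cdot> i) \<cdot> b" "(q \<cdot> i) \<cdot> a = (q \<cdot> i) \<cdot> b" for Z a b
    proof -
      have [simp]: "a \<in> Arr C" "b \<in> Arr C" "Dom C a = Z" "Dom C b = Z"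
        "Cod C a = Dom C i" "Cod C b = Dom C i"
        using that by (auto simp: hom_def)
      have "i \<cdot> a = i \<cdot> b"
        by (rule jointly_monic_cancel[OF pullback_jointly_monic[OF pb]]) (use that in auto)
      then have "j \<cdot> (i \<cdot> a) = j \<cdot> (i \<cdot> b)"
        by simp
      then show "a = b"
        using comp_eq_extend1[OF ji, of a] comp_eq_extend1[OF ji, of b] by simp
    qed
    then show "jointly_monic C (p \<cdot> i, q \<cdot> i)"
      by (auto simp: jointly_monic_def)
    fix a b
    assume ab [simp]: "a \<in> Arr C" "b \<in> Arr C" "Dom C b = Dom C a" "Cod C a = Dom C f"
      "Cod C b = Dom C g" and eq: "f \<cdot> a = g \<cdot> b"
    obtain h where h [simp]: "h \<in> Arr C" "Dom C h = Dom C a" "Cod C h = Dom C p"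
      and "p \<cdot> h = a" "q \<cdot> h = b"
      by (rule pullback_factor[OF pb ab eq])
    then show "mem C (p \<cdot> i, q \<cdot> i) a b"
      using comp_eq_extend1[OF ij, of h] by (intro memI[of "j \<cdot> h"]) auto
  qed auto
qed

section \<open>Products and pullbacks from finite limits\<close>

definition discrete_pair :: "(nat, nat) cat" where
  "discrete_pair = \<lparr>Obj = {0, 1}, Arr = {0, 1}, Dom = id, Cod = id, Ident = id,
     Comp = (\<lambda>v u. u)\<rparr>"

text \<open>The arrows \<open>0, 1, 2\<close> are the identities, \<open>3 : 0 \<rightarrow> 2\<close> and \<open>4 : 1 \<rightarrow> 2\<close>.\<close>

definition cospan :: "(nat, nat) cat" where
  "cospan = \<lparr>Obj = {0, 1, 2}, Arr = {0, 1, 2, 3, 4},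
     Dom = (\<lambda>u. if u = 3 then 0 else if u = 4 then 1 else u),
     Cod = (\<lambda>u. if u = 3 \<or> u = 4 then 2 else u), Ident = id,
     Comp = (\<lambda>v u. if u = 3 \<or> u = 4 then u else v)\<rparr>"

lemma category_discrete_pair: "category discrete_pair"
  by unfold_locales (auto simp: discrete_pair_def hom_def)

lemma finite_discrete_pair: "finite (Obj discrete_pair)" "finite (Arr discrete_pair)"
  by (auto simp: discrete_pair_def)

lemma category_cospan: "category cospan"
  by unfold_locales (auto simp: cospan_def hom_def split: if_splits)

lemma finite_cospan: "finite (Obj cospan)" "finite (Arr cospan)"
  by (auto simp: cospan_def)

lemma is_limit_factor:
  assumes "is_limit J C Fo Fa L \<pi>" "is_cone J C Fo Fa M \<mu>"
  obtains h where "h \<in> hom C M L" "\<And>j. j \<in> Obj J \<Longrightarrow> \<pi> j \<cdot>\<^bsub>C\<^esub> h = \<mu> j"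
proof -
  have "\<exists>!h. h \<in> hom C M L \<and> (\<forall>j \<in> Obj J. \<pi> j \<cdot>\<^bsub>C\<^esub> h = \<mu> j)"
    using assms by (simp add: is_limit_def)
  then show thesis
    using that by blast
qed

text \<open>Both arrows mediate the cone obtained by composing the limit cone with \<open>a\<close>,
  so they coincide. Equations between arrows into a limit are later verified one component at a time
  with this.\<close>

lemma (in category) is_limit_cancel:
  assumes lim: "is_limit J C Fo Fa L \<pi>" and J: "category J" and F: "is_functor J C Fo Fa"
    and [simp]: "a \<in> Arr C" "b \<in> Arr C" "Dom C a = Dom C b" "Cod C a = L" "Cod C b = L"
    and eq: "\<And>j. j \<in> Obj J \<Longrightarrow> \<pi> j \<cdot> a = \<pi> j \<cdot> b"
  shows "a = b"
proof -
  interpret J: category J by (fact J)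
  have cone: "is_cone J C Fo Fa L \<pi>"
    using lim by (simp add: is_limit_def)
  then have [simp]: "\<pi> j \<in> Arr C" "Dom C (\<pi> j) = L" "Cod C (\<pi> j) = Fo j" if "j \<in> Obj J" for j
    using that by (auto simp: is_cone_def hom_def)
  have [simp]: "Fa u \<in> Arr C" "Dom C (Fa u) = Fo (Dom J u)" "Cod C (Fa u) = Fo (Cod J u)"
    if "u \<in> Arr J" for u
    using F that by (auto simp: is_functor_def hom_def)
  have "Fa u \<cdot> (\<pi> (Dom J u) \<cdot> a) = \<pi> (Cod J u) \<cdot> a" if "u \<in> Arr J" for u
    using that cone by (intro comp_eq_extend1) (auto simp: is_cone_def)
  then have "is_cone J C Fo Fa (Dom C a) (\<lambda>j. \<pi> j \<cdot> a)"
    by (auto simp: is_cone_def hom_def)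
  then have "\<exists>!h. h \<in> hom C (Dom C a) L \<and> (\<forall>j \<in> Obj J. \<pi> j \<cdot> h = \<pi> j \<cdot> a)"
    using lim by (auto simp: is_limit_def)
  moreover have "a \<in> hom C (Dom C a) L" "b \<in> hom C (Dom C a) L"
    by (auto simp: hom_def)
  ultimately show ?thesis
    using eq by metis
qed

lemma is_productD:
  assumes "is_product C X Y p q"
  shows "p \<in> Arr C" "q \<in> Arr C" "Dom C q = Dom C p" "Cod C p = X" "Cod C q = Y"
  using assms by (auto simp: is_product_def)

lemma product_factor:
  assumes "is_product C X Y p q" "a \<in> Arr C" "b \<in> Arr C" "Dom C b = Dom C a"
    "Cod C a = X" "Cod C b = Y"
  obtains h where "h \<in> Arr C" "Dom C h = Dom C a" "Cod C h = Dom C p"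
    "p \<cdot>\<^bsub>C\<^esub> h = a" "q \<cdot>\<^bsub>C\<^esub> h = b"
proof -
  have "a \<in> hom C (Dom C a) X" "b \<in> hom C (Dom C a) Y"
    using assms by (auto simp: hom_def)
  then have "\<exists>!h. h \<in> hom C (Dom C a) (Dom C p) \<and> p \<cdot>\<^bsub>C\<^esub> h = a \<and> q \<cdot>\<^bsub>C\<^esub> h = b"
    using assms(1) unfolding is_product_def by blast
  then show thesis
    using that by (auto simp: hom_def)
qed

lemma (in category) product_jointly_monic:
  assumes "is_product C X Y p q"
  shows "jointly_monic C (p, q)"
proof -
  note [simp] = is_productD[OF assms]
  have "a = b" if "a \<in> hom C Z (Dom C p)" "b \<in> hom C Z (Dom C p)"
    "p \<cdot> a = p \<cdot> b" "q \<cdot> a = q \<cdot> b" for Z a b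
  proof -
    have "p \<cdot> a \<in> hom C Z X" "q \<cdot> a \<in> hom C Z Y"
      using that by (auto simp: hom_def)
    then have "\<exists>!h. h \<in> hom C Z (Dom C p) \<and> p \<cdot> h = p \<cdot> a \<and> q \<cdot> h = q \<cdot> a"
      using assms unfolding is_product_def by blast
    then show ?thesis
      using that by metis
  qed
  then show ?thesis
    by (auto simp: jointly_monic_def)
qed

context category
begin

lemma product_exists:
  assumes "finitely_complete C" and [simp]: "X \<in> Obj C" "Y \<in> Obj C"
  obtains p q where "is_product C X Y p q"
proof -
  define Fo where "Fo = (\<lambda>j::nat. if j = 0 then X else Y)"
  define Fa where "Fa = (\<lambda>j. Ident C (Fo j))"
  have F: "is_functor discrete_pair C Fo Fa"
    by (auto simp: is_functor_def discrete_pair_def Fo_def Fa_def hom_def)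
  then obtain L \<pi> where lim: "is_limit discrete_pair C Fo Fa L \<pi>"
    using assms(1) category_discrete_pair finite_discrete_pair
    unfolding finitely_complete_def by blast
  then have cone: "is_cone discrete_pair C Fo Fa L \<pi>"
    by (simp add: is_limit_def)
  then have [simp]: "\<pi> 0 \<in> Arr C" "Dom C (\<pi> 0) = L" "Cod C (\<pi> 0) = X"
    "\<pi> 1 \<in> Arr C" "Dom C (\<pi> 1) = L" "Cod C (\<pi> 1) = Y"
    by (auto simp: is_cone_def discrete_pair_def Fo_def hom_def)
  have "\<exists>!h. h \<in> hom C Z L \<and> \<pi> 0 \<cdot> h = a \<and> \<pi> 1 \<cdot> h = b"
    if "a \<in> hom C Z X" "b \<in> hom C Z Y" for Z a b
  proof -
    have "is_cone discrete_pair C Fo Fa Z (\<lambda>j. if j = 0 then a else b)"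
      using that by (auto simp: is_cone_def discrete_pair_def Fo_def Fa_def hom_def)
    then have "\<exists>!h. h \<in> hom C Z L \<and> (\<forall>j \<in> Obj discrete_pair. \<pi> j \<cdot> h = (if j = 0 then a else b))"
      using lim unfolding is_limit_def by blast
    then show ?thesis
      by (auto simp: discrete_pair_def)
  qed
  then have "is_product C X Y (\<pi> 0) (\<pi> 1)"
    by (simp add: is_product_def del: One_nat_def)
  then show thesis
    by (rule that)
qed

definition cospan_obj :: "'a \<Rightarrow> 'a \<Rightarrow> nat \<Rightarrow> 'o" where
  "cospan_obj f g j = (if j = 0 then Dom C f else if j = 1 then Dom C g else Cod C f)"

definition cospan_arr :: "'a \<Rightarrow> 'a \<Rightarrow> nat \<Rightarrow> 'a" where
  "cospan_arr f g u = (if u = 3 then f else if u = 4 then g else Ident C (cospan_obj f g u))"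

lemma cospan_functor:
  assumes "f \<in> Arr C" "g \<in> Arr C" "Cod C f = Cod C g"
  shows "is_functor cospan C (cospan_obj f g) (cospan_arr f g)"
  using assms by (auto simp: is_functor_def cospan_def cospan_obj_def cospan_arr_def hom_def)

lemma cospan_limit_pullback:
  assumes lim: "is_limit cospan C Fo Fa L \<pi>" and F: "is_functor cospan C Fo Fa"
  shows "is_pullback C (Fa 3) (Fa 4) (\<pi> 0) (\<pi> 1)"
proof -
  have cone: "is_cone cospan C Fo Fa L \<pi>"
    using lim by (simp add: is_limit_def)
  have [simp]: "\<pi> j \<in> Arr C" "Dom C (\<pi> j) = L" "Cod C (\<pi> j) = Fo j" if "j \<in> {0,1,2}" for j
    using cone that by (auto simp: is_cone_def cospan_def hom_def)
  have [simp]: "Fa 3 \<in> Arr C" "Dom C (Fa 3) = Fo 0" "Cod C (Fa 3) = Fo 2"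
    "Fa 4 \<in> Arr C" "Dom C (Fa 4) = Fo 1" "Cod C (Fa 4) = Fo 2"
    using F by (auto simp: is_functor_def cospan_def hom_def)
  have id: "Fa j = Ident C (Fo j)" if "j \<in> {0,1,2}" for j
    using F that by (auto simp: is_functor_def cospan_def)
  have eq: "Fa 3 \<cdot> \<pi> 0 = \<pi> 2" "Fa 4 \<cdot> \<pi> 1 = \<pi> 2"
    using cone by (auto simp: is_cone_def cospan_def)
  show ?thesis
  proof (rule is_pullbackI)
    have "a = b" if "a \<in> hom C Z L" "b \<in> hom C Z L"
      "\<pi> 0 \<cdot> a = \<pi> 0 \<cdot> b" "\<pi> 1 \<cdot> a = \<pi> 1 \<cdot> b" for Z a b
    proof (rule is_limit_cancel[OF lim category_cospan F])
      have "\<pi> 2 \<cdot> a = \<pi> 2 \<cdot> b"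
        using that comp_eq_extend1[OF eq(1), of a] comp_eq_extend1[OF eq(1), of b]
        by (auto simp: hom_def)
      then show "\<And>j. j \<in> Obj cospan \<Longrightarrow> \<pi> j \<cdot> a = \<pi> j \<cdot> b"
        using that by (auto simp: cospan_def)
    qed (use that in \<open>auto simp: hom_def\<close>)
    then show "jointly_monic C (\<pi> 0, \<pi> 1)"
      by (auto simp: jointly_monic_def)
    fix a b
    assume [simp]: "a \<in> Arr C" "b \<in> Arr C" "Dom C b = Dom C a" "Cod C a = Dom C (Fa 3)"
      "Cod C b = Dom C (Fa 4)" and ab: "Fa 3 \<cdot> a = Fa 4 \<cdot> b"
    \<comment> \<open>The leg at the common codomain is forced: it is the common composite of the
      two sides.\<close>
    define \<mu> where "\<mu> = (\<lambda>j::nat. if j = 0 then a else if j = 1 then b else Fa 3 \<cdot> a)"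
    have "is_cone cospan C Fo Fa (Dom C a) \<mu>"
      using ab by (auto simp: is_cone_def cospan_def \<mu>_def hom_def id)
    then obtain h where "h \<in> hom C (Dom C a) L" "\<And>j. j \<in> Obj cospan \<Longrightarrow> \<pi> j \<cdot> h = \<mu> j"
      using is_limit_factor[OF lim] by blast
    from this(1) this(2)[of 0] this(2)[of 1] show "mem C (\<pi> 0, \<pi> 1) a b"
      by (intro memI[of h]) (auto simp: hom_def \<mu>_def cospan_def)
  qed (use eq in auto)
qed

lemma pullback_exists:
  assumes fc: "finitely_complete C" and fg: "f \<in> Arr C" "g \<in> Arr C" "Cod C f = Cod C g"
  obtains p q where "is_pullback C f g p q"
proof -
  obtain L \<pi> where "is_limit cospan C (cospan_obj f g) (cospan_arr f g) L \<pi>"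
    using fc cospan_functor[OF fg] category_cospan finite_cospan
    unfolding finitely_complete_def by blast
  from cospan_limit_pullback[OF this cospan_functor[OF fg]] that show thesis
    by (simp add: cospan_arr_def)
qed

end

section \<open>Regular epimorphisms\<close>

context category
begin

lemma is_coequaliserD:
  assumes "is_coequaliser C u v e"
  shows "u \<in> Arr C" "v \<in> Arr C" "Dom C v = Dom C u" "Cod C v = Cod C u" "e \<in> Arr C"
    "Dom C e = Cod C u" "e \<cdot> u = e \<cdot> v"
  using assms by (auto simp: is_coequaliser_def)

lemma coequaliser_factor:
  assumes "is_coequaliser C u v e" "k \<in> Arr C" "Dom C k = Cod C u" "k \<cdot> u = k \<cdot> v"
  obtains h where "h \<in> Arr C" "Dom C h = Cod C e" "Cod C h = Cod C k" "h \<cdot> e = k"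
proof -
  have "k \<in> hom C (Cod C u) (Cod C k)"
    using assms by (auto simp: hom_def)
  then have "\<exists>!h. h \<in> hom C (Cod C e) (Cod C k) \<and> h \<cdot> e = k"
    using assms(1,4) by (simp add: is_coequaliser_def)
  then show thesis
    using that by (auto simp: hom_def)
qed

lemma regular_epi_arr: "regular_epi C e \<Longrightarrow> e \<in> Arr C"
  by (auto simp: regular_epi_def is_coequaliser_def)

text \<open>The composite \<open>a \<cdot> e\<close> coequalises the pair of which \<open>e\<close>
  is the coequaliser, and both \<open>a\<close> and \<open>b\<close> are factorisations of it
  through \<open>e\<close>.\<close>

lemma regular_epi_cancel:
  assumes "regular_epi C e" "a \<cdot> e = b \<cdot> e" and [simp]: "a \<in> Arr C" "b \<in> Arr C"
    "Dom C a = Cod C e" "Dom C b = Cod C e" "Cod C a = Cod C b"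
  shows "a = b"
proof -
  obtain u v where uv: "is_coequaliser C u v e"
    using assms by (auto simp: regular_epi_def)
  note [simp] = is_coequaliserD[OF uv]
  have "(a \<cdot> e) \<cdot> u = (a \<cdot> e) \<cdot> v"
    by simp
  moreover have "a \<cdot> e \<in> hom C (Cod C u) (Cod C a)"
    by (simp add: hom_def)
  ultimately have "\<exists>!h. h \<in> hom C (Cod C e) (Cod C a) \<and> h \<cdot> e = a \<cdot> e"
    using uv unfolding is_coequaliser_def by blast
  moreover have "a \<in> hom C (Cod C e) (Cod C a)" "b \<in> hom C (Cod C e) (Cod C a)"
    by (auto simp: hom_def)
  ultimately show ?thesis
    using assms(2) by metis
qed

lemma is_coequaliserI:
  assumes "u \<in> Arr C" "v \<in> Arr C" "Dom C u = Dom C v" "Cod C u = Cod C v" "e \<in> Arr C"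
    "Dom C e = Cod C u" "e \<cdot> u = e \<cdot> v"
    and factor: "\<And>k. \<lbrakk>k \<in> Arr C; Dom C k = Cod C u; k \<cdot> u = k \<cdot> v\<rbrakk> \<Longrightarrow>
      \<exists>h \<in> hom C (Cod C e) (Cod C k). h \<cdot> e = k"
    and epi: "\<And>a b. \<lbrakk>a \<in> Arr C; b \<in> Arr C; Dom C a = Cod C e; Dom C b = Cod C e;
      Cod C a = Cod C b; a \<cdot> e = b \<cdot> e\<rbrakk> \<Longrightarrow> a = b"
  shows "is_coequaliser C u v e"
proof -
  have "\<exists>!h. h \<in> hom C (Cod C e) Z \<and> h \<cdot> e = k"
    if k: "k \<in> hom C (Cod C u) Z" "k \<cdot> u = k \<cdot> v" for Z k
  proof -
    obtain h where "h \<in> hom C (Cod C e) Z" "h \<cdot> e = k"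
      using factor[of k] k by (auto simp: hom_def)
    moreover have "h' = h" if "h' \<in> hom C (Cod C e) Z" "h' \<cdot> e = k" for h'
      using that calculation by - (rule epi, simp_all add: hom_def)
    ultimately show ?thesis
      by blast
  qed
  then show ?thesis
    using assms(1-7) by (simp add: is_coequaliser_def)
qed

text \<open>The same parallel pair works: a factorisation through \<open>e\<close> becomes one
  through \<open>i \<cdot> e\<close> by composing with the inverse of \<open>i\<close>.\<close>

lemma regular_epi_iso_comp:
  assumes "regular_epi C e" and iso: "isomorphism C i" and dom [simp]: "Dom C i = Cod C e"
  shows "regular_epi C (i \<cdot> e)"
proof -
  obtain u v where uv: "is_coequaliser C u v e"
    using assms by (auto simp: regular_epi_def)
  note [simp] = is_coequaliserD[OF uv]
  have [simp]: "i \<in> Arr C"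
    using iso by (simp add: isomorphism_def)
  obtain j where j [simp]: "j \<in> Arr C" "Dom C j = Cod C i" "Cod C j = Dom C i"
    and ji: "j \<cdot> i = Ident C (Dom C i)" and ij: "i \<cdot> j = Ident C (Cod C i)"
    using isomorphismE[OF iso] .
  have "is_coequaliser C u v (i \<cdot> e)"
  proof (rule is_coequaliserI)
    fix k assume k [simp]: "k \<in> Arr C" "Dom C k = Cod C u" and ku: "k \<cdot> u = k \<cdot> v"
    obtain h where [simp]: "h \<in> Arr C" "Dom C h = Cod C e" "Cod C h = Cod C k" and h: "h \<cdot> e = k"
      by (rule coequaliser_factor[OF uv k ku])
    have "j \<cdot> (i \<cdot> e) = e"
      using comp_eq_extend1[OF ji, of e] by simp
    then show "\<exists>h \<in> hom C (Cod C (i \<cdot> e)) (Cod C k). h \<cdot> (i \<cdot> e) = k"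
      using h by (intro bexI[of _ "h \<cdot> j"]) (auto simp: hom_def)
  next
    fix a b
    assume [simp]: "a \<in> Arr C" "b \<in> Arr C" "Dom C a = Cod C (i \<cdot> e)" "Dom C b = Cod C (i \<cdot> e)"
      "Cod C a = Cod C b" and eq: "a \<cdot> (i \<cdot> e) = b \<cdot> (i \<cdot> e)"
    have "a \<cdot> i = b \<cdot> i"
      by (rule regular_epi_cancel[OF assms(1)]) (use eq in auto)
    then have "(a \<cdot> i) \<cdot> j = (b \<cdot> i) \<cdot> j"
      by simp
    then show "a = b"
      by (simp add: ij)
  qed auto
  then show ?thesis
    by (auto simp: regular_epi_def)
qed

text \<open>Any pair coequalised by \<open>e\<close> factors through its kernel pair, so an arrow
  that identifies the kernel pair also identifies the pair of which \<open>e\<close> is the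
  coequaliser.\<close>

lemma kernel_pair_is_coequaliser:
  assumes "regular_epi C e" and pb: "is_pullback C e e p q"
  shows "is_coequaliser C p q e"
proof -
  obtain u v where uv: "is_coequaliser C u v e"
    using assms by (auto simp: regular_epi_def)
  note [simp] = is_coequaliserD(1-6)[OF uv] is_pullbackD(1,4-9)[OF pb]
  obtain w where w [simp]: "w \<in> Arr C" "Dom C w = Dom C u" "Cod C w = Dom C p"
    and pw: "p \<cdot> w = u" and qw: "q \<cdot> w = v"
    by (rule pullback_factor[OF pb is_coequaliserD(1,2)[OF uv]])
      (use is_coequaliserD(7)[OF uv] in simp_all)
  show ?thesis
  proof (rule is_coequaliserI)
    fix k assume k [simp]: "k \<in> Arr C" "Dom C k = Cod C p" and kp: "k \<cdot> p = k \<cdot> q"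
    have "k \<cdot> (p \<cdot> w) = k \<cdot> (q \<cdot> w)"
      by (rule comp_eq_extend[OF kp]) auto
    then have kuv: "k \<cdot> u = k \<cdot> v"
      by (simp add: pw qw)
    have dom: "Dom C k = Cod C u"
      by simp
    obtain h where "h \<in> Arr C" "Dom C h = Cod C e" "Cod C h = Cod C k" "h \<cdot> e = k"
      by (rule coequaliser_factor[OF uv k(1) dom kuv])
    then show "\<exists>h \<in> hom C (Cod C e) (Cod C k). h \<cdot> e = k"
      by (intro bexI[of _ h]) (simp_all add: hom_def)
  next
    fix a b
    assume "a \<in> Arr C" "b \<in> Arr C" "Dom C a = Cod C e" "Dom C b = Cod C e"
      "Cod C a = Cod C b" "a \<cdot> e = b \<cdot> e"
    then show "a = b"
      using regular_epi_cancel[OF assms(1)] by blast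
  qed simp_all
qed

section \<open>Generalised elements of relations and descent along regular epimorphisms\<close>

lemma mem_arrD:
  assumes "jointly_monic C r" "mem C r x y"
  shows "x \<in> Arr C" "y \<in> Arr C" "Dom C y = Dom C x" "Cod C x = Cod C (fst r)"
    "Cod C y = Cod C (snd r)"
proof -
  note [simp] = jointly_monicD[OF assms(1)]
  obtain h where [simp]: "h \<in> Arr C" "Dom C h = Dom C x" "Cod C h = Dom C (fst r)"
    and h: "x = fst r \<cdot> h" "y = snd r \<cdot> h"
    using assms(2) by (auto simp: mem_def hom_def)
  show "x \<in> Arr C" "Cod C x = Cod C (fst r)"
    by (subst h, simp)+
  show "y \<in> Arr C" "Dom C y = Dom C x" "Cod C y = Cod C (snd r)"
    by (simp_all add: h(2))
qed

lemma mem_comp: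
  assumes jm: "jointly_monic C r" and xy: "mem C r x y" and [simp]: "k \<in> Arr C" "Cod C k = Dom C x"
  shows "mem C r (x \<cdot> k) (y \<cdot> k)"
proof -
  note [simp] = jointly_monicD[OF jm] mem_arrD[OF jm xy]
  obtain h where [simp]: "h \<in> Arr C" "Dom C h = Dom C x" "Cod C h = Dom C (fst r)"
    and "fst r \<cdot> h = x" "snd r \<cdot> h = y"
    using memE[OF xy] .
  then show ?thesis
    using comp_eq_extend1[of "fst r" h x k] comp_eq_extend1[of "snd r" h y k]
    by (intro memI[of "h \<cdot> k"]) auto
qed

text \<open>A regular epimorphism is left orthogonal to jointly monic pairs, so membership is local.\<close>

lemma mem_local:
  assumes e: "regular_epi C e" and jm: "jointly_monic C r" and me: "mem C r (x \<cdot> e) (y \<cdot> e)"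
    and [simp]: "x \<in> Arr C" "y \<in> Arr C" "Dom C x = Cod C e" "Dom C y = Cod C e"
    "Cod C x = Cod C (fst r)" "Cod C y = Cod C (snd r)"
  shows "mem C r x y"
proof -
  obtain u v where uv: "is_coequaliser C u v e"
    using e by (auto simp: regular_epi_def)
  note [simp] = is_coequaliserD[OF uv] jointly_monicD[OF jm]
  obtain h where h [simp]: "h \<in> Arr C" "Dom C h = Dom C e" "Cod C h = Dom C (fst r)"
    and h_eq: "fst r \<cdot> h = x \<cdot> e" "snd r \<cdot> h = y \<cdot> e"
    by (rule memE[OF me]) simp
  have legs: "fst r \<cdot> (h \<cdot> w) = x \<cdot> (e \<cdot> w)" "snd r \<cdot> (h \<cdot> w) = y \<cdot> (e \<cdot> w)"
    if "w \<in> Arr C" "Cod C w = Dom C e" for w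
    using that by (simp_all add: comp_eq_extend[OF h_eq(1)] comp_eq_extend[OF h_eq(2)])
  have "h \<cdot> u = h \<cdot> v"
    by (rule jointly_monic_cancel[OF jm]) (simp_all add: legs)
  then obtain k where k [simp]: "k \<in> Arr C" "Dom C k = Cod C e" "Cod C k = Cod C h"
    and ke: "k \<cdot> e = h"
    by - (rule coequaliser_factor[OF uv, of h], auto)
  have "fst r \<cdot> k = x"
    by (rule regular_epi_cancel[OF e]) (use h_eq ke in auto)
  moreover have "snd r \<cdot> k = y"
    by (rule regular_epi_cancel[OF e]) (use h_eq ke in auto)
  ultimately show ?thesis
    by (intro memI[of k]) auto
qed

lemma monic_arr: "monic C m \<Longrightarrow> m \<in> Arr C"
  by (simp add: monic_def)

text \<open>The diagonal of a square with a regular epimorphism on one side and a monomorphism on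
  the other. It is \<open>mem_local\<close> for the pair \<open>(m, m)\<close>, which is jointly
  monic because \<open>m\<close> is monic.\<close>

lemma monic_lift:
  assumes e: "regular_epi C e" and m: "monic C m" and eq: "m \<cdot> w = x \<cdot> e"
    and [simp]: "w \<in> Arr C" "Cod C w = Dom C m" "x \<in> Arr C" "Dom C x = Cod C e" "Cod C x = Cod C m"
  obtains h where "h \<in> Arr C" "Dom C h = Dom C x" "Cod C h = Dom C m" "m \<cdot> h = x"
proof -
  note [simp] = monic_arr[OF m] regular_epi_arr[OF e]
  have "Dom C (m \<cdot> w) = Dom C (x \<cdot> e)"
    by (simp only: eq)
  then have "Dom C w = Dom C e"
    by simp
  then have "mem C (m, m) (x \<cdot> e) (x \<cdot> e)"
    by (intro memI[of w]) (auto simp: eq)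
  moreover have "jointly_monic C (m, m)"
    using m by (auto simp: jointly_monic_def monic_def)
  ultimately have "mem C (m, m) x x"
    by - (rule mem_local[OF e], auto)
  then show thesis
    by (rule memE) (rule that, simp_all)
qed

lemma isomorphism_split_monic:
  assumes m: "monic C m" and mh: "m \<cdot> h = Ident C (Cod C m)"
    and [simp]: "h \<in> Arr C" "Dom C h = Cod C m" "Cod C h = Dom C m"
  shows "isomorphism C m"
proof -
  note [simp] = monic_arr[OF m]
  have "m \<cdot> (h \<cdot> m) = m"
    using comp_eq_extend1[OF mh, of m] by simp
  then have "h \<cdot> m = Ident C (Dom C m)"
    by - (rule monic_cancel[OF m], auto)
  then show ?thesis
    unfolding isomorphism_def using mh by (intro conjI bexI[of _ h]) (auto simp: hom_def)
qed

lemma product_pair_monic: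
  assumes pr: "is_product C X Y p q" and [simp]: "m \<in> Arr C" "Cod C m = Dom C p"
  shows "jointly_monic C (p \<cdot> m, q \<cdot> m) \<longleftrightarrow> monic C m"
proof -
  note [simp] = is_productD[OF pr]
  have *: "(p \<cdot> m) \<cdot> a = (p \<cdot> m) \<cdot> b \<and> (q \<cdot> m) \<cdot> a = (q \<cdot> m) \<cdot> b \<longleftrightarrow> m \<cdot> a = m \<cdot> b"
    if "a \<in> hom C Z (Dom C m)" "b \<in> hom C Z (Dom C m)" for Z a b
  proof -
    have [simp]: "a \<in> Arr C" "b \<in> Arr C" "Dom C a = Z" "Dom C b = Z"
      "Cod C a = Dom C m" "Cod C b = Dom C m"
      using that by (auto simp: hom_def)
    have "m \<cdot> a = m \<cdot> b" if "p \<cdot> (m \<cdot> a) = p \<cdot> (m \<cdot> b)" "q \<cdot> (m \<cdot> a) = q \<cdot> (m \<cdot> b)"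
      using that by - (rule jointly_monic_cancel[OF product_jointly_monic[OF pr]], auto)
    then show ?thesis
      by auto
  qed
  show ?thesis
    unfolding jointly_monic_def monic_def fst_conv snd_conv
    using * by (simp del: comp_assoc) blast
qed

end

section \<open>Covers and image factorisations in a regular category\<close>

context regular_category
begin

lemma product:
  assumes "X \<in> Obj C" "Y \<in> Obj C"
  obtains p q where "is_product C X Y p q"
  using product_exists[OF finitely_complete assms] .

lemma pullback:
  assumes "f \<in> Arr C" "g \<in> Arr C" "Cod C f = Cod C g"
  obtains p q where "is_pullback C f g p q"
  using pullback_exists[OF finitely_complete assms] .

text \<open>Regular epimorphisms act as surjections on generalised elements up to a cover; the cover
  is the pullback of \<open>e\<close> along \<open>a\<close>, regular by stability.\<close>

lemma cover_lift:
  assumes e: "regular_epi C e" and [simp]: "a \<in> Arr C" "Cod C a = Cod C e"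
  obtains e' a' where "regular_epi C e'" "Cod C e' = Dom C a" "a' \<in> Arr C"
    "Dom C a' = Dom C e'" "Cod C a' = Dom C e" "e \<cdot> a' = a \<cdot> e'"
proof -
  note [simp] = regular_epi_arr[OF e]
  obtain p q where pb: "is_pullback C e a p q"
    by (rule pullback[of e a]) auto
  then show thesis
    using that[of q p] regular_epi_stable[OF e pb] is_pullbackD[OF pb] by simp
qed

text \<open>To see that \<open>m\<close> is monic, two elements with equal image under
  \<open>m\<close> are lifted through \<open>e\<close> on a cover. The lifts have the same image
  under \<open>f\<close>, so they form an element of the kernel pair, which \<open>e\<close>
  identifies. The coequaliser \<open>e\<close> is a parameter because the regularity proof for
  Equiv(C) needs the factorisation of a prescribed one.\<close>

lemma kernel_pair_factorisation:
  assumes pb: "is_pullback C f f p q" and co: "is_coequaliser C p q e"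
  obtains m where "monic C m" "Dom C m = Cod C e" "Cod C m = Cod C f" "m \<cdot> e = f"
proof -
  note [simp] = is_pullbackD(1,4-8)[OF pb] is_coequaliserD[OF co]
  have e: "regular_epi C e"
    using co by (auto simp: regular_epi_def)
  obtain m where m [simp]: "m \<in> Arr C" "Dom C m = Cod C e" "Cod C m = Cod C f" and me: "m \<cdot> e = f"
    by (rule coequaliser_factor[OF co, of f]) (use is_pullbackD(9)[OF pb] in simp_all)
  have "a = b" if "a \<in> hom C Z (Dom C m)" "b \<in> hom C Z (Dom C m)" "m \<cdot> a = m \<cdot> b" for Z a b
  proof -
    have [simp]: "a \<in> Arr C" "b \<in> Arr C" "Dom C a = Z" "Dom C b = Z"
      "Cod C a = Cod C e" "Cod C b = Cod C e"
      using that by (auto simp: hom_def)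
    obtain c x where c: "regular_epi C c" and [simp]: "Cod C c = Dom C a" "x \<in> Arr C"
      "Dom C x = Dom C c" "Cod C x = Dom C e" and ex: "e \<cdot> x = a \<cdot> c"
      by (rule cover_lift[OF e, of a]) auto
    note [simp] = regular_epi_arr[OF c]
    \<comment> \<open>The second element is lifted only after restriction to the first cover, so
      that both lifts live on the domain of \<open>d\<close>.\<close>
    obtain d y where d: "regular_epi C d" and [simp]: "Cod C d = Dom C (b \<cdot> c)" "y \<in> Arr C"
      "Dom C y = Dom C d" "Cod C y = Dom C e" and ey: "e \<cdot> y = (b \<cdot> c) \<cdot> d"
      by (rule cover_lift[OF e, of "b \<cdot> c"]) auto
    note [simp] = regular_epi_arr[OF d]
    have exd: "e \<cdot> (x \<cdot> d) = a \<cdot> (c \<cdot> d)"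
      by (rule comp_eq_extend[OF ex]) auto
    have "f \<cdot> (x \<cdot> d) = m \<cdot> (e \<cdot> (x \<cdot> d))" "f \<cdot> y = m \<cdot> (e \<cdot> y)"
      using comp_eq_extend1[OF me, of "x \<cdot> d"] comp_eq_extend1[OF me, of y] by simp_all
    moreover have "m \<cdot> (a \<cdot> (c \<cdot> d)) = m \<cdot> (b \<cdot> (c \<cdot> d))"
      by (rule comp_eq_extend[OF that(3)]) auto
    ultimately have "f \<cdot> (x \<cdot> d) = f \<cdot> y"
      using exd ey by simp
    then obtain h where [simp]: "h \<in> Arr C" "Dom C h = Dom C d" "Cod C h = Dom C p"
      and h: "p \<cdot> h = x \<cdot> d" "q \<cdot> h = y"
      by - (rule pullback_factor[OF pb, of "x \<cdot> d" y], auto)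
    have "e \<cdot> (p \<cdot> h) = e \<cdot> (q \<cdot> h)"
      by (rule comp_eq_extend) auto
    then have "(a \<cdot> c) \<cdot> d = (b \<cdot> c) \<cdot> d"
      using h exd ey by simp
    then have "a \<cdot> c = b \<cdot> c"
      by - (rule regular_epi_cancel[OF d], auto)
    then show ?thesis
      by - (rule regular_epi_cancel[OF c], auto)
  qed
  then have "monic C m"
    by (auto simp: monic_def)
  then show thesis
    using that m(2,3) me by blast
qed

lemma image_factorisation:
  assumes [simp]: "f \<in> Arr C"
  obtains e m where "regular_epi C e" "monic C m" "Dom C e = Dom C f" "Cod C e = Dom C m"
    "Cod C m = Cod C f" "m \<cdot> e = f"
proof -
  obtain p q where pb: "is_pullback C f f p q"
    by (rule pullback[of f f]) auto
  obtain e where co: "is_coequaliser C p q e"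
    using kernel_pair_coequaliser[OF pb] by blast
  obtain m where "monic C m" "Dom C m = Cod C e" "Cod C m = Cod C f" "m \<cdot> e = f"
    using kernel_pair_factorisation[OF pb co] .
  then show thesis
    using that[of e m] co is_coequaliserD[OF co] is_pullbackD[OF pb]
    by (auto simp: regular_epi_def)
qed

text \<open>Factor the composite as a regular epimorphism followed by a monomorphism
  \<open>m\<close>. Lifting along \<open>e\<close> makes \<open>e'\<close> factor through
  \<open>m\<close>, and lifting along \<open>e'\<close> then makes the identity factor through
  \<open>m\<close>; a split monomorphism of this kind is invertible.\<close>

lemma regular_epi_comp:
  assumes e: "regular_epi C e" and e': "regular_epi C e'" and [simp]: "Dom C e' = Cod C e"
  shows "regular_epi C (e' \<cdot> e)"
proof -
  note [simp] = regular_epi_arr[OF e] regular_epi_arr[OF e']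
  obtain d m where d: "regular_epi C d" and m: "monic C m" and [simp]: "Dom C d = Dom C (e' \<cdot> e)"
    "Cod C d = Dom C m" "Cod C m = Cod C (e' \<cdot> e)" and md: "m \<cdot> d = e' \<cdot> e"
    by (rule image_factorisation[of "e' \<cdot> e"]) auto
  note [simp] = regular_epi_arr[OF d] monic_arr[OF m]
  obtain h where [simp]: "h \<in> Arr C" "Dom C h = Dom C e'" "Cod C h = Dom C m" and h: "m \<cdot> h = e'"
    by (rule monic_lift[OF e m md]) simp_all
  obtain k where "k \<in> Arr C" "Dom C k = Cod C m" "Cod C k = Dom C m" "m \<cdot> k = Ident C (Cod C m)"
    by (rule monic_lift[OF e' m, of h "Ident C (Cod C m)"]) (simp_all add: h)
  then have "isomorphism C m"
    using isomorphism_split_monic[OF m] by blast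
  then have "regular_epi C (m \<cdot> d)"
    by (intro regular_epi_iso_comp d) auto
  then show ?thesis
    by (simp add: md)
qed

text \<open>The image of the arrow into a product with components \<open>u\<close> and
  \<open>v\<close>, stated by its legs so that the product disappears.\<close>

lemma joint_image:
  assumes [simp]: "u \<in> Arr C" "v \<in> Arr C" "Dom C u = Dom C v"
  obtains t e where "jointly_monic C t" "regular_epi C e" "Dom C e = Dom C u"
    "Cod C e = Dom C (fst t)" "Cod C (fst t) = Cod C u" "Cod C (snd t) = Cod C v"
    "fst t \<cdot> e = u" "snd t \<cdot> e = v"
proof -
  obtain p q where pr: "is_product C (Cod C u) (Cod C v) p q"
    by (rule product[of "Cod C u" "Cod C v"]) auto
  note [simp] = is_productD[OF pr]
  obtain k where [simp]: "k \<in> Arr C" "Dom C k = Dom C u" "Cod C k = Dom C p"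
    and k: "p \<cdot> k = u" "q \<cdot> k = v"
    by (rule product_factor[OF pr, of u v]) simp_all
  obtain e m where e: "regular_epi C e" and m: "monic C m" and [simp]: "Dom C e = Dom C k"
    "Cod C e = Dom C m" "Cod C m = Cod C k" and me: "m \<cdot> e = k"
    by (rule image_factorisation[of k]) auto
  note [simp] = regular_epi_arr[OF e] monic_arr[OF m]
  have "jointly_monic C (p \<cdot> m, q \<cdot> m)"
    using m by (simp add: product_pair_monic[OF pr])
  then show thesis
    using e me k by (intro that[of "(p \<cdot> m, q \<cdot> m)" e]) auto
qed

end

section \<open>Relations in a regular category\<close>

context regular_category
begin

lemma is_relation_iff:
  "is_relation C X Y r \<longleftrightarrow> jointly_monic C r \<and> Cod C (fst r) = X \<and> Cod C (snd r) = Y"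
proof
  assume "is_relation C X Y r"
  then obtain p q m where pr: "is_product C X Y p q" and m: "monic C m" "Cod C m = Dom C p"
    and r: "r = (p \<cdot> m, q \<cdot> m)"
    by (cases r) (auto simp: is_relation_def)
  then show "jointly_monic C r \<and> Cod C (fst r) = X \<and> Cod C (snd r) = Y"
    using product_pair_monic[OF pr] is_productD[OF pr] monic_arr[OF m(1)] by simp
next
  assume r: "jointly_monic C r \<and> Cod C (fst r) = X \<and> Cod C (snd r) = Y"
  note [simp] = jointly_monicD[of C r]
  obtain p q where pr: "is_product C X Y p q"
    using r by (metis product obj_arr(2) jointly_monicD(1,2))
  obtain m where m: "m \<in> Arr C" "Cod C m = Dom C p" "p \<cdot> m = fst r" "q \<cdot> m = snd r"
    by (rule product_factor[OF pr, of "fst r" "snd r"]) (use r in simp_all)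
  then have "monic C m"
    using product_pair_monic[OF pr, of m] r by simp
  then have "\<exists>p q m. is_product C X Y p q \<and> monic C m \<and> Cod C m = Dom C p \<and>
      fst r = p \<cdot> m \<and> snd r = q \<cdot> m"
    using pr m by metis
  then show "is_relation C X Y r"
    by (simp add: is_relation_def case_prod_beta)
qed

text \<open>The Yoneda argument: an internal law holds for all generalised elements by composition,
  and conversely follows from its instance at a universal element. Here that element is the identity
  of \<open>X\<close>; for symmetry it is the pair of legs of \<open>r\<close>.\<close>

lemma reflexive_rel_mem:
  assumes jm: "jointly_monic C r" and cod: "Cod C (fst r) = X" "Cod C (snd r) = X"
  shows "reflexive_rel C X r \<longleftrightarrow> (\<forall>x \<in> Arr C. Cod C x = X \<longrightarrow> mem C r x x)"
proof
  note [simp] = jointly_monicD[OF jm]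
  have [simp]: "X \<in> Obj C"
    using cod(1) obj_arr(2)[of "fst r"] by simp
  show "\<forall>x \<in> Arr C. Cod C x = X \<longrightarrow> mem C r x x" if "reflexive_rel C X r"
  proof (intro ballI impI)
    fix x assume [simp]: "x \<in> Arr C" and x: "Cod C x = X"
    have "mem C r (Ident C X) (Ident C X)"
      using that by (auto simp: reflexive_rel_def mem_def case_prod_beta)
    from mem_comp[OF jm this, of x] show "mem C r x x"
      by (simp add: x)
  qed
  show "reflexive_rel C X r" if "\<forall>x \<in> Arr C. Cod C x = X \<longrightarrow> mem C r x x"
  proof -
    have "mem C r (Ident C X) (Ident C X)"
      using that by simp
    then show ?thesis
      by (auto simp: reflexive_rel_def mem_def case_prod_beta)
  qed
qed

lemma symmetric_rel_mem:
  assumes jm: "jointly_monic C r"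
  shows "symmetric_rel C r \<longleftrightarrow> (\<forall>x y. mem C r x y \<longrightarrow> mem C r y x)"
proof
  note [simp] = jointly_monicD[OF jm]
  have eq: "symmetric_rel C r \<longleftrightarrow> mem C r (snd r) (fst r)"
    by (auto simp: symmetric_rel_def mem_def case_prod_beta)
  show "\<forall>x y. mem C r x y \<longrightarrow> mem C r y x" if "symmetric_rel C r"
  proof (intro allI impI)
    fix x y assume "mem C r x y"
    then obtain h where [simp]: "h \<in> Arr C" "Dom C h = Dom C x" "Cod C h = Dom C (fst r)"
      and h: "fst r \<cdot> h = x" "snd r \<cdot> h = y"
      by (rule memE)
    have "mem C r (snd r \<cdot> h) (fst r \<cdot> h)"
      using that eq by (intro mem_comp[OF jm]) simp_all
    then show "mem C r y x"
      by (simp only: h)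
  qed
  show "symmetric_rel C r" if "\<forall>x y. mem C r x y \<longrightarrow> mem C r y x"
  proof -
    have "mem C r (fst r) (snd r)"
      by (rule memI[of "Ident C (Dom C (fst r))"]) simp_all
    then show ?thesis
      using that eq by blast
  qed
qed

text \<open>The universal composable pair lives on the pullback of the second leg along the first;
  the arrow witnessing transitivity is the law applied to it, and every other composable pair
  factors through it.\<close>

lemma transitive_rel_mem:
  assumes jm: "jointly_monic C r" and cod: "Cod C (fst r) = Cod C (snd r)"
  shows "transitive_rel C r \<longleftrightarrow> (\<forall>x y z. mem C r x y \<longrightarrow> mem C r y z \<longrightarrow> mem C r x z)"
proof
  note [simp] = jointly_monicD[OF jm]
  show "\<forall>x y z. mem C r x y \<longrightarrow> mem C r y z \<longrightarrow> mem C r x z" if tr: "transitive_rel C r"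
  proof (intro allI impI)
    fix x y z assume xy: "mem C r x y" and yz: "mem C r y z"
    obtain p q where pb: "is_pullback C (snd r) (fst r) p q"
      and "mem C r (fst r \<cdot> p) (snd r \<cdot> q)"
    proof -
      obtain p q t where pb: "is_pullback C (snd r) (fst r) p q"
        and t: "t \<in> hom C (Dom C p) (Dom C (fst r))"
        and eq: "fst r \<cdot> t = fst r \<cdot> p" "snd r \<cdot> t = snd r \<cdot> q"
        using tr by (auto simp: transitive_rel_def case_prod_beta)
      have "mem C r (fst r \<cdot> p) (snd r \<cdot> q)"
        using t eq is_pullbackD[OF pb] by (intro memI[of t]) (simp_all add: hom_def)
      with pb show thesis
        by (rule that)
    qed
    note [simp] = is_pullbackD[OF pb]
    obtain h where [simp]: "h \<in> Arr C" "Dom C h = Dom C x" "Cod C h = Dom C (fst r)"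
      and h: "fst r \<cdot> h = x" "snd r \<cdot> h = y"
      using xy by (rule memE)
    obtain k where [simp]: "k \<in> Arr C" "Dom C k = Dom C y" "Cod C k = Dom C (fst r)"
      and k: "fst r \<cdot> k = y" "snd r \<cdot> k = z"
      using yz by (rule memE)
    have [simp]: "Dom C y = Dom C x"
      using mem_arrD[OF jm xy] by simp
    obtain w where [simp]: "w \<in> Arr C" "Dom C w = Dom C h" "Cod C w = Dom C p"
      and w: "p \<cdot> w = h" "q \<cdot> w = k"
      by (rule pullback_factor[OF pb, of h k]) (simp_all add: h k)
    have "mem C r ((fst r \<cdot> p) \<cdot> w) ((snd r \<cdot> q) \<cdot> w)"
      by (rule mem_comp[OF jm]) (use \<open>mem C r (fst r \<cdot> p) (snd r \<cdot> q)\<close> in simp_all)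
    then show "mem C r x z"
      by (simp add: w h k)
  qed
  show "transitive_rel C r" if tr: "\<forall>x y z. mem C r x y \<longrightarrow> mem C r y z \<longrightarrow> mem C r x z"
  proof -
    obtain p q where pb: "is_pullback C (snd r) (fst r) p q"
      by (rule pullback[of "snd r" "fst r"]) (simp_all add: cod)
    note [simp] = is_pullbackD(1-8)[OF pb] is_pullbackD(9)[OF pb, symmetric]
    have "mem C r (fst r \<cdot> p) (snd r \<cdot> p)" "mem C r (fst r \<cdot> q) (snd r \<cdot> q)"
      by (rule memI[of p], simp_all) (rule memI[of q], simp_all)
    then have "mem C r (fst r \<cdot> p) (snd r \<cdot> q)"
      using tr by (metis is_pullbackD(9)[OF pb])
    then have "\<exists>t \<in> hom C (Dom C p) (Dom C (fst r)).
        fst r \<cdot> t = fst r \<cdot> p \<and> snd r \<cdot> t = snd r \<cdot> q"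
      by (simp add: mem_def)
    then show ?thesis
      using pb by (auto simp: transitive_rel_def case_prod_beta)
  qed
qed

lemma equivalence_rel_mem:
  "equivalence_rel C X r \<longleftrightarrow> jointly_monic C r \<and> Cod C (fst r) = X \<and> Cod C (snd r) = X \<and>
     (\<forall>x \<in> Arr C. Cod C x = X \<longrightarrow> mem C r x x) \<and> (\<forall>x y. mem C r x y \<longrightarrow> mem C r y x) \<and>
     (\<forall>x y z. mem C r x y \<longrightarrow> mem C r y z \<longrightarrow> mem C r x z)"
proof (cases "is_relation C X X r")
  case True
  then have *: "jointly_monic C r" "Cod C (fst r) = X" "Cod C (snd r) = X"
    by (simp_all add: is_relation_iff)
  then have "Cod C (fst r) = Cod C (snd r)"
    by simp
  with True * show ?thesis
    unfolding equivalence_rel_def reflexive_rel_mem[OF *] symmetric_rel_mem[OF *(1)]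
      transitive_rel_mem[OF *(1) \<open>Cod C (fst r) = Cod C (snd r)\<close>] by blast
next
  case False
  then show ?thesis
    unfolding equivalence_rel_def is_relation_iff by blast
qed

lemma equivalence_relD:
  assumes "equivalence_rel C X r"
  shows "jointly_monic C r" "Cod C (fst r) = X" "Cod C (snd r) = X"
    "\<And>x. x \<in> Arr C \<Longrightarrow> Cod C x = X \<Longrightarrow> mem C r x x"
    "\<And>x y. mem C r x y \<Longrightarrow> mem C r y x"
    "\<And>x y z. mem C r x y \<Longrightarrow> mem C r y z \<Longrightarrow> mem C r x z"
  using assms unfolding equivalence_rel_mem by blast+

text \<open>The product and the arrow \<open>k\<close> into it are eliminated: a composite is a
  jointly monic pair through which the outer legs on the pullback factor by one regular epimorphism.
  In this form a functor can be applied to it without any statement about products.\<close>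

lemma is_rel_comp_iff:
  assumes [simp]: "fst r \<in> Arr C" "snd s \<in> Arr C" "Dom C (fst r) = Dom C (snd r)"
    "Dom C (snd s) = Dom C (fst s)"
  shows "is_rel_comp C s r t \<longleftrightarrow> jointly_monic C t \<and>
    Cod C (fst t) = Cod C (fst r) \<and> Cod C (snd t) = Cod C (snd s) \<and>
    (\<exists>p q e. is_pullback C (snd r) (fst s) p q \<and> regular_epi C e \<and> Dom C e = Dom C p \<and>
       Cod C e = Dom C (fst t) \<and> fst t \<cdot> e = fst r \<cdot> p \<and> snd t \<cdot> e = snd s \<cdot> q)"
    (is "_ \<longleftrightarrow> ?rhs")
proof
  assume "is_rel_comp C s r t"
  then obtain p q x z k m where pb: "is_pullback C (snd r) (fst s) p q"
    and pr: "is_product C (Cod C (fst r)) (Cod C (snd s)) x z"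
    and k: "k \<in> hom C (Dom C p) (Dom C x)" "x \<cdot> k = fst r \<cdot> p" "z \<cdot> k = snd s \<cdot> q"
    and "is_image C k m" and t: "t = (x \<cdot> m, z \<cdot> m)"
    by (cases t) (auto simp: is_rel_comp_def case_prod_beta)
  then obtain e where m: "monic C m" and e: "regular_epi C e" and [simp]: "Cod C e = Dom C m"
    and me: "m \<cdot> e = k"
    by (auto simp: is_image_def)
  note [simp] = regular_epi_arr[OF e] monic_arr[OF m] is_productD[OF pr]
  have "Dom C (m \<cdot> e) = Dom C p" "Cod C (m \<cdot> e) = Dom C x"
    using k(1) unfolding me by (simp_all add: hom_def)
  then have [simp]: "Dom C e = Dom C p" "Cod C m = Dom C x"
    by simp_all
  have "jointly_monic C t"
    using m product_pair_monic[OF pr, of m] by (simp add: t)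
  moreover have "fst t \<cdot> e = fst r \<cdot> p" "snd t \<cdot> e = snd s \<cdot> q"
    using k(2,3) by (simp_all add: t me)
  moreover have "Cod C e = Dom C (fst t)"
    "Cod C (fst t) = Cod C (fst r)" "Cod C (snd t) = Cod C (snd s)"
    by (simp_all add: t)
  ultimately show ?rhs
    using pb e \<open>Dom C e = Dom C p\<close> by blast
next
  assume ?rhs
  then obtain p q e where jm: "jointly_monic C t"
    and [simp]: "Cod C (fst t) = Cod C (fst r)" "Cod C (snd t) = Cod C (snd s)"
    and pb: "is_pullback C (snd r) (fst s) p q" and e: "regular_epi C e"
    and [simp]: "Dom C e = Dom C p" "Cod C e = Dom C (fst t)"
    and eq: "fst t \<cdot> e = fst r \<cdot> p" "snd t \<cdot> e = snd s \<cdot> q"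
    by blast
  note [simp] = regular_epi_arr[OF e] jointly_monicD[OF jm]
  obtain x z where pr: "is_product C (Cod C (fst r)) (Cod C (snd s)) x z"
    by (rule product[of "Cod C (fst r)" "Cod C (snd s)"]) auto
  note [simp] = is_productD[OF pr]
  obtain m where [simp]: "m \<in> Arr C" "Dom C m = Dom C (fst t)" "Cod C m = Dom C x"
    and m_eq: "x \<cdot> m = fst t" "z \<cdot> m = snd t"
    by (rule product_factor[OF pr, of "fst t" "snd t"]) simp_all
  have "monic C m"
    using jm product_pair_monic[OF pr, of m] by (simp add: m_eq)
  then have "is_image C (m \<cdot> e) m"
    using e by (auto simp: is_image_def)
  moreover have "m \<cdot> e \<in> hom C (Dom C p) (Dom C x)"
    by (simp add: hom_def)
  moreover have "x \<cdot> (m \<cdot> e) = fst r \<cdot> p" "z \<cdot> (m \<cdot> e) = snd s \<cdot> q"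
    using comp_eq_extend1[OF m_eq(1), of e] comp_eq_extend1[OF m_eq(2), of e]
    by (simp_all add: eq)
  ultimately have "\<exists>p q x z k m. is_pullback C (snd r) (fst s) p q \<and>
      is_product C (Cod C (fst r)) (Cod C (snd s)) x z \<and> k \<in> hom C (Dom C p) (Dom C x) \<and>
      x \<cdot> k = fst r \<cdot> p \<and> z \<cdot> k = snd s \<cdot> q \<and> is_image C k m \<and> fst t = x \<cdot> m \<and> snd t = z \<cdot> m"
    using pb pr m_eq by metis
  then show "is_rel_comp C s r t"
    by (simp add: is_rel_comp_def case_prod_beta)
qed

text \<open>Existence of a composite, as a joint image of the outer legs, makes the choice in
  \<open>rel_comp\<close> meaningful.\<close>

lemma rel_comp:
  assumes r: "jointly_monic C r" and s: "jointly_monic C s" and [simp]: "Cod C (snd r) = Cod C (fst s)"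
  shows "is_rel_comp C s r (rel_comp C s r)"
proof -
  note [simp] = jointly_monicD[OF r] jointly_monicD[OF s]
  obtain p q where pb: "is_pullback C (snd r) (fst s) p q"
    by (rule pullback[of "snd r" "fst s"]) auto
  note [simp] = is_pullbackD(1,2,4-9)[OF pb]
  obtain t e where "jointly_monic C t" "regular_epi C e" "Dom C e = Dom C (fst r \<cdot> p)"
    "Cod C e = Dom C (fst t)" "Cod C (fst t) = Cod C (fst r \<cdot> p)"
    "Cod C (snd t) = Cod C (snd s \<cdot> q)" "fst t \<cdot> e = fst r \<cdot> p" "snd t \<cdot> e = snd s \<cdot> q"
    by (rule joint_image[of "fst r \<cdot> p" "snd s \<cdot> q"]) auto
  then have "is_rel_comp C s r t"
    using pb by (subst is_rel_comp_iff) auto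
  then show ?thesis
    unfolding rel_comp_def by (rule someI)
qed

lemma is_rel_compD:
  assumes "jointly_monic C r" "jointly_monic C s" "is_rel_comp C s r t"
  shows "jointly_monic C t" "Cod C (fst t) = Cod C (fst r)" "Cod C (snd t) = Cod C (snd s)"
  using assms(3) is_rel_comp_iff[of r s t] jointly_monicD[OF assms(1)] jointly_monicD[OF assms(2)]
  by simp_all

lemma is_rel_comp_mem:
  assumes r: "jointly_monic C r" and s: "jointly_monic C s" and t: "is_rel_comp C s r t"
    and xy: "mem C r x y" and yz: "mem C s y z"
  shows "mem C t x z"
proof -
  note [simp] = jointly_monicD[OF r] jointly_monicD[OF s] mem_arrD[OF r xy] mem_arrD[OF s yz]
  obtain p q e where jt: "jointly_monic C t"
    and pb: "is_pullback C (snd r) (fst s) p q" and e: "regular_epi C e"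
    and [simp]: "Dom C e = Dom C p" "Cod C e = Dom C (fst t)"
    and eq: "fst t \<cdot> e = fst r \<cdot> p" "snd t \<cdot> e = snd s \<cdot> q"
    using t is_rel_comp_iff[of r s t] by auto
  note [simp] = jointly_monicD[OF jt] is_pullbackD(1,2,4-9)[OF pb] regular_epi_arr[OF e]
  obtain h where [simp]: "h \<in> Arr C" "Dom C h = Dom C x" "Cod C h = Dom C (fst r)"
    and h: "fst r \<cdot> h = x" "snd r \<cdot> h = y"
    using xy by (rule memE)
  obtain k where [simp]: "k \<in> Arr C" "Dom C k = Dom C y" "Cod C k = Dom C (fst s)"
    and k: "fst s \<cdot> k = y" "snd s \<cdot> k = z"
    using yz by (rule memE)
  obtain w where [simp]: "w \<in> Arr C" "Dom C w = Dom C h" "Cod C w = Dom C p"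
    and w: "p \<cdot> w = h" "q \<cdot> w = k"
    by (rule pullback_factor[OF pb, of h k]) (simp_all add: h k)
  have "fst t \<cdot> (e \<cdot> w) = fst r \<cdot> (p \<cdot> w)" "snd t \<cdot> (e \<cdot> w) = snd s \<cdot> (q \<cdot> w)"
    by (rule comp_eq_extend[OF eq(1)], simp_all) (rule comp_eq_extend[OF eq(2)], simp_all)
  then show ?thesis
    by (intro memI[of "e \<cdot> w"]) (simp_all add: w h k)
qed

text \<open>An element of the image lifts along the regular epimorphism onto \<open>t\<close> only
  after passing to a cover; the intermediate element \<open>y\<close> is read off on the
  pullback.\<close>

lemma is_rel_comp_cover:
  assumes r: "jointly_monic C r" and s: "jointly_monic C s" and t: "is_rel_comp C s r t"
    and xz: "mem C t x z"
  obtains c y where "regular_epi C c" "Cod C c = Dom C x"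
    "mem C r (x \<cdot> c) y" "mem C s y (z \<cdot> c)"
proof -
  note [simp] = jointly_monicD[OF r] jointly_monicD[OF s]
  obtain p q e where jt: "jointly_monic C t"
    and pb: "is_pullback C (snd r) (fst s) p q" and e: "regular_epi C e"
    and [simp]: "Dom C e = Dom C p" "Cod C e = Dom C (fst t)"
    and eq: "fst t \<cdot> e = fst r \<cdot> p" "snd t \<cdot> e = snd s \<cdot> q"
    using t is_rel_comp_iff[of r s t] by auto
  note [simp] = jointly_monicD[OF jt] is_pullbackD(1,2,4-9)[OF pb] regular_epi_arr[OF e]
  obtain h where [simp]: "h \<in> Arr C" "Dom C h = Dom C x" "Cod C h = Dom C (fst t)"
    and h: "fst t \<cdot> h = x" "snd t \<cdot> h = z"
    using xz by (rule memE)
  obtain c w where c: "regular_epi C c" and [simp]: "Cod C c = Dom C h" "w \<in> Arr C"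
    "Dom C w = Dom C c" "Cod C w = Dom C e" and ew: "e \<cdot> w = h \<cdot> c"
    by (rule cover_lift[OF e, of h]) auto
  note [simp] = regular_epi_arr[OF c]
  have "x \<cdot> c = fst t \<cdot> (h \<cdot> c)" "z \<cdot> c = snd t \<cdot> (h \<cdot> c)"
    using comp_eq_extend1[OF h(1), of c] comp_eq_extend1[OF h(2), of c] by simp_all
  moreover have "fst t \<cdot> (e \<cdot> w) = fst r \<cdot> (p \<cdot> w)" "snd t \<cdot> (e \<cdot> w) = snd s \<cdot> (q \<cdot> w)"
    by (rule comp_eq_extend[OF eq(1)], simp_all) (rule comp_eq_extend[OF eq(2)], simp_all)
  ultimately have legs: "x \<cdot> c = fst r \<cdot> (p \<cdot> w)" "z \<cdot> c = snd s \<cdot> (q \<cdot> w)"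
    by (simp_all add: ew)
  have "snd r \<cdot> (p \<cdot> w) = fst s \<cdot> (q \<cdot> w)"
    by (rule comp_eq_extend[OF is_pullbackD(9)[OF pb]]) simp_all
  then have "mem C r (x \<cdot> c) (fst s \<cdot> (q \<cdot> w))" "mem C s (fst s \<cdot> (q \<cdot> w)) (z \<cdot> c)"
    unfolding legs by (intro memI[of "p \<cdot> w"]; simp) (intro memI[of "q \<cdot> w"]; simp)
  then show thesis
    using that c by simp
qed

text \<open>Each inclusion is tested on the universal element given by the legs, and the two
  resulting arrows are mutually inverse by joint monicity.\<close>

lemma rel_eqI:
  assumes r: "jointly_monic C r" and s: "jointly_monic C s"
    and rs: "mem C s (fst r) (snd r)" and sr: "mem C r (fst s) (snd s)"
  shows "rel_eq C r s"
proof -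
  note [simp] = jointly_monicD[OF r] jointly_monicD[OF s]
  obtain i where i [simp]: "i \<in> Arr C" "Dom C i = Dom C (fst r)" "Cod C i = Dom C (fst s)"
    and i_eq: "fst s \<cdot> i = fst r" "snd s \<cdot> i = snd r"
    using rs by (rule memE)
  obtain j where j [simp]: "j \<in> Arr C" "Dom C j = Dom C (fst s)" "Cod C j = Dom C (fst r)"
    and j_eq: "fst r \<cdot> j = fst s" "snd r \<cdot> j = snd s"
    using sr by (rule memE)
  have "i \<cdot> j = Ident C (Dom C (fst s))"
    by (rule jointly_monic_cancel[OF s])
      (simp_all add: comp_eq_extend1[OF i_eq(1)] comp_eq_extend1[OF i_eq(2)] j_eq)
  moreover have "j \<cdot> i = Ident C (Dom C (fst r))"
    by (rule jointly_monic_cancel[OF r])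
      (simp_all add: comp_eq_extend1[OF j_eq(1)] comp_eq_extend1[OF j_eq(2)] i_eq)
  ultimately have "isomorphism C i"
    unfolding isomorphism_def by (intro conjI bexI[of _ j]) (simp_all add: hom_def)
  then show ?thesis
    unfolding rel_eq_def case_prod_beta using i_eq
    by (intro bexI[of _ i] conjI) (simp_all add: hom_def)
qed

lemma rel_eq_mem:
  assumes r: "jointly_monic C r" and s: "jointly_monic C s" and eq: "rel_eq C r s"
    and xy: "mem C r x y"
  shows "mem C s x y"
proof -
  note [simp] = jointly_monicD[OF r] jointly_monicD[OF s]
  obtain i where [simp]: "i \<in> Arr C" "Dom C i = Dom C (fst r)" "Cod C i = Dom C (fst s)"
    and i: "fst s \<cdot> i = fst r" "snd s \<cdot> i = snd r"
    using eq by (auto simp: rel_eq_def hom_def case_prod_beta)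
  obtain h where [simp]: "h \<in> Arr C" "Dom C h = Dom C x" "Cod C h = Dom C (fst r)"
    and h: "fst r \<cdot> h = x" "snd r \<cdot> h = y"
    using xy by (rule memE)
  show ?thesis
    using comp_eq_extend1[OF i(1), of h] comp_eq_extend1[OF i(2), of h]
    by (intro memI[of "i \<cdot> h"]) (simp_all add: h)
qed

end

section \<open>Images of equivalence relations in Goursat categories\<close>

lemma (in category) mem_kernel_pair:
  assumes pb: "is_pullback C f f p q"
  shows "mem C (p, q) x y \<longleftrightarrow> x \<in> Arr C \<and> y \<in> Arr C \<and> Dom C y = Dom C x \<and>
    Cod C x = Dom C f \<and> Cod C y = Dom C f \<and> f \<cdot> x = f \<cdot> y"
proof
  note [simp] = is_pullbackD(1,4-9)[OF pb]
  assume m: "mem C (p, q) x y"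
  then obtain h where [simp]: "h \<in> Arr C" "Dom C h = Dom C x" "Cod C h = Dom C p"
    and h: "p \<cdot> h = x" "q \<cdot> h = y"
    by (rule memE) simp
  have "f \<cdot> (p \<cdot> h) = f \<cdot> (q \<cdot> h)"
    by (rule comp_eq_extend[OF is_pullbackD(9)[OF pb]]) simp_all
  then show "x \<in> Arr C \<and> y \<in> Arr C \<and> Dom C y = Dom C x \<and>
    Cod C x = Dom C f \<and> Cod C y = Dom C f \<and> f \<cdot> x = f \<cdot> y"
    using mem_arrD[OF pullback_jointly_monic[OF pb] m] h by simp
next
  assume "x \<in> Arr C \<and> y \<in> Arr C \<and> Dom C y = Dom C x \<and>
    Cod C x = Dom C f \<and> Cod C y = Dom C f \<and> f \<cdot> x = f \<cdot> y"
  then obtain h where "h \<in> Arr C" "Dom C h = Dom C x" "Cod C h = Dom C p" "p \<cdot> h = x" "q \<cdot> h = y"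
    by (elim conjE) (rule pullback_factor[OF pb, of x y])
  then show "mem C (p, q) x y"
    by (intro memI[of h]) simp_all
qed

text \<open>By \<open>mem_kernel_pair\<close> the three laws reduce to those of the equality
  \<open>f \<cdot> x = f \<cdot> y\<close>.\<close>

lemma (in regular_category) kernel_pair_equivalence_rel:
  assumes pb: "is_pullback C f f p q"
  shows "equivalence_rel C (Dom C f) (p, q)"
  unfolding equivalence_rel_mem mem_kernel_pair[OF pb]
  using pullback_jointly_monic[OF pb] is_pullbackD(7,8)[OF pb] by simp

context goursat_category
begin

text \<open>The inclusion of RSR in SRS for elements: a chain with steps in \<open>r\<close>,
  \<open>s\<close>, \<open>r\<close> is replaced by a chain with the same ends and steps in
  \<open>s\<close>, \<open>r\<close>, \<open>s\<close>. Opening the outer and the inner composite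
  costs one cover each, and these are composed into \<open>c\<close>.\<close>

lemma three_permutable_local:
  assumes r: "equivalence_rel C X r" and s: "equivalence_rel C X s"
    and xy: "mem C r x y" and yz: "mem C s y z" and zw: "mem C r z w"
  obtains c y' z' where "regular_epi C c" "Cod C c = Dom C x"
    "mem C s (x \<cdot> c) y'" "mem C r y' z'" "mem C s z' (w \<cdot> c)"
proof -
  note R [simp] = equivalence_relD(1-3)[OF r] and S [simp] = equivalence_relD(1-3)[OF s]
  have sr: "is_rel_comp C s r (rel_comp C s r)"
    by (rule rel_comp) simp_all
  note SR [simp] = is_rel_compD[OF R(1) S(1) sr]
  have rsr: "is_rel_comp C r (rel_comp C s r) (rel_comp C r (rel_comp C s r))"
    by (rule rel_comp) simp_all
  note RSR [simp] = is_rel_compD[OF SR(1) R(1) rsr]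
  have rs: "is_rel_comp C r s (rel_comp C r s)"
    by (rule rel_comp) simp_all
  note RS [simp] = is_rel_compD[OF S(1) R(1) rs]
  have srs: "is_rel_comp C s (rel_comp C r s) (rel_comp C s (rel_comp C r s))"
    by (rule rel_comp) simp_all
  note SRS [simp] = is_rel_compD[OF RS(1) S(1) srs]
  have "mem C (rel_comp C r (rel_comp C s r)) x w"
    by (rule is_rel_comp_mem[OF SR(1) R(1) rsr is_rel_comp_mem[OF R(1) S(1) sr xy yz] zw])
  then have xw: "mem C (rel_comp C s (rel_comp C r s)) x w"
    by (rule rel_eq_mem[OF RSR(1) SRS(1) three_permutable[OF r s]])
  obtain c z' where c: "regular_epi C c" "Cod C c = Dom C x"
    and xz: "mem C (rel_comp C r s) (x \<cdot> c) z'" and zw': "mem C s z' (w \<cdot> c)"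
    by (rule is_rel_comp_cover[OF RS(1) S(1) srs xw])
  obtain d y' where d: "regular_epi C d" "Cod C d = Dom C (x \<cdot> c)"
    and xy': "mem C s ((x \<cdot> c) \<cdot> d) y'" and yz': "mem C r y' (z' \<cdot> d)"
    by (rule is_rel_comp_cover[OF S(1) R(1) rs xz])
  note [simp] = mem_arrD[OF R(1) xy] mem_arrD[OF R(1) zw] mem_arrD[OF S(1) yz]
    mem_arrD(1,4)[OF S(1) zw'] regular_epi_arr[OF c(1)] regular_epi_arr[OF d(1)] c(2)
  have [simp]: "Cod C d = Dom C c" "Dom C z' = Dom C c"
    using d(2) mem_arrD(3)[OF S(1) zw'] by simp_all
  have "mem C s (z' \<cdot> d) ((w \<cdot> c) \<cdot> d)"
    by (rule mem_comp[OF S(1) zw']) simp_all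
  then show thesis
    using xy' yz' regular_epi_comp[OF d(1) c(1)] by (intro that[of "c \<cdot> d" y' "z' \<cdot> d"]) simp_all
qed

text \<open>The composites are arbitrary representatives, since the image in C of a composite chosen
  in Equiv(C) need not be the one chosen in C. The element of \<open>t\<close> is opened into a
  chain on covers, the chain is permuted, and the covers are then removed in reverse order by
  \<open>mem_local\<close>.\<close>

lemma three_permutable_mem:
  assumes r: "equivalence_rel C X r" and s: "equivalence_rel C X s"
    and sr: "is_rel_comp C s r a" and rsr: "is_rel_comp C r a t"
    and rs: "is_rel_comp C r s b" and srs: "is_rel_comp C s b u"
    and xw: "mem C t x w"
  shows "mem C u x w"
proof -
  note R [simp] = equivalence_relD(1-3)[OF r] and S [simp] = equivalence_relD(1-3)[OF s]
  note A [simp] = is_rel_compD[OF R(1) S(1) sr]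
  note T [simp] = is_rel_compD[OF A(1) R(1) rsr]
  note B [simp] = is_rel_compD[OF S(1) R(1) rs]
  note U [simp] = is_rel_compD[OF B(1) S(1) srs]
  note [simp] = mem_arrD[OF T(1) xw]
  obtain c z where c: "regular_epi C c" and [simp]: "Cod C c = Dom C x"
    and xz: "mem C a (x \<cdot> c) z" and zw: "mem C r z (w \<cdot> c)"
    by (rule is_rel_comp_cover[OF A(1) R(1) rsr xw])
  note [simp] = regular_epi_arr[OF c] mem_arrD(1,4)[OF R(1) zw]
  have [simp]: "Dom C z = Dom C c"
    using mem_arrD(3)[OF R(1) zw] by simp
  obtain d y where d: "regular_epi C d" and "Cod C d = Dom C (x \<cdot> c)"
    and xy: "mem C r ((x \<cdot> c) \<cdot> d) y" and yz: "mem C s y (z \<cdot> d)"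
    by (rule is_rel_comp_cover[OF R(1) S(1) sr xz])
  then have [simp]: "Cod C d = Dom C c"
    by simp
  note [simp] = regular_epi_arr[OF d]
  have "mem C r (z \<cdot> d) ((w \<cdot> c) \<cdot> d)"
    by (rule mem_comp[OF R(1) zw]) simp_all
  then obtain e y' z' where e: "regular_epi C e" and "Cod C e = Dom C ((x \<cdot> c) \<cdot> d)"
    and xy': "mem C s (((x \<cdot> c) \<cdot> d) \<cdot> e) y'" and yz': "mem C r y' z'"
    and zw': "mem C s z' (((w \<cdot> c) \<cdot> d) \<cdot> e)"
    by (rule three_permutable_local[OF r s xy yz])
  then have [simp]: "Cod C e = Dom C d"
    by simp
  note [simp] = regular_epi_arr[OF e]
  have "mem C u (((x \<cdot> c) \<cdot> d) \<cdot> e) (((w \<cdot> c) \<cdot> d) \<cdot> e)"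
    by (rule is_rel_comp_mem[OF B(1) S(1) srs is_rel_comp_mem[OF S(1) R(1) rs xy' yz'] zw'])
  then have "mem C u ((x \<cdot> c) \<cdot> d) ((w \<cdot> c) \<cdot> d)"
    by (rule mem_local[OF e U(1)]) simp_all
  then have "mem C u (x \<cdot> c) (w \<cdot> c)"
    by (rule mem_local[OF d U(1)]) simp_all
  then show ?thesis
    by (rule mem_local[OF c U(1)]) simp_all
qed

text \<open>For transitivity, let \<open>K\<close> be the kernel pair of \<open>f\<close>. A composable pair in the image of \<open>r\<close>
  comes locally from a generalised pair in \<open>rKr\<close>, which equals \<open>KrK\<close>, and the image of \<open>KrK\<close>
  under \<open>f\<close> is that of \<open>r\<close>.\<close>

lemma image_equivalence_rel:
  assumes f: "regular_epi C f" and r: "equivalence_rel C (Dom C f) r"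
  obtains s e where "equivalence_rel C (Cod C f) s" "regular_epi C e" "Dom C e = Dom C (fst r)"
    "Cod C e = Dom C (fst s)" "fst s \<cdot> e = f \<cdot> fst r" "snd s \<cdot> e = f \<cdot> snd r"
proof -
  note [simp] = regular_epi_arr[OF f]
  note R [simp] = equivalence_relD(1-3)[OF r] and R' [simp] = jointly_monicD[OF R(1)]
  obtain s e where S [simp]: "jointly_monic C s" and e: "regular_epi C e"
    and "Dom C e = Dom C (f \<cdot> fst r)" "Cod C (fst s) = Cod C (f \<cdot> fst r)"
      "Cod C (snd s) = Cod C (f \<cdot> snd r)"
    and [simp]: "Cod C e = Dom C (fst s)"
    and eq: "fst s \<cdot> e = f \<cdot> fst r" "snd s \<cdot> e = f \<cdot> snd r"
    by (rule joint_image[of "f \<cdot> fst r" "f \<cdot> snd r"]) simp_all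
  then have [simp]: "Dom C e = Dom C (fst r)" "Cod C (fst s) = Cod C f" "Cod C (snd s) = Cod C f"
    by simp_all
  note [simp] = regular_epi_arr[OF e] jointly_monicD[OF S]
  have push: "mem C s (f \<cdot> x) (f \<cdot> y)" if xy: "mem C r x y" for x y
  proof -
    note [simp] = mem_arrD[OF R(1) xy]
    obtain h where [simp]: "h \<in> Arr C" "Dom C h = Dom C x" "Cod C h = Dom C (fst r)"
      and h: "fst r \<cdot> h = x" "snd r \<cdot> h = y"
      using xy by (rule memE)
    show ?thesis
      by (rule memI[of "e \<cdot> h"])
        (simp_all add: comp_eq_extend[OF eq(1)] comp_eq_extend[OF eq(2)] h)
  qed
  \<comment> \<open>Elements of \<open>r\<close> map to elements of \<open>s\<close> directly, but
    elements of \<open>s\<close> come from \<open>r\<close> only on a cover; each use of this fact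
    is later undone by \<open>mem_local\<close>.\<close>
  have pull: "\<exists>c x y. regular_epi C c \<and> Cod C c = Dom C a \<and> mem C r x y \<and>
      f \<cdot> x = a \<cdot> c \<and> f \<cdot> y = b \<cdot> c \<and> Dom C x = Dom C c" if ab: "mem C s a b" for a b
  proof -
    note [simp] = mem_arrD[OF S ab]
    obtain h where [simp]: "h \<in> Arr C" "Dom C h = Dom C a" "Cod C h = Dom C (fst s)"
      and h: "fst s \<cdot> h = a" "snd s \<cdot> h = b"
      using ab by (rule memE)
    obtain c w where c: "regular_epi C c" and [simp]: "Cod C c = Dom C h" "w \<in> Arr C"
      "Dom C w = Dom C c" "Cod C w = Dom C e" and ew: "e \<cdot> w = h \<cdot> c"
      by (rule cover_lift[OF e, of h]) simp_all
    note [simp] = regular_epi_arr[OF c]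
    have "f \<cdot> (fst r \<cdot> w) = a \<cdot> c"
      using comp_eq_extend[OF eq(1), of w] comp_eq_extend1[OF h(1), of c] by (simp add: ew)
    moreover have "f \<cdot> (snd r \<cdot> w) = b \<cdot> c"
      using comp_eq_extend[OF eq(2), of w] comp_eq_extend1[OF h(2), of c] by (simp add: ew)
    moreover have "mem C r (fst r \<cdot> w) (snd r \<cdot> w)"
      by (rule memI[of w]) simp_all
    moreover have "Dom C (fst r \<cdot> w) = Dom C c" "Cod C c = Dom C a"
      by simp_all
    ultimately show ?thesis
      using c by blast
  qed
  have "mem C s a a" if [simp]: "a \<in> Arr C" "Cod C a = Cod C f" for a
  proof -
    obtain c x where c: "regular_epi C c" and [simp]: "Cod C c = Dom C a" "x \<in> Arr C"
      "Dom C x = Dom C c" "Cod C x = Dom C f" and fx: "f \<cdot> x = a \<cdot> c"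
      by (rule cover_lift[OF f, of a]) simp_all
    have "mem C s (f \<cdot> x) (f \<cdot> x)"
      by (rule push[OF equivalence_relD(4)[OF r]]) simp_all
    then show ?thesis
      unfolding fx by (rule mem_local[OF c S]) simp_all
  qed
  moreover have "mem C s b a" if ab: "mem C s a b" for a b
  proof -
    note [simp] = mem_arrD[OF S ab]
    obtain c x y where c: "regular_epi C c" and [simp]: "Cod C c = Dom C a"
      and xy: "mem C r x y" and fx: "f \<cdot> x = a \<cdot> c" and fy: "f \<cdot> y = b \<cdot> c"
      using pull[OF ab] by blast
    have "mem C s (f \<cdot> y) (f \<cdot> x)"
      by (rule push[OF equivalence_relD(5)[OF r xy]])
    then show ?thesis
      unfolding fx fy by (rule mem_local[OF c S]) simp_all
  qed
  moreover have "mem C s a d" if ab: "mem C s a b" and bd: "mem C s b d" for a b d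
  proof -
    note [simp] = mem_arrD[OF S bd] mem_arrD[OF S ab]
    obtain c x y where c: "regular_epi C c" and [simp]: "Cod C c = Dom C a"
      and xy: "mem C r x y" and fx: "f \<cdot> x = a \<cdot> c" and fy: "f \<cdot> y = b \<cdot> c"
      and [simp]: "Dom C x = Dom C c"
      using pull[OF ab] by blast
    note [simp] = regular_epi_arr[OF c] mem_arrD[OF R(1) xy]
    have "mem C s (b \<cdot> c) (d \<cdot> c)"
      by (rule mem_comp[OF S bd]) simp_all
    from pull[OF this] obtain c' y' z where c': "regular_epi C c'" and "Cod C c' = Dom C (b \<cdot> c)"
      and yz: "mem C r y' z" and fy': "f \<cdot> y' = (b \<cdot> c) \<cdot> c'" and fz: "f \<cdot> z = (d \<cdot> c) \<cdot> c'"
      and [simp]: "Dom C y' = Dom C c'"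
      by blast
    then have [simp]: "Cod C c' = Dom C c"
      by simp
    note [simp] = regular_epi_arr[OF c'] mem_arrD[OF R(1) yz]
    obtain p q where pb: "is_pullback C f f p q"
      by (rule pullback[of f f]) simp_all
    note K = kernel_pair_equivalence_rel[OF pb]
    have "f \<cdot> (y \<cdot> c') = f \<cdot> y'"
      using comp_eq_extend[OF fy, of c'] fy' by simp
    then have "mem C (p, q) (y \<cdot> c') y'"
      by (simp add: mem_kernel_pair[OF pb])
    moreover have "mem C r (x \<cdot> c') (y \<cdot> c')"
      by (rule mem_comp[OF R(1) xy]) simp_all
    \<comment> \<open>After permutation both steps in the kernel pair stand at the ends of the
      chain, where \<open>f\<close> collapses them. Only the middle step from \<open>v\<close> to
      \<open>w\<close> in \<open>r\<close> remains to be mapped into \<open>s\<close>.\<close>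
    ultimately obtain c'' v w where c'': "regular_epi C c''" and "Cod C c'' = Dom C (x \<cdot> c')"
      and xv: "mem C (p, q) ((x \<cdot> c') \<cdot> c'') v" and vw: "mem C r v w"
      and wz: "mem C (p, q) w (z \<cdot> c'')"
      using yz by - (rule three_permutable_local[OF r K])
    then have [simp]: "Cod C c'' = Dom C c'"
      by simp
    note [simp] = regular_epi_arr[OF c'']
    have "f \<cdot> v = f \<cdot> ((x \<cdot> c') \<cdot> c'')"
      using xv by (simp add: mem_kernel_pair[OF pb])
    also have "\<dots> = ((a \<cdot> c) \<cdot> c') \<cdot> c''"
      using comp_eq_extend[OF fx, of "c' \<cdot> c''"] by simp
    finally have fv: "f \<cdot> v = ((a \<cdot> c) \<cdot> c') \<cdot> c''" .
    have "f \<cdot> w = f \<cdot> (z \<cdot> c'')"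
      using wz by (simp add: mem_kernel_pair[OF pb])
    also have "\<dots> = ((d \<cdot> c) \<cdot> c') \<cdot> c''"
      using comp_eq_extend[OF fz, of c''] by simp
    finally have fw: "f \<cdot> w = ((d \<cdot> c) \<cdot> c') \<cdot> c''" .
    have "mem C s (((a \<cdot> c) \<cdot> c') \<cdot> c'') (((d \<cdot> c) \<cdot> c') \<cdot> c'')"
      using push[OF vw] by (simp only: fv fw)
    then have "mem C s ((a \<cdot> c) \<cdot> c') ((d \<cdot> c) \<cdot> c')"
      by (rule mem_local[OF c'' S]) simp_all
    then have "mem C s (a \<cdot> c) (d \<cdot> c)"
      by (rule mem_local[OF c' S]) simp_all
    then show ?thesis
      by (rule mem_local[OF c S]) simp_all
  qed
  ultimately have "equivalence_rel C (Cod C f) s"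
    unfolding equivalence_rel_mem
    using S \<open>Cod C (fst s) = Cod C f\<close> \<open>Cod C (snd s) = Cod C f\<close> by blast
  from that[OF this e _ _ eq] show thesis
    by simp
qed

end

section \<open>Functors\<close>

lemma is_functorD:
  assumes "is_functor D C Fo Fa" "u \<in> Arr D"
  shows "Fa u \<in> Arr C" "Dom C (Fa u) = Fo (Dom D u)" "Cod C (Fa u) = Fo (Cod D u)"
  using assms by (auto simp: is_functor_def hom_def)

lemma is_functor_comp:
  assumes "is_functor D C Fo Fa" "u \<in> Arr D" "v \<in> Arr D" "Cod D u = Dom D v"
  shows "Fa (v \<cdot>\<^bsub>D\<^esub> u) = Fa v \<cdot>\<^bsub>C\<^esub> Fa u"
  using assms by (simp add: is_functor_def)

lemma is_functor_Ident:
  assumes "is_functor D C Fo Fa" "X \<in> Obj D"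
  shows "Fa (Ident D X) = Ident C (Fo X)" "Fo X \<in> Obj C"
  using assms by (auto simp: is_functor_def)

lemma is_functor_compose:
  assumes F: "is_functor J D Fo Fa" and G: "is_functor D C Go Ga"
  shows "is_functor J C (\<lambda>j. Go (Fo j)) (\<lambda>u. Ga (Fa u))"
  unfolding is_functor_def
proof (intro conjI ballI impI)
  show "Go (Fo j) \<in> Obj C" "Ga (Fa (Ident J j)) = Ident C (Go (Fo j))" if "j \<in> Obj J" for j
    using is_functor_Ident[OF F that] is_functor_Ident[OF G] by simp_all
  show "Ga (Fa u) \<in> hom C (Go (Fo (Dom J u))) (Go (Fo (Cod J u)))" if "u \<in> Arr J" for u
    using is_functorD[OF F that] is_functorD[OF G] by (simp add: hom_def)
  show "Ga (Fa (v \<cdot>\<^bsub>J\<^esub> u)) = Ga (Fa v) \<cdot>\<^bsub>C\<^esub> Ga (Fa u)"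
    if "u \<in> Arr J" "v \<in> Arr J" "Cod J u = Dom J v" for u v
    using is_functor_comp[OF F that] is_functor_comp[OF G, of "Fa u" "Fa v"]
      is_functorD[OF F that(1)] is_functorD[OF F that(2)] that(3) by simp
qed

lemma is_coneD:
  assumes "is_cone J C Fo Fa L \<pi>" "j \<in> Obj J"
  shows "\<pi> j \<in> Arr C" "Dom C (\<pi> j) = L" "Cod C (\<pi> j) = Fo j"
  using assms by (auto simp: is_cone_def hom_def)

lemma is_cone_functor:
  assumes J: "category J" and F: "is_functor J D Fo Fa" and G: "is_functor D C Go Ga"
    and c: "is_cone J D Fo Fa L \<pi>"
  shows "is_cone J C (\<lambda>j. Go (Fo j)) (\<lambda>u. Ga (Fa u)) (Go L) (\<lambda>j. Ga (\<pi> j))"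
  unfolding is_cone_def
proof (intro conjI ballI)
  show "Go L \<in> Obj C"
    using c is_functor_Ident(2)[OF G] by (simp add: is_cone_def)
  show "Ga (\<pi> j) \<in> hom C (Go L) (Go (Fo j))" if "j \<in> Obj J" for j
    using is_coneD[OF c that] is_functorD[OF G] by (simp add: hom_def)
  show "Ga (Fa u) \<cdot>\<^bsub>C\<^esub> Ga (\<pi> (Dom J u)) = Ga (\<pi> (Cod J u))" if "u \<in> Arr J" for u
    using c that is_functor_comp[OF G, of "\<pi> (Dom J u)" "Fa u"] is_functorD[OF F that]
      is_coneD[OF c category.Dom_in[OF J that]] by (simp add: is_cone_def)
qed

lemma functor_isomorphism:
  assumes D: "category D" and G: "is_functor D C Go Ga" and i: "isomorphism D i"
  shows "isomorphism C (Ga i)"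
proof -
  interpret D: category D by (fact D)
  have i': "i \<in> Arr D"
    using i by (simp add: isomorphism_def)
  obtain j where j: "j \<in> Arr D" "Dom D j = Cod D i" "Cod D j = Dom D i"
    "j \<cdot>\<^bsub>D\<^esub> i = Ident D (Dom D i)" "i \<cdot>\<^bsub>D\<^esub> j = Ident D (Cod D i)"
    using D.isomorphismE[OF i] .
  have "Ga j \<cdot>\<^bsub>C\<^esub> Ga i = Ident C (Go (Dom D i))" "Ga i \<cdot>\<^bsub>C\<^esub> Ga j = Ident C (Go (Cod D i))"
    using is_functor_comp[OF G i' j(1)] is_functor_comp[OF G j(1) i'] j i'
    by (simp_all add: is_functor_Ident[OF G])
  then show ?thesis
    unfolding isomorphism_def using is_functorD[OF G i'] is_functorD[OF G j(1)] j(2,3)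
    by (intro conjI bexI[of _ "Ga j"]) (simp_all add: hom_def)
qed

text \<open>Preservation has to be verified for one pullback only: any other differs from it by an
  isomorphism, and functors preserve isomorphisms.\<close>

lemma functor_pullback:
  assumes D: "category D" and C: "category C" and G: "is_functor D C Go Ga"
    and pb: "is_pullback D f g p q" and pbC: "is_pullback C (Ga f) (Ga g) (Ga p) (Ga q)"
    and pb': "is_pullback D f g p' q'"
  shows "is_pullback C (Ga f) (Ga g) (Ga p') (Ga q')"
proof -
  interpret D: category D by (fact D)
  interpret C: category C by (fact C)
  obtain i where i: "isomorphism D i" "Dom D i = Dom D p'" "Cod D i = Dom D p"
    "p \<cdot>\<^bsub>D\<^esub> i = p'" "q \<cdot>\<^bsub>D\<^esub> i = q'"
    using D.pullback_unique[OF pb pb'] .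
  have i': "i \<in> Arr D"
    using i(1) by (simp add: isomorphism_def)
  have "Ga p \<cdot>\<^bsub>C\<^esub> Ga i = Ga p'" "Ga q \<cdot>\<^bsub>C\<^esub> Ga i = Ga q'"
    using is_functor_comp[OF G i', of p] is_functor_comp[OF G i', of q] i is_pullbackD[OF pb]
    by simp_all
  moreover have "Cod C (Ga i) = Dom C (Ga p)"
    using is_functorD[OF G i'] is_functorD[OF G is_pullbackD(4)[OF pb]] i(3) by simp
  ultimately show ?thesis
    using C.pullback_iso[OF pbC functor_isomorphism[OF D G i(1)]] by simp
qed

section \<open>Limits in the category of equivalence relations\<close>

text \<open>For a relation from R to X \<times> X, index 0 always refers to the level of X and index
  1 to the level of R, on objects as on arrows.\<close>

abbreviation obj0 :: "('o, 'a) cat \<Rightarrow> 'a \<times> 'a \<Rightarrow> 'o" where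
  "obj0 C \<equiv> \<lambda>r. Cod C (fst r)"

abbreviation obj1 :: "('o, 'a) cat \<Rightarrow> 'a \<times> 'a \<Rightarrow> 'o" where
  "obj1 C \<equiv> \<lambda>r. Dom C (fst r)"

definition arr0 :: "'a equiv_arr \<Rightarrow> 'a" where
  "arr0 F = fst (fst (snd F))"

definition arr1 :: "'a equiv_arr \<Rightarrow> 'a" where
  "arr1 F = snd (fst (snd F))"

lemma arr_simps [simp]:
  "arr0 (r, (f, g), s) = f" "arr1 (r, (f, g), s) = g"
  "arr0 (G \<cdot>\<^bsub>Equiv C\<^esub> F) = arr0 G \<cdot>\<^bsub>C\<^esub> arr0 F" "arr1 (G \<cdot>\<^bsub>Equiv C\<^esub> F) = arr1 G \<cdot>\<^bsub>C\<^esub> arr1 F"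
  "arr0 (Ident (Equiv C) r) = Ident C (obj0 C r)" "arr1 (Ident (Equiv C) r) = Ident C (obj1 C r)"
  by (auto simp: arr0_def arr1_def Equiv_def case_prod_beta)

lemma Equiv_Dom_Cod [simp]:
  "Dom (Equiv C) (r, fg, s) = r" "Cod (Equiv C) (r, fg, s) = s"
  by (auto simp: Equiv_def)

context regular_category
begin

lemma Equiv_obj_iff: "r \<in> Obj (Equiv C) \<longleftrightarrow> equivalence_rel C (obj0 C r) r"
proof
  assume "r \<in> Obj (Equiv C)"
  then obtain X where X: "equivalence_rel C X r"
    by (auto simp: Equiv_def)
  then show "equivalence_rel C (obj0 C r) r"
    by (simp add: equivalence_relD(2)[OF X])
next
  assume r: "equivalence_rel C (obj0 C r) r"
  then have "obj0 C r \<in> Obj C"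
    using jointly_monicD[OF equivalence_relD(1)[OF r]] by simp
  with r show "r \<in> Obj (Equiv C)"
    by (auto simp: Equiv_def)
qed

text \<open>The leg is a variable \<open>l\<close> ranging over \<open>fst\<close> and
  \<open>snd\<close>, so that an argument for both legs is given once.\<close>

lemma Equiv_objD:
  assumes "r \<in> Obj (Equiv C)"
  shows "jointly_monic C r" "\<And>x. x \<in> Arr C \<Longrightarrow> Cod C x = Cod C (fst r) \<Longrightarrow> mem C r x x"
    "l \<in> {fst, snd} \<Longrightarrow> l r \<in> Arr C" "l \<in> {fst, snd} \<Longrightarrow> Dom C (l r) = Dom C (fst r)"
    "l \<in> {fst, snd} \<Longrightarrow> Cod C (l r) = Cod C (fst r)"
  using assms jointly_monicD[of C r] equivalence_relD(1-4)[of "Cod C (fst r)" r]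
  by (auto simp: Equiv_obj_iff)

lemma Equiv_arr_iff:
  "F \<in> Arr (Equiv C) \<longleftrightarrow> F = (Dom (Equiv C) F, (arr0 F, arr1 F), Cod (Equiv C) F) \<and>
     Dom (Equiv C) F \<in> Obj (Equiv C) \<and> Cod (Equiv C) F \<in> Obj (Equiv C) \<and>
     arr0 F \<in> hom C (obj0 C (Dom (Equiv C) F)) (obj0 C (Cod (Equiv C) F)) \<and>
     arr1 F \<in> hom C (obj1 C (Dom (Equiv C) F)) (obj1 C (Cod (Equiv C) F)) \<and>
     (\<forall>l \<in> {fst, snd}. l (Cod (Equiv C) F) \<cdot> arr1 F = arr0 F \<cdot> l (Dom (Equiv C) F))"
  by (cases F) (auto simp: Equiv_def arr0_def arr1_def)

lemma Equiv_arrI: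
  assumes "r \<in> Obj (Equiv C)" "s \<in> Obj (Equiv C)" "f \<in> Arr C" "g \<in> Arr C"
    "Dom C f = obj0 C r" "Cod C f = obj0 C s" "Dom C g = obj1 C r" "Cod C g = obj1 C s"
    "\<And>l. l \<in> {fst, snd} \<Longrightarrow> l s \<cdot> g = f \<cdot> l r"
  shows "(r, (f, g), s) \<in> Arr (Equiv C)"
  using assms by (simp add: Equiv_arr_iff hom_def)

lemma Equiv_arrD:
  assumes "F \<in> Arr (Equiv C)"
  shows "Dom (Equiv C) F \<in> Obj (Equiv C)" "Cod (Equiv C) F \<in> Obj (Equiv C)"
    "arr0 F \<in> Arr C" "Dom C (arr0 F) = obj0 C (Dom (Equiv C) F)"
    "Cod C (arr0 F) = obj0 C (Cod (Equiv C) F)"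
    "arr1 F \<in> Arr C" "Dom C (arr1 F) = obj1 C (Dom (Equiv C) F)"
    "Cod C (arr1 F) = obj1 C (Cod (Equiv C) F)"
  using assms by (auto simp: Equiv_arr_iff hom_def)

lemma Equiv_naturality:
  assumes "F \<in> Arr (Equiv C)" "l \<in> {fst, snd}"
  shows "l (Cod (Equiv C) F) \<cdot> arr1 F = arr0 F \<cdot> l (Dom (Equiv C) F)"
  using assms by (auto simp: Equiv_arr_iff)

text \<open>The two naturality equations fix both legs of the target after \<open>arr1\<close>, and
  these legs are jointly monic. Equations in Equiv(C) thus need checking on level 0 only.\<close>

lemma Equiv_arr_eqI:
  assumes F: "F \<in> Arr (Equiv C)" and G: "G \<in> Arr (Equiv C)"
    and dom: "Dom (Equiv C) F = Dom (Equiv C) G" and cod: "Cod (Equiv C) F = Cod (Equiv C) G"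
    and eq: "arr0 F = arr0 G"
  shows "F = G"
proof -
  note [simp] = Equiv_arrD[OF F] Equiv_arrD[OF G]
  have "l (Cod (Equiv C) G) \<cdot> arr1 F = l (Cod (Equiv C) G) \<cdot> arr1 G" if "l \<in> {fst, snd}" for l
    using Equiv_naturality[OF F that] Equiv_naturality[OF G that] by (simp add: dom cod eq)
  then have "arr1 F = arr1 G"
    by - (rule jointly_monic_cancel[OF Equiv_objD(1)[of "Cod (Equiv C) G"]], simp_all add: dom cod)
  then show ?thesis
    using F G dom cod eq unfolding Equiv_arr_iff by metis
qed

lemma Equiv_comp_arr:
  assumes F: "F \<in> Arr (Equiv C)" and G: "G \<in> Arr (Equiv C)"
    and FG: "Dom (Equiv C) G = Cod (Equiv C) F"
  shows "G \<cdot>\<^bsub>Equiv C\<^esub> F \<in> Arr (Equiv C)" "Dom (Equiv C) (G \<cdot>\<^bsub>Equiv C\<^esub> F) = Dom (Equiv C) F"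
    "Cod (Equiv C) (G \<cdot>\<^bsub>Equiv C\<^esub> F) = Cod (Equiv C) G"
proof -
  note [simp] = Equiv_arrD[OF F] Equiv_arrD[OF G] FG[symmetric]
  let ?r = "Dom (Equiv C) F" and ?t = "Cod (Equiv C) G"
  have "l ?t \<cdot> (arr1 G \<cdot> arr1 F) = (arr0 G \<cdot> arr0 F) \<cdot> l ?r" if l: "l \<in> {fst, snd}" for l
  proof -
    note [simp] = Equiv_objD(3-5)[OF _ l]
    have "l ?t \<cdot> (arr1 G \<cdot> arr1 F) = arr0 G \<cdot> (l (Dom (Equiv C) G) \<cdot> arr1 F)"
      by (rule comp_eq_extend[OF Equiv_naturality[OF G l]]) simp_all
    also have "\<dots> = arr0 G \<cdot> (arr0 F \<cdot> l ?r)"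
      using Equiv_naturality[OF F l] by simp
    finally show ?thesis
      by simp
  qed
  then have "(?r, (arr0 G \<cdot> arr0 F, arr1 G \<cdot> arr1 F), ?t) \<in> Arr (Equiv C)"
    by (intro Equiv_arrI) simp_all
  moreover have "G \<cdot>\<^bsub>Equiv C\<^esub> F = (?r, (arr0 G \<cdot> arr0 F, arr1 G \<cdot> arr1 F), ?t)"
    by (simp add: Equiv_def arr0_def arr1_def case_prod_beta)
  ultimately show "G \<cdot>\<^bsub>Equiv C\<^esub> F \<in> Arr (Equiv C)"
    "Dom (Equiv C) (G \<cdot>\<^bsub>Equiv C\<^esub> F) = Dom (Equiv C) F"
    "Cod (Equiv C) (G \<cdot>\<^bsub>Equiv C\<^esub> F) = Cod (Equiv C) G"
    by simp_all
qed

lemma Equiv_Ident: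
  assumes r: "r \<in> Obj (Equiv C)"
  shows "Ident (Equiv C) r \<in> Arr (Equiv C)" "Dom (Equiv C) (Ident (Equiv C) r) = r"
    "Cod (Equiv C) (Ident (Equiv C) r) = r"
proof -
  note [simp] = jointly_monicD[OF Equiv_objD(1)[OF r]] Equiv_objD(5)[OF r, of snd]
  have "(r, (Ident C (obj0 C r), Ident C (obj1 C r)), r) \<in> Arr (Equiv C)"
    by (rule Equiv_arrI[OF r r]) auto
  moreover have "Ident (Equiv C) r = (r, (Ident C (obj0 C r), Ident C (obj1 C r)), r)"
    by (simp add: Equiv_def case_prod_beta)
  ultimately show "Ident (Equiv C) r \<in> Arr (Equiv C)" "Dom (Equiv C) (Ident (Equiv C) r) = r"
    "Cod (Equiv C) (Ident (Equiv C) r) = r"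
    by simp_all
qed

lemma category_Equiv: "category (Equiv C)"
proof
  fix F G H r s t u
  show "Dom (Equiv C) F \<in> Obj (Equiv C)" "Cod (Equiv C) F \<in> Obj (Equiv C)"
    if "F \<in> Arr (Equiv C)"
    using Equiv_arrD[OF that] by simp_all
  show "Ident (Equiv C) r \<in> hom (Equiv C) r r" if "r \<in> Obj (Equiv C)"
    using Equiv_Ident[OF that] by (simp add: hom_def)
  show "G \<cdot>\<^bsub>Equiv C\<^esub> F \<in> hom (Equiv C) r t"
    if "F \<in> hom (Equiv C) r s" "G \<in> hom (Equiv C) s t"
    using that by (simp add: hom_def Equiv_comp_arr)
  show "F \<cdot>\<^bsub>Equiv C\<^esub> Ident (Equiv C) r = F" "Ident (Equiv C) s \<cdot>\<^bsub>Equiv C\<^esub> F = F"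
    if "F \<in> hom (Equiv C) r s"
    using that Equiv_arrD[of F]
    by (auto intro!: Equiv_arr_eqI simp: hom_def Equiv_comp_arr Equiv_Ident)
  show "(H \<cdot>\<^bsub>Equiv C\<^esub> G) \<cdot>\<^bsub>Equiv C\<^esub> F = H \<cdot>\<^bsub>Equiv C\<^esub> (G \<cdot>\<^bsub>Equiv C\<^esub> F)"
    if "F \<in> hom (Equiv C) r s" "G \<in> hom (Equiv C) s t" "H \<in> hom (Equiv C) t u"
    using that Equiv_arrD[of F] Equiv_arrD[of G] Equiv_arrD[of H]
    by (intro Equiv_arr_eqI) (simp_all add: hom_def Equiv_comp_arr)
qed

lemma functor_arr0: "is_functor (Equiv C) C (obj0 C) arr0"
  unfolding is_functor_def
  using Equiv_arrD Equiv_objD(3)[of _ fst] by (simp add: hom_def)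

lemma functor_arr1: "is_functor (Equiv C) C (obj1 C) arr1"
  unfolding is_functor_def
  using Equiv_arrD Equiv_objD(3)[of _ fst] by (simp add: hom_def)

interpretation Equiv: category "Equiv C"
  by (rule category_Equiv)

text \<open>The two limit cones in C are prescribed and reappear as the components of the new cone,
  so the limit built in Equiv(C) is visibly preserved by both functors. The legs of the limit
  relation are induced by the legs of the relations \<open>Fo j\<close>.\<close>

lemma Equiv_limit:
  assumes J: "category J" and F: "is_functor J (Equiv C) Fo Fa"
    and limL: "is_limit J C (\<lambda>j. obj0 C (Fo j)) (\<lambda>u. arr0 (Fa u)) L \<pi>"
    and limM: "is_limit J C (\<lambda>j. obj1 C (Fo j)) (\<lambda>u. arr1 (Fa u)) M \<mu>"
  obtains R \<rho> where "is_limit J (Equiv C) Fo Fa R \<rho>" "obj0 C R = L" "obj1 C R = M"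
    "\<And>j. arr0 (\<rho> j) = \<pi> j" "\<And>j. arr1 (\<rho> j) = \<mu> j"
proof -
  interpret J: category J by (fact J)
  note F0 = is_functor_compose[OF F functor_arr0] and F1 = is_functor_compose[OF F functor_arr1]
  have coneL: "is_cone J C (\<lambda>j. obj0 C (Fo j)) (\<lambda>u. arr0 (Fa u)) L \<pi>"
    and coneM: "is_cone J C (\<lambda>j. obj1 C (Fo j)) (\<lambda>u. arr1 (Fa u)) M \<mu>"
    using limL limM by (auto simp: is_limit_def)
  note [simp] = is_coneD[OF coneL] is_coneD[OF coneM] is_functor_Ident(2)[OF F] is_functorD[OF F]
  have [simp]: "L \<in> Obj C" "M \<in> Obj C"
    using coneL coneM by (auto simp: is_cone_def)
  \<comment> \<open>Naturality of the arrows \<open>Fa u\<close> turns the level 1 cone, followed by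
    one leg, into a cone over the level 0 diagram.\<close>
  have leg: "\<exists>r \<in> hom C M L. \<forall>j \<in> Obj J. \<pi> j \<cdot> r = l (Fo j) \<cdot> \<mu> j" if l: "l \<in> {fst, snd}" for l
  proof -
    note [simp] = Equiv_objD(3-5)[OF _ l]
    have "is_cone J C (\<lambda>j. obj0 C (Fo j)) (\<lambda>u. arr0 (Fa u)) M (\<lambda>j. l (Fo j) \<cdot> \<mu> j)"
      unfolding is_cone_def
    proof (intro conjI ballI)
      fix u assume u [simp]: "u \<in> Arr J"
      note [simp] = Equiv_arrD[OF is_functorD(1)[OF F u]]
      have nat: "arr0 (Fa u) \<cdot> l (Fo (Dom J u)) = l (Fo (Cod J u)) \<cdot> arr1 (Fa u)"
        using Equiv_naturality[OF is_functorD(1)[OF F u] l] by simp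
      have "arr0 (Fa u) \<cdot> (l (Fo (Dom J u)) \<cdot> \<mu> (Dom J u)) =
          l (Fo (Cod J u)) \<cdot> (arr1 (Fa u) \<cdot> \<mu> (Dom J u))"
        by (rule comp_eq_extend[OF nat]) simp_all
      also have "arr1 (Fa u) \<cdot> \<mu> (Dom J u) = \<mu> (Cod J u)"
        using coneM u by (simp add: is_cone_def)
      finally show "arr0 (Fa u) \<cdot> (l (Fo (Dom J u)) \<cdot> \<mu> (Dom J u)) = l (Fo (Cod J u)) \<cdot> \<mu> (Cod J u)" .
    qed (simp_all add: hom_def)
    then obtain r where "r \<in> hom C M L" "\<And>j. j \<in> Obj J \<Longrightarrow> \<pi> j \<cdot> r = l (Fo j) \<cdot> \<mu> j"
      by (rule is_limit_factor[OF limL]) (rule that)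
    then show ?thesis
      by blast
  qed
  obtain r1 where r1: "r1 \<in> hom C M L" "\<And>j. j \<in> Obj J \<Longrightarrow> \<pi> j \<cdot> r1 = fst (Fo j) \<cdot> \<mu> j"
    using leg[of fst] by auto
  obtain r2 where r2: "r2 \<in> hom C M L" "\<And>j. j \<in> Obj J \<Longrightarrow> \<pi> j \<cdot> r2 = snd (Fo j) \<cdot> \<mu> j"
    using leg[of snd] by auto
  define R where "R = (r1, r2)"
  have R_arr: "l R \<in> Arr C" "Dom C (l R) = M" "Cod C (l R) = L" if "l \<in> {fst, snd}" for l
    using r1 r2 that by (auto simp: R_def hom_def)
  note [simp] = R_arr[of fst, simplified] R_arr[of snd, simplified]
  have R_leg: "\<pi> j \<cdot> l R = l (Fo j) \<cdot> \<mu> j" if "j \<in> Obj J" "l \<in> {fst, snd}" for j l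
    using r1(2) r2(2) that by (auto simp: R_def)
  have R_leg_comp: "\<pi> j \<cdot> (l R \<cdot> a) = l (Fo j) \<cdot> (\<mu> j \<cdot> a)"
    if [simp]: "j \<in> Obj J" "a \<in> Arr C" "Cod C a = M" and l: "l \<in> {fst, snd}" for j l a
  proof -
    note [simp] = Equiv_objD(3-5)[OF _ l] R_arr[OF l]
    show ?thesis
      by (rule comp_eq_extend[OF R_leg[OF that(1) l]]) simp_all
  qed
  have jm: "jointly_monic C R"
  proof -
    have "a = b" if "a \<in> hom C Z M" "b \<in> hom C Z M" "fst R \<cdot> a = fst R \<cdot> b" "snd R \<cdot> a = snd R \<cdot> b"
      for Z a b
    proof (rule is_limit_cancel[OF limM J F1])
      have [simp]: "a \<in> Arr C" "b \<in> Arr C" "Dom C a = Z" "Dom C b = Z" "Cod C a = M" "Cod C b = M"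
        using that by (auto simp: hom_def)
      then show "a \<in> Arr C" "b \<in> Arr C" "Dom C a = Dom C b" "Cod C a = M" "Cod C b = M"
        by simp_all
      fix j assume j [simp]: "j \<in> Obj J"
      have "l (Fo j) \<cdot> (\<mu> j \<cdot> a) = l (Fo j) \<cdot> (\<mu> j \<cdot> b)" if "l \<in> {fst, snd}" for l
        using R_leg_comp[OF j _ _ that, of a] R_leg_comp[OF j _ _ that, of b]
          \<open>fst R \<cdot> a = fst R \<cdot> b\<close> \<open>snd R \<cdot> a = snd R \<cdot> b\<close> that by auto
      then show "\<mu> j \<cdot> a = \<mu> j \<cdot> b"
        by - (rule jointly_monic_cancel[OF Equiv_objD(1)[OF is_functor_Ident(2)[OF F j]]], simp_all)
    qed
    then show ?thesis
      unfolding jointly_monic_def by simp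
  qed
  \<comment> \<open>Membership in the limit relation is componentwise, so reflexivity, symmetry and
    transitivity are inherited from the relations \<open>Fo j\<close>.\<close>
  have mem_R: "mem C R x y \<longleftrightarrow> (\<forall>j \<in> Obj J. mem C (Fo j) (\<pi> j \<cdot> x) (\<pi> j \<cdot> y))"
    if [simp]: "x \<in> Arr C" "y \<in> Arr C" "Dom C y = Dom C x" "Cod C x = L" "Cod C y = L" for x y
  proof
    assume "mem C R x y"
    then obtain h where [simp]: "h \<in> Arr C" "Dom C h = Dom C x" "Cod C h = M"
      and h: "fst R \<cdot> h = x" "snd R \<cdot> h = y"
      by (rule memE) simp
    show "\<forall>j \<in> Obj J. mem C (Fo j) (\<pi> j \<cdot> x) (\<pi> j \<cdot> y)"
    proof
      fix j assume j [simp]: "j \<in> Obj J"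
      have "fst (Fo j) \<cdot> (\<mu> j \<cdot> h) = \<pi> j \<cdot> x" "snd (Fo j) \<cdot> (\<mu> j \<cdot> h) = \<pi> j \<cdot> y"
        by (simp_all flip: R_leg_comp add: h)
      then show "mem C (Fo j) (\<pi> j \<cdot> x) (\<pi> j \<cdot> y)"
        by - (rule memI[of "\<mu> j \<cdot> h"], simp_all)
    qed
  next
    assume "\<forall>j \<in> Obj J. mem C (Fo j) (\<pi> j \<cdot> x) (\<pi> j \<cdot> y)"
    then have "\<forall>j \<in> Obj J. \<exists>h. h \<in> Arr C \<and> Dom C h = Dom C x \<and> Cod C h = obj1 C (Fo j) \<and>
        fst (Fo j) \<cdot> h = \<pi> j \<cdot> x \<and> snd (Fo j) \<cdot> h = \<pi> j \<cdot> y"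
      by (auto simp: mem_def hom_def)
    then obtain h where h: "\<And>j. j \<in> Obj J \<Longrightarrow> h j \<in> Arr C \<and> Dom C (h j) = Dom C x \<and>
        Cod C (h j) = obj1 C (Fo j) \<and> fst (Fo j) \<cdot> h j = \<pi> j \<cdot> x \<and> snd (Fo j) \<cdot> h j = \<pi> j \<cdot> y"
      by metis
    note [simp] = h[THEN conjunct1] h[THEN conjunct2, THEN conjunct1]
      h[THEN conjunct2, THEN conjunct2, THEN conjunct1]
    \<comment> \<open>The selected witnesses are automatically compatible: each is determined by its
      legs, and the legs agree along \<open>u\<close> because \<open>\<pi>\<close> is a
      cone.\<close>
    have "is_cone J C (\<lambda>j. obj1 C (Fo j)) (\<lambda>u. arr1 (Fa u)) (Dom C x) h"
      unfolding is_cone_def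
    proof (intro conjI ballI)
      fix u assume u [simp]: "u \<in> Arr J"
      note Fu = is_functorD(1)[OF F u]
      note [simp] = Equiv_arrD[OF Fu]
      have "l (Fo (Cod J u)) \<cdot> (arr1 (Fa u) \<cdot> h (Dom J u)) = l (Fo (Cod J u)) \<cdot> h (Cod J u)"
        if l: "l \<in> {fst, snd}" and z: "z \<in> Arr C" "Cod C z = L" "Dom C z = Dom C x"
          and leg: "\<And>j. j \<in> Obj J \<Longrightarrow> l (Fo j) \<cdot> h j = \<pi> j \<cdot> z" for l z
      proof -
        note [simp] = Equiv_objD(3-5)[OF _ l] z
        have nat: "l (Fo (Cod J u)) \<cdot> arr1 (Fa u) = arr0 (Fa u) \<cdot> l (Fo (Dom J u))"
          using Equiv_naturality[OF Fu l] by simp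
        have "l (Fo (Cod J u)) \<cdot> (arr1 (Fa u) \<cdot> h (Dom J u)) =
            arr0 (Fa u) \<cdot> (l (Fo (Dom J u)) \<cdot> h (Dom J u))"
          by (rule comp_eq_extend[OF nat]) simp_all
        also have "\<dots> = arr0 (Fa u) \<cdot> (\<pi> (Dom J u) \<cdot> z)"
          by (simp add: leg)
        also have "\<dots> = \<pi> (Cod J u) \<cdot> z"
          using coneL by (intro comp_eq_extend1) (simp_all add: is_cone_def)
        finally show ?thesis
          by (simp add: leg)
      qed
      from this[of fst x] this[of snd y] show "arr1 (Fa u) \<cdot> h (Dom J u) = h (Cod J u)"
        using h by - (rule jointly_monic_cancel[OF Equiv_objD(1)[of "Fo (Cod J u)"]], simp_all)
    qed (simp_all add: hom_def)
    then obtain k where k: "k \<in> hom C (Dom C x) M"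
      and k_eq: "\<And>j. j \<in> Obj J \<Longrightarrow> \<mu> j \<cdot> k = h j"
      by (rule is_limit_factor[OF limM]) (rule that)
    then have [simp]: "k \<in> Arr C" "Dom C k = Dom C x" "Cod C k = M"
      by (auto simp: hom_def)
    have "fst R \<cdot> k = x"
      by (rule is_limit_cancel[OF limL J F0]) (simp_all add: R_leg_comp k_eq h)
    moreover have "snd R \<cdot> k = y"
      by (rule is_limit_cancel[OF limL J F0]) (simp_all add: R_leg_comp k_eq h)
    ultimately show "mem C R x y"
      by (intro memI[of k]) simp_all
  qed
  have Fo_equiv: "equivalence_rel C (obj0 C (Fo j)) (Fo j)" if "j \<in> Obj J" for j
    using that by (simp flip: Equiv_obj_iff)
  have "equivalence_rel C L R"
    unfolding equivalence_rel_mem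
  proof (intro conjI ballI allI impI)
    show "mem C R x x" if "x \<in> Arr C" "Cod C x = L" for x
      using that by (simp add: mem_R equivalence_relD(4)[OF Fo_equiv])
    show "mem C R y x" if xy: "mem C R x y" for x y
    proof -
      note [simp] = mem_arrD[OF jm xy]
      have "\<forall>j \<in> Obj J. mem C (Fo j) (\<pi> j \<cdot> x) (\<pi> j \<cdot> y)"
        using xy by (subst (asm) mem_R) simp_all
      then show ?thesis
        by (subst mem_R) (simp_all add: equivalence_relD(5)[OF Fo_equiv])
    qed
    show "mem C R x z" if xy: "mem C R x y" and yz: "mem C R y z" for x y z
    proof -
      note [simp] = mem_arrD[OF jm xy] mem_arrD[OF jm yz]
      have "\<forall>j \<in> Obj J. mem C (Fo j) (\<pi> j \<cdot> x) (\<pi> j \<cdot> y)"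
        using xy by (subst (asm) mem_R) simp_all
      moreover have "\<forall>j \<in> Obj J. mem C (Fo j) (\<pi> j \<cdot> y) (\<pi> j \<cdot> z)"
        using yz by (subst (asm) mem_R) simp_all
      ultimately have "\<forall>j \<in> Obj J. mem C (Fo j) (\<pi> j \<cdot> x) (\<pi> j \<cdot> z)"
        using equivalence_relD(6)[OF Fo_equiv] by blast
      then show ?thesis
        by (subst mem_R) simp_all
    qed
  qed (simp_all add: jm)
  then have R [simp]: "R \<in> Obj (Equiv C)"
    by (simp add: Equiv_obj_iff)
  define \<rho> where "\<rho> = (\<lambda>j. (R, (\<pi> j, \<mu> j), Fo j))"
  have \<rho>_arr [simp]: "\<rho> j \<in> Arr (Equiv C)" if "j \<in> Obj J" for j
    using that unfolding \<rho>_def by (intro Equiv_arrI) (simp_all add: R_leg)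
  have [simp]: "arr0 (\<rho> j) = \<pi> j" "arr1 (\<rho> j) = \<mu> j" "Dom (Equiv C) (\<rho> j) = R"
    "Cod (Equiv C) (\<rho> j) = Fo j" for j
    by (simp_all add: \<rho>_def)
  have cone: "is_cone J (Equiv C) Fo Fa R \<rho>"
    unfolding is_cone_def
  proof (intro conjI ballI)
    show "Fa u \<cdot>\<^bsub>Equiv C\<^esub> \<rho> (Dom J u) = \<rho> (Cod J u)" if "u \<in> Arr J" for u
      using that coneL by (intro Equiv_arr_eqI) (simp_all add: is_cone_def)
  qed (simp_all add: hom_def)
  have "\<exists>!H. H \<in> hom (Equiv C) N R \<and> (\<forall>j \<in> Obj J. \<rho> j \<cdot>\<^bsub>Equiv C\<^esub> H = \<nu> j)"
    if coneN: "is_cone J (Equiv C) Fo Fa N \<nu>" for N \<nu>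
  proof -
    note [simp] = is_coneD[OF coneN]
    have N [simp]: "N \<in> Obj (Equiv C)"
      using coneN by (simp add: is_cone_def)
    obtain h0 where h0: "h0 \<in> hom C (obj0 C N) L" "\<And>j. j \<in> Obj J \<Longrightarrow> \<pi> j \<cdot> h0 = arr0 (\<nu> j)"
      by (rule is_limit_factor[OF limL is_cone_functor[OF J F functor_arr0 coneN]]) (rule that)
    obtain h1 where h1: "h1 \<in> hom C (obj1 C N) M" "\<And>j. j \<in> Obj J \<Longrightarrow> \<mu> j \<cdot> h1 = arr1 (\<nu> j)"
      by (rule is_limit_factor[OF limM is_cone_functor[OF J F functor_arr1 coneN]]) (rule that)
    have [simp]: "h0 \<in> Arr C" "Dom C h0 = obj0 C N" "Cod C h0 = L"
      "h1 \<in> Arr C" "Dom C h1 = obj1 C N" "Cod C h1 = M"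
      using h0 h1 by (auto simp: hom_def)
    \<comment> \<open>The mediating arrows of the two levels were obtained independently; that they
      respect the legs is checked after each projection \<open>\<pi> j\<close>, using naturality of
      \<open>\<nu> j\<close>.\<close>
    have compat: "l R \<cdot> h1 = h0 \<cdot> l N" if l: "l \<in> {fst, snd}" for l
    proof (rule is_limit_cancel[OF limL J F0])
      note [simp] = Equiv_objD(3-5)[OF _ l] R_arr[OF l] R_leg_comp[OF _ _ _ l]
      show "l R \<cdot> h1 \<in> Arr C" "h0 \<cdot> l N \<in> Arr C" "Dom C (l R \<cdot> h1) = Dom C (h0 \<cdot> l N)"
        "Cod C (l R \<cdot> h1) = L" "Cod C (h0 \<cdot> l N) = L"
        by simp_all
      fix j assume j [simp]: "j \<in> Obj J"
      have "\<pi> j \<cdot> (h0 \<cdot> l N) = arr0 (\<nu> j) \<cdot> l N"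
        by (rule comp_eq_extend1[OF h0(2)[OF j]]) simp_all
      then show "\<pi> j \<cdot> (l R \<cdot> h1) = \<pi> j \<cdot> (h0 \<cdot> l N)"
        using Equiv_naturality[OF is_coneD(1)[OF coneN j] l] by (simp add: R_leg_comp h1)
    qed
    define H where "H = (N, (h0, h1), R)"
    have [simp]: "H \<in> Arr (Equiv C)"
      unfolding H_def by (rule Equiv_arrI) (simp_all add: compat)
    have [simp]: "Dom (Equiv C) H = N" "Cod (Equiv C) H = R" "arr0 H = h0"
      by (simp_all add: H_def)
    show ?thesis
    proof (rule ex1I[of _ H])
      show "H \<in> hom (Equiv C) N R \<and> (\<forall>j \<in> Obj J. \<rho> j \<cdot>\<^bsub>Equiv C\<^esub> H = \<nu> j)"
        by (auto simp: hom_def h0(2) intro!: Equiv_arr_eqI)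
      fix G assume G: "G \<in> hom (Equiv C) N R \<and> (\<forall>j \<in> Obj J. \<rho> j \<cdot>\<^bsub>Equiv C\<^esub> G = \<nu> j)"
      then have [simp]: "G \<in> Arr (Equiv C)" "Dom (Equiv C) G = N" "Cod (Equiv C) G = R"
        by (auto simp: hom_def)
      note [simp] = Equiv_arrD[OF this(1)]
      have G_eq: "\<pi> j \<cdot> arr0 G = arr0 (\<nu> j)" if "j \<in> Obj J" for j
        using G that by (metis \<open>\<And>j. arr0 (\<rho> j) = \<pi> j\<close> arr_simps(3))
      have "arr0 G = h0"
        by (rule is_limit_cancel[OF limL J F0]) (simp_all add: h0(2) G_eq)
      then show "G = H"
        by - (rule Equiv_arr_eqI, simp_all)
    qed
  qed
  with cone have "is_limit J (Equiv C) Fo Fa R \<rho>"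
    by (simp add: is_limit_def)
  then show thesis
    by (rule that) simp_all
qed

end

section \<open>Finite completeness, joint monicity and coequalisers in Equiv(C)\<close>

context regular_category
begin

interpretation Equiv: category "Equiv C"
  by (rule category_Equiv)

lemma Equiv_limit_exists:
  assumes "category (J :: (nat, nat) cat)" "finite (Obj J)" "finite (Arr J)"
    and F: "is_functor J (Equiv C) Fo Fa"
  obtains R \<rho> where "is_limit J (Equiv C) Fo Fa R \<rho>"
    "is_limit J C (\<lambda>j. obj0 C (Fo j)) (\<lambda>u. arr0 (Fa u)) (obj0 C R) (\<lambda>j. arr0 (\<rho> j))"
    "is_limit J C (\<lambda>j. obj1 C (Fo j)) (\<lambda>u. arr1 (Fa u)) (obj1 C R) (\<lambda>j. arr1 (\<rho> j))"
proof -
  obtain L \<pi> where L: "is_limit J C (\<lambda>j. obj0 C (Fo j)) (\<lambda>u. arr0 (Fa u)) L \<pi>"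
    using finitely_complete assms(1-3) is_functor_compose[OF F functor_arr0]
    unfolding finitely_complete_def by blast
  obtain M \<mu> where M: "is_limit J C (\<lambda>j. obj1 C (Fo j)) (\<lambda>u. arr1 (Fa u)) M \<mu>"
    using finitely_complete assms(1-3) is_functor_compose[OF F functor_arr1]
    unfolding finitely_complete_def by blast
  obtain R \<rho> where "is_limit J (Equiv C) Fo Fa R \<rho>" "obj0 C R = L" "obj1 C R = M"
    "\<And>j. arr0 (\<rho> j) = \<pi> j" "\<And>j. arr1 (\<rho> j) = \<mu> j"
    by (rule Equiv_limit[OF assms(1) F L M]) (rule that)
  then show thesis
    using that[of R \<rho>] L M by simp
qed

lemma finitely_complete_Equiv: "finitely_complete (Equiv C)"
  unfolding finitely_complete_def using Equiv_limit_exists by blast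

lemma Equiv_pullback_exists:
  assumes FG: "F \<in> Arr (Equiv C)" "G \<in> Arr (Equiv C)" "Cod (Equiv C) F = Cod (Equiv C) G"
  obtains P Q where "is_pullback (Equiv C) F G P Q"
    "is_pullback C (arr0 F) (arr0 G) (arr0 P) (arr0 Q)"
    "is_pullback C (arr1 F) (arr1 G) (arr1 P) (arr1 Q)"
proof -
  note H = Equiv.cospan_functor[OF FG]
  obtain R \<rho> where lim: "is_limit cospan (Equiv C) (Equiv.cospan_obj F G) (Equiv.cospan_arr F G) R \<rho>"
    "is_limit cospan C (\<lambda>j. obj0 C (Equiv.cospan_obj F G j)) (\<lambda>u. arr0 (Equiv.cospan_arr F G u))
       (obj0 C R) (\<lambda>j. arr0 (\<rho> j))"
    "is_limit cospan C (\<lambda>j. obj1 C (Equiv.cospan_obj F G j)) (\<lambda>u. arr1 (Equiv.cospan_arr F G u))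
       (obj1 C R) (\<lambda>j. arr1 (\<rho> j))"
    by (rule Equiv_limit_exists[OF category_cospan finite_cospan H]) (rule that)
  have "Equiv.cospan_arr F G 3 = F" "Equiv.cospan_arr F G 4 = G"
    by (simp_all add: Equiv.cospan_arr_def)
  then show thesis
    using that[of "\<rho> 0" "\<rho> 1"] Equiv.cospan_limit_pullback[OF lim(1) H]
      cospan_limit_pullback[OF lim(2) is_functor_compose[OF H functor_arr0]]
      cospan_limit_pullback[OF lim(3) is_functor_compose[OF H functor_arr1]] by simp
qed

lemma Equiv_pullbackD:
  assumes pb: "is_pullback (Equiv C) F G P Q"
  shows "is_pullback C (arr0 F) (arr0 G) (arr0 P) (arr0 Q)"
    "is_pullback C (arr1 F) (arr1 G) (arr1 P) (arr1 Q)"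
proof -
  obtain P' Q' where "is_pullback (Equiv C) F G P' Q'"
    "is_pullback C (arr0 F) (arr0 G) (arr0 P') (arr0 Q')"
    "is_pullback C (arr1 F) (arr1 G) (arr1 P') (arr1 Q')"
    by (rule Equiv_pullback_exists[OF is_pullbackD(1,2)[OF pb] is_pullbackD(3)[OF pb, symmetric]])
      (rule that)
  then show "is_pullback C (arr0 F) (arr0 G) (arr0 P) (arr0 Q)"
    "is_pullback C (arr1 F) (arr1 G) (arr1 P) (arr1 Q)"
    using functor_pullback[OF category_Equiv category_axioms functor_arr0 _ _ pb]
      functor_pullback[OF category_Equiv category_axioms functor_arr1 _ _ pb] by blast+
qed

text \<open>The discrete equivalence relation on \<open>Z\<close> represents the generalised elements \<open>Z \<rightarrow> X\<close>
  of the object underlying an equivalence relation on \<open>X\<close>.\<close>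

lemma Equiv_discrete:
  assumes r: "r \<in> Obj (Equiv C)" and a: "a \<in> Arr C" "Cod C a = obj0 C r"
  obtains A where "A \<in> Arr (Equiv C)" "Cod (Equiv C) A = r" "arr0 A = a"
    "Dom (Equiv C) A = (Ident C (Dom C a), Ident C (Dom C a))"
proof -
  note [simp] = a
  let ?Z = "Dom C a"
  let ?d = "(Ident C ?Z, Ident C ?Z)"
  have mem_d: "mem C ?d x y \<longleftrightarrow> x \<in> Arr C \<and> Cod C x = ?Z \<and> y = x" for x y
  proof
    assume "mem C ?d x y"
    then show "x \<in> Arr C \<and> Cod C x = ?Z \<and> y = x"
      by (auto simp: mem_def hom_def)
  next
    assume "x \<in> Arr C \<and> Cod C x = ?Z \<and> y = x"
    then show "mem C ?d x y"
      by (intro memI[of x]) simp_all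
  qed
  have "jointly_monic C ?d"
    unfolding jointly_monic_def by (auto simp: hom_def)
  then have "equivalence_rel C ?Z ?d"
    unfolding equivalence_rel_mem mem_d by simp
  then have d: "?d \<in> Obj (Equiv C)"
    unfolding Equiv_obj_iff by simp
  have "mem C r a a"
    by (rule Equiv_objD(2)[OF r]) simp_all
  then obtain h where "h \<in> Arr C" "Dom C h = ?Z" "Cod C h = obj1 C r" "fst r \<cdot> h = a" "snd r \<cdot> h = a"
    by (rule memE) simp
  then have "(?d, (a, h), r) \<in> Arr (Equiv C)"
    by - (rule Equiv_arrI[OF d r], simp_all, elim disjE, simp_all)
  then show thesis
    by (rule that) simp_all
qed

text \<open>Elements of the underlying object are arrows out of a discrete relation, so two elements
  identified on level 0 give two arrows of Equiv(C) identified by \<open>T1\<close> and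
  \<open>T2\<close>.\<close>

lemma Equiv_jointly_monic0:
  assumes T: "jointly_monic (Equiv C) (T1, T2)"
  shows "jointly_monic C (arr0 T1, arr0 T2)"
proof -
  have T1: "T1 \<in> Arr (Equiv C)" and T2: "T2 \<in> Arr (Equiv C)"
    and dom [simp]: "Dom (Equiv C) T2 = Dom (Equiv C) T1"
    using jointly_monicD[OF T] by simp_all
  note [simp] = T1 T2 Equiv_arrD[OF T1] Equiv_arrD(3-)[OF T2]
  have "a = b" if "a \<in> hom C Z (obj0 C (Dom (Equiv C) T1))" "b \<in> hom C Z (obj0 C (Dom (Equiv C) T1))"
    "arr0 T1 \<cdot> a = arr0 T1 \<cdot> b" "arr0 T2 \<cdot> a = arr0 T2 \<cdot> b" for Z a b
  proof -
    have ab: "a \<in> Arr C" "Cod C a = obj0 C (Dom (Equiv C) T1)" "Dom C a = Z"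
      "b \<in> Arr C" "Cod C b = obj0 C (Dom (Equiv C) T1)" "Dom C b = Z"
      using that by (auto simp: hom_def)
    obtain A where A [simp]: "A \<in> Arr (Equiv C)" "Cod (Equiv C) A = Dom (Equiv C) T1" "arr0 A = a"
      "Dom (Equiv C) A = (Ident C Z, Ident C Z)"
      using Equiv_discrete[OF Equiv_arrD(1)[OF T1] ab(1,2)] unfolding ab(3) .
    obtain B where B [simp]: "B \<in> Arr (Equiv C)" "Cod (Equiv C) B = Dom (Equiv C) T1" "arr0 B = b"
      "Dom (Equiv C) B = (Ident C Z, Ident C Z)"
      using Equiv_discrete[OF Equiv_arrD(1)[OF T1] ab(4,5)] unfolding ab(6) .
    have "A = B"
    proof (rule jointly_monic_cancel[OF T])
      show "fst (T1, T2) \<cdot>\<^bsub>Equiv C\<^esub> A = fst (T1, T2) \<cdot>\<^bsub>Equiv C\<^esub> B"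
        by (rule Equiv_arr_eqI) (use that in simp_all)
      show "snd (T1, T2) \<cdot>\<^bsub>Equiv C\<^esub> A = snd (T1, T2) \<cdot>\<^bsub>Equiv C\<^esub> B"
        by (rule Equiv_arr_eqI) (use that in simp_all)
    qed simp_all
    then show ?thesis
      using A(3) B(3) by simp
  qed
  then show ?thesis
    unfolding jointly_monic_def by simp
qed

text \<open>Elements of R with equal images have equal legs, since the legs are separated by the
  level 0 components of \<open>T1\<close> and \<open>T2\<close>; the legs of the source relation
  then separate the elements themselves.\<close>

lemma Equiv_jointly_monic1:
  assumes T1: "T1 \<in> Arr (Equiv C)" and T2: "T2 \<in> Arr (Equiv C)"
    and dom [simp]: "Dom (Equiv C) T2 = Dom (Equiv C) T1"
    and jm: "jointly_monic C (arr0 T1, arr0 T2)"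
  shows "jointly_monic C (arr1 T1, arr1 T2)"
proof -
  let ?r = "Dom (Equiv C) T1"
  note [simp] = T1 T2 Equiv_arrD[OF T1] Equiv_arrD(3-)[OF T2]
  have leg: "arr0 T \<cdot> (l ?r \<cdot> a) = l (Cod (Equiv C) T) \<cdot> (arr1 T \<cdot> a)"
    if T: "T \<in> Arr (Equiv C)" "Dom (Equiv C) T = ?r" and l: "l \<in> {fst, snd}"
      and [simp]: "a \<in> Arr C" "Cod C a = obj1 C ?r" for T l a
  proof -
    note [simp] = Equiv_objD(3-5)[OF _ l] Equiv_arrD(2-)[OF T(1)] T
    have nat: "arr0 T \<cdot> l ?r = l (Cod (Equiv C) T) \<cdot> arr1 T"
      using Equiv_naturality[OF T(1) l] by simp
    show ?thesis
      by (rule comp_eq_extend[OF nat]) simp_all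
  qed
  have "a = b" if ab: "a \<in> hom C Z (obj1 C ?r)" "b \<in> hom C Z (obj1 C ?r)"
    "arr1 T1 \<cdot> a = arr1 T1 \<cdot> b" "arr1 T2 \<cdot> a = arr1 T2 \<cdot> b" for Z a b
  proof -
    have [simp]: "a \<in> Arr C" "Cod C a = obj1 C ?r" "Dom C a = Z"
      "b \<in> Arr C" "Cod C b = obj1 C ?r" "Dom C b = Z"
      using that by (auto simp: hom_def)
    have "l ?r \<cdot> a = l ?r \<cdot> b" if l: "l \<in> {fst, snd}" for l
    proof -
      note [simp] = Equiv_objD(3-5)[OF _ l]
      show ?thesis
        by (rule jointly_monic_cancel[OF jm]) (simp_all add: leg[OF T1 _ l] leg[OF T2 _ l] ab)
    qed
    from this[of fst] this[of snd] show ?thesis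
      by - (rule jointly_monic_cancel[OF Equiv_objD(1)[of ?r]], simp_all)
  qed
  then show ?thesis
    unfolding jointly_monic_def by simp
qed

text \<open>A competing arrow \<open>K\<close> factors on level 0 through an arrow \<open>h\<close>.
  That \<open>h\<close> respects the relations holds after composition with \<open>arr1 F\<close>,
  where \<open>arr1 K\<close> is the witness, and membership descends along this regular
  epimorphism. No coequaliser property of the level 1 arrows enters.\<close>

lemma Equiv_coequaliser:
  assumes P: "P \<in> Arr (Equiv C)" and Q: "Q \<in> Arr (Equiv C)" and F: "F \<in> Arr (Equiv C)"
    and [simp]: "Dom (Equiv C) P = Dom (Equiv C) Q" "Cod (Equiv C) P = Dom (Equiv C) F"
      "Cod (Equiv C) Q = Dom (Equiv C) F"
    and co: "is_coequaliser C (arr0 P) (arr0 Q) (arr0 F)" and e: "regular_epi C (arr1 F)"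
  shows "is_coequaliser (Equiv C) P Q F"
proof -
  note [simp] = P Q F Equiv_arrD(3-)[OF P] Equiv_arrD(3-)[OF Q] Equiv_arrD[OF F]
  let ?r = "Dom (Equiv C) F" and ?s = "Cod (Equiv C) F"
  have e0: "regular_epi C (arr0 F)"
    using co by (auto simp: regular_epi_def)
  show ?thesis
  proof (rule Equiv.is_coequaliserI)
    show "F \<cdot>\<^bsub>Equiv C\<^esub> P = F \<cdot>\<^bsub>Equiv C\<^esub> Q"
      by (rule Equiv_arr_eqI) (simp_all add: is_coequaliserD(7)[OF co])
  next
    fix K assume K: "K \<in> Arr (Equiv C)" and dom: "Dom (Equiv C) K = Cod (Equiv C) P"
      and KP: "K \<cdot>\<^bsub>Equiv C\<^esub> P = K \<cdot>\<^bsub>Equiv C\<^esub> Q"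
    let ?t = "Cod (Equiv C) K"
    note [simp] = Equiv_arrD(2-)[OF K]
    have [simp]: "Dom (Equiv C) K = ?r"
      using dom by simp
    have "arr0 K \<cdot> arr0 P = arr0 K \<cdot> arr0 Q"
      using arg_cong[OF KP, of arr0] by simp
    then obtain h where [simp]: "h \<in> Arr C" "Dom C h = obj0 C ?s" "Cod C h = obj0 C ?t"
      and h: "h \<cdot> arr0 F = arr0 K"
      by - (rule coequaliser_factor[OF co, of "arr0 K"], simp_all)
    have leg: "(h \<cdot> l ?s) \<cdot> arr1 F = l ?t \<cdot> arr1 K" if l: "l \<in> {fst, snd}" for l
    proof -
      note [simp] = Equiv_objD(3-5)[OF _ l]
      have "(h \<cdot> l ?s) \<cdot> arr1 F = h \<cdot> (arr0 F \<cdot> l ?r)"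
        using Equiv_naturality[OF F l] by simp
      also have "\<dots> = arr0 K \<cdot> l ?r"
        by (rule comp_eq_extend1[OF h]) simp_all
      finally show ?thesis
        using Equiv_naturality[OF K l] by simp
    qed
    note [simp] = Equiv_objD(3-5)[of _ snd, simplified] Equiv_objD(3)[of _ fst, simplified]
    have "mem C ?t ((h \<cdot> fst ?s) \<cdot> arr1 F) ((h \<cdot> snd ?s) \<cdot> arr1 F)"
      by (rule memI[of "arr1 K"]) (use leg[of fst] leg[of snd] in simp_all)
    then have "mem C ?t (h \<cdot> fst ?s) (h \<cdot> snd ?s)"
      by - (rule mem_local[OF e Equiv_objD(1)], simp_all)
    then obtain k where "k \<in> Arr C" "Dom C k = obj1 C ?s" "Cod C k = obj1 C ?t"
      "fst ?t \<cdot> k = h \<cdot> fst ?s" "snd ?t \<cdot> k = h \<cdot> snd ?s"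
      by (rule memE) simp
    then have H: "(?s, (h, k), ?t) \<in> Arr (Equiv C)"
      by - (rule Equiv_arrI, simp_all, elim disjE, simp_all)
    have "(?s, (h, k), ?t) \<cdot>\<^bsub>Equiv C\<^esub> F = K"
      by (rule Equiv_arr_eqI) (use H K in \<open>simp_all add: h\<close>)
    then show "\<exists>H \<in> hom (Equiv C) (Cod (Equiv C) F) (Cod (Equiv C) K). H \<cdot>\<^bsub>Equiv C\<^esub> F = K"
      using H by (intro bexI[of _ "(?s, (h, k), ?t)"]) (simp_all add: hom_def)
  next
    fix A B
    assume A: "A \<in> Arr (Equiv C)" and B: "B \<in> Arr (Equiv C)"
      and [simp]: "Dom (Equiv C) A = ?s" "Dom (Equiv C) B = ?s"
        "Cod (Equiv C) A = Cod (Equiv C) B"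
      and AB: "A \<cdot>\<^bsub>Equiv C\<^esub> F = B \<cdot>\<^bsub>Equiv C\<^esub> F"
    note [simp] = Equiv_arrD(3-)[OF A] Equiv_arrD(2-)[OF B]
    have "arr0 A = arr0 B"
      by (rule regular_epi_cancel[OF e0]) (use arg_cong[OF AB, of arr0] in simp_all)
    then show "A = B"
      by - (rule Equiv_arr_eqI[OF A B], simp_all)
  qed simp_all
qed

end

section \<open>Regular epimorphisms between equivalence relations\<close>

text \<open>The kernel pair of \<open>F\<close> in Equiv(C) lies over the kernel pair of
  \<open>arr0 F\<close> in C, whose coequaliser is \<open>arr0 F\<close> itself.\<close>

lemma (in regular_category) regular_epi_EquivI:
  assumes F: "F \<in> Arr (Equiv C)"
    and e0: "regular_epi C (arr0 F)" and e1: "regular_epi C (arr1 F)"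
  shows "regular_epi (Equiv C) F"
proof -
  obtain P Q where pb: "is_pullback (Equiv C) F F P Q"
    and pb0: "is_pullback C (arr0 F) (arr0 F) (arr0 P) (arr0 Q)"
    by (rule Equiv_pullback_exists[OF F F refl]) (rule that)
  have "is_coequaliser (Equiv C) P Q F"
    using is_pullbackD[OF pb] kernel_pair_is_coequaliser[OF e0 pb0] e1
    by (intro Equiv_coequaliser) simp_all
  then show ?thesis
    unfolding regular_epi_def by blast
qed

context goursat_category
begin

interpretation Equiv: category "Equiv C"
  by (rule category_Equiv)

text \<open>The middle object is the image of the source relation along \<open>e\<close>, an
  equivalence relation by the Goursat condition; the level 1 part of \<open>M\<close> comes from
  descent along \<open>arr1 E\<close>. The level 0 factorisation is prescribed, so \<open>e\<close>
  may later be a coequaliser of a given kernel pair.\<close>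

lemma Equiv_image:
  assumes F: "F \<in> Arr (Equiv C)" and e: "regular_epi C e" and m: "monic C m"
    and dom: "Dom C m = Cod C e" and me: "m \<cdot> e = arr0 F"
  obtains E M where "E \<in> Arr (Equiv C)" "M \<in> Arr (Equiv C)"
    "Dom (Equiv C) E = Dom (Equiv C) F" "Cod (Equiv C) M = Cod (Equiv C) F"
    "Dom (Equiv C) M = Cod (Equiv C) E" "M \<cdot>\<^bsub>Equiv C\<^esub> E = F"
    "arr0 E = e" "arr0 M = m" "regular_epi C (arr1 E)"
proof -
  let ?r = "Dom (Equiv C) F" and ?t = "Cod (Equiv C) F"
  note [simp] = regular_epi_arr[OF e] monic_arr[OF m] dom Equiv_arrD[OF F]
  have "Dom C (m \<cdot> e) = obj0 C ?r" "Cod C (m \<cdot> e) = obj0 C ?t"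
    by (simp_all only: me Equiv_arrD(4,5)[OF F])
  then have [simp]: "Dom C e = obj0 C ?r" "Cod C m = obj0 C ?t"
    by simp_all
  have "equivalence_rel C (Dom C e) ?r"
    by (simp flip: Equiv_obj_iff)
  then obtain s e1 where s: "equivalence_rel C (Cod C e) s" and e1: "regular_epi C e1"
    and [simp]: "Dom C e1 = obj1 C ?r" "Cod C e1 = obj1 C s"
    and eq: "fst s \<cdot> e1 = e \<cdot> fst ?r" "snd s \<cdot> e1 = e \<cdot> snd ?r"
    by (rule image_equivalence_rel[OF e]) (rule that)
  note [simp] = regular_epi_arr[OF e1] equivalence_relD(2)[OF s]
  have s' [simp]: "s \<in> Obj (Equiv C)"
    using s by (simp add: Equiv_obj_iff)
  note [simp] = Equiv_objD(3-5)[of _ snd, simplified] Equiv_objD(3)[of _ fst, simplified]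
  have E: "(?r, (e, e1), s) \<in> Arr (Equiv C)"
    by (rule Equiv_arrI) (use eq in \<open>auto simp del: comp_assoc\<close>)
  have leg: "(m \<cdot> l s) \<cdot> e1 = l ?t \<cdot> arr1 F" if l: "l \<in> {fst, snd}" for l
  proof -
    note [simp] = Equiv_objD(3-5)[OF _ l]
    have "(m \<cdot> l s) \<cdot> e1 = m \<cdot> (e \<cdot> l ?r)"
      using eq l by auto
    also have "\<dots> = arr0 F \<cdot> l ?r"
      by (rule comp_eq_extend1[OF me]) simp_all
    finally show ?thesis
      using Equiv_naturality[OF F l] by simp
  qed
  have "mem C ?t ((m \<cdot> fst s) \<cdot> e1) ((m \<cdot> snd s) \<cdot> e1)"
    by (rule memI[of "arr1 F"]) (use leg[of fst] leg[of snd] in simp_all)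
  then have "mem C ?t (m \<cdot> fst s) (m \<cdot> snd s)"
    by - (rule mem_local[OF e1 Equiv_objD(1)], simp_all)
  then obtain k where "k \<in> Arr C" "Dom C k = obj1 C s" "Cod C k = obj1 C ?t"
    "fst ?t \<cdot> k = m \<cdot> fst s" "snd ?t \<cdot> k = m \<cdot> snd s"
    by (rule memE) simp
  then have M: "(s, (m, k), ?t) \<in> Arr (Equiv C)"
    by - (rule Equiv_arrI, simp_all, elim disjE, simp_all)
  have "(s, (m, k), ?t) \<cdot>\<^bsub>Equiv C\<^esub> (?r, (e, e1), s) = F"
    by (rule Equiv_arr_eqI) (use E M F in \<open>simp_all add: me\<close>)
  with E M e1 show thesis
    by (intro that[of "(?r, (e, e1), s)" "(s, (m, k), ?t)"]) simp_all
qed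

text \<open>In an image factorisation of \<open>F\<close>, the first factor \<open>E\<close> also
  coequalises the pair defining \<open>F\<close>, because \<open>m\<close> is monic and level 0
  decides equality. So \<open>E\<close> factors through \<open>F\<close>, which makes
  \<open>M\<close> split and in fact invertible; \<open>F\<close> is then \<open>E\<close> up to
  isomorphism, and \<open>E\<close> is a regular epimorphism on both levels.\<close>

lemma regular_epi_EquivD:
  assumes "regular_epi (Equiv C) F"
  shows "regular_epi C (arr0 F)" "regular_epi C (arr1 F)"
proof -
  obtain U V where co: "is_coequaliser (Equiv C) U V F"
    using assms unfolding regular_epi_def by blast
  note F = Equiv.is_coequaliserD(5)[OF co] and U = Equiv.is_coequaliserD(1)[OF co]
    and V = Equiv.is_coequaliserD(2)[OF co]
  note [simp] = F U V Equiv.is_coequaliserD(3,4,6)[OF co] Equiv_arrD[OF F]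
  obtain e m where e: "regular_epi C e" and m: "monic C m"
    and [simp]: "Dom C e = Dom C (arr0 F)" "Cod C e = Dom C m" "Cod C m = Cod C (arr0 F)"
    and me: "m \<cdot> e = arr0 F"
    by (rule image_factorisation[OF Equiv_arrD(3)[OF F]])
  note [simp] = regular_epi_arr[OF e] monic_arr[OF m]
  obtain E M where E: "E \<in> Arr (Equiv C)" and M: "M \<in> Arr (Equiv C)"
    and [simp]: "Dom (Equiv C) E = Dom (Equiv C) F" "Cod (Equiv C) M = Cod (Equiv C) F"
      "Dom (Equiv C) M = Cod (Equiv C) E"
    and ME: "M \<cdot>\<^bsub>Equiv C\<^esub> E = F"
    and [simp]: "arr0 E = e" "arr0 M = m" and e1: "regular_epi C (arr1 E)"
    by (rule Equiv_image[OF F e m _ me]) (simp, rule that)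
  note [simp] = E M
  have "m \<cdot> (e \<cdot> arr0 U) = arr0 F \<cdot> arr0 U" "m \<cdot> (e \<cdot> arr0 V) = arr0 F \<cdot> arr0 V"
    using Equiv_arrD(3-)[OF U] Equiv_arrD(3-)[OF V]
    by (simp_all add: comp_eq_extend1[OF me])
  moreover have "arr0 F \<cdot> arr0 U = arr0 F \<cdot> arr0 V"
    using arg_cong[OF Equiv.is_coequaliserD(7)[OF co], of arr0] by simp
  ultimately have "e \<cdot> arr0 U = e \<cdot> arr0 V"
    using Equiv_arrD(3-)[OF U] Equiv_arrD(3-)[OF V] by - (rule monic_cancel[OF m], simp_all)
  then have "E \<cdot>\<^bsub>Equiv C\<^esub> U = E \<cdot>\<^bsub>Equiv C\<^esub> V"
    by - (rule Equiv_arr_eqI, simp_all)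
  then obtain H where H [simp]: "H \<in> Arr (Equiv C)" "Dom (Equiv C) H = Cod (Equiv C) F"
    "Cod (Equiv C) H = Cod (Equiv C) E" and HF: "H \<cdot>\<^bsub>Equiv C\<^esub> F = E"
    by - (rule Equiv.coequaliser_factor[OF co, of E], simp_all)
  have "(M \<cdot>\<^bsub>Equiv C\<^esub> H) \<cdot>\<^bsub>Equiv C\<^esub> F = Ident (Equiv C) (Cod (Equiv C) F) \<cdot>\<^bsub>Equiv C\<^esub> F"
    by (simp add: HF ME)
  then have MH: "M \<cdot>\<^bsub>Equiv C\<^esub> H = Ident (Equiv C) (Cod (Equiv C) F)"
    by - (rule Equiv.regular_epi_cancel[OF assms], simp_all)
  have [simp]: "arr0 H \<in> Arr C" "Dom C (arr0 H) = Cod C m" "Cod C (arr0 H) = Dom C m"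
    using Equiv_arrD[OF H(1)] Equiv_arrD(3-5)[OF M] by simp_all
  have "m \<cdot> arr0 H = Ident C (Cod C m)"
    using arg_cong[OF MH, of arr0] by simp
  then have iso: "isomorphism C m"
    by - (rule isomorphism_split_monic[OF m, of "arr0 H"], simp_all)
  show "regular_epi C (arr0 F)"
    using regular_epi_iso_comp[OF e iso] by (simp add: me)
  \<comment> \<open>Invertibility of \<open>m\<close> in C alone would say nothing about level 1.
    The inverse is the level 0 part of the arrow \<open>H\<close> of Equiv(C), so \<open>M\<close>
    is invertible there and \<open>arr1 M\<close> is invertible too.\<close>
  have "arr0 H \<cdot> m = Ident C (Dom C m)"
    using \<open>m \<cdot> arr0 H = Ident C (Cod C m)\<close>
    by - (rule monic_cancel[OF m], simp_all add: comp_eq_extend1[of m "arr0 H"])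
  moreover have "Dom C m = obj0 C (Cod (Equiv C) E)"
    using Equiv_arrD(4)[OF M] by simp
  ultimately have "H \<cdot>\<^bsub>Equiv C\<^esub> M = Ident (Equiv C) (Cod (Equiv C) E)"
    by - (rule Equiv_arr_eqI, simp_all)
  then have "isomorphism (Equiv C) M"
    unfolding isomorphism_def using MH by (intro conjI bexI[of _ H]) (simp_all add: hom_def)
  from functor_isomorphism[OF category_Equiv functor_arr1 this]
  have "regular_epi C (arr1 M \<cdot> arr1 E)"
    using Equiv_arrD(7)[OF M] Equiv_arrD(8)[OF E] by - (rule regular_epi_iso_comp[OF e1], simp_all)
  then show "regular_epi C (arr1 F)"
    using arg_cong[OF ME, of arr1] by simp
qed

lemma regular_category_Equiv: "regular_category (Equiv C)"
proof
  show "finitely_complete (Equiv C)"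
    by (rule finitely_complete_Equiv)
next
  fix F G P Q
  assume F: "regular_epi (Equiv C) F" and pb: "is_pullback (Equiv C) F G P Q"
  show "regular_epi (Equiv C) Q"
    using regular_epi_EquivI[OF is_pullbackD(5)[OF pb]]
      regular_epi_stable[OF regular_epi_EquivD(1)[OF F] Equiv_pullbackD(1)[OF pb]]
      regular_epi_stable[OF regular_epi_EquivD(2)[OF F] Equiv_pullbackD(2)[OF pb]] by blast
next
  fix F P Q
  assume pb: "is_pullback (Equiv C) F F P Q"
  note pb0 = Equiv_pullbackD(1)[OF pb]
  obtain e where co: "is_coequaliser C (arr0 P) (arr0 Q) e"
    using kernel_pair_coequaliser[OF pb0] by blast
  then have e: "regular_epi C e"
    by (auto simp: regular_epi_def)
  obtain m where m: "monic C m" "Dom C m = Cod C e" "Cod C m = Cod C (arr0 F)" "m \<cdot> e = arr0 F"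
    by (rule kernel_pair_factorisation[OF pb0 co])
  \<comment> \<open>Only the first factor is kept: it lies over the coequaliser \<open>e\<close> of
    the level 0 kernel pair and is a regular epimorphism on level 1, as the coequaliser criterion
    demands.\<close>
  obtain E M where E: "E \<in> Arr (Equiv C)" "Dom (Equiv C) E = Dom (Equiv C) F" "arr0 E = e"
    "regular_epi C (arr1 E)"
    by (rule Equiv_image[OF is_pullbackD(1)[OF pb] e m(1,2,4)]) (rule that)
  have "is_coequaliser (Equiv C) P Q E"
    using E co is_pullbackD[OF pb] by (intro Equiv_coequaliser) simp_all
  then show "\<exists>E. is_coequaliser (Equiv C) P Q E"
    by blast
qed

end

section \<open>Functors preserving relations and their composites\<close>

text \<open>Collects what the leg descriptions of relations and their composites refer to, so that
  both functors from Equiv(C) to C are treated at once.\<close>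

locale regular_functor = D: regular_category D + C: regular_category C
  for D :: "('p, 'b) cat" and C :: "('o, 'a) cat" +
  fixes Go :: "'p \<Rightarrow> 'o" and Ga :: "'b \<Rightarrow> 'a"
  assumes is_functor: "is_functor D C Go Ga"
    and pullback: "is_pullback D f g p q \<Longrightarrow> is_pullback C (Ga f) (Ga g) (Ga p) (Ga q)"
    and regular_epi: "regular_epi D f \<Longrightarrow> regular_epi C (Ga f)"
    and jointly_monic: "jointly_monic D r \<Longrightarrow> jointly_monic C (map_prod Ga Ga r)"
begin

lemmas arr [simp] = is_functorD[OF is_functor]
lemmas comp = is_functor_comp[OF is_functor]

text \<open>The internal definition is used rather than the element form: a functor carries the
  witnessing arrows along, whereas generalised elements of \<open>Go X\<close> need not come from
  the source category.\<close>

lemma equivalence_rel: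
  assumes "equivalence_rel D X r"
  shows "equivalence_rel C (Go X) (map_prod Ga Ga r)"
proof -
  have jm: "jointly_monic D r" and cod: "Cod D (fst r) = X" "Cod D (snd r) = X"
    using D.equivalence_relD(1-3)[OF assms] .
  note [simp] = jointly_monicD[OF jm] cod
  have X: "X \<in> Obj D"
    using D.obj_arr(2)[of "fst r"] by simp
  have "is_relation C (Go X) (Go X) (map_prod Ga Ga r)"
    unfolding C.is_relation_iff using jointly_monic[OF jm] by simp
  moreover have "reflexive_rel C (Go X) (map_prod Ga Ga r)"
  proof -
    obtain d where d: "d \<in> Arr D" "Dom D d = X" "Cod D d = Dom D (fst r)"
      "fst r \<cdot>\<^bsub>D\<^esub> d = Ident D X" "snd r \<cdot>\<^bsub>D\<^esub> d = Ident D X"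
      using assms by (auto simp: equivalence_rel_def reflexive_rel_def hom_def case_prod_beta)
    then have "Ga (fst r) \<cdot>\<^bsub>C\<^esub> Ga d = Ident C (Go X)" "Ga (snd r) \<cdot>\<^bsub>C\<^esub> Ga d = Ident C (Go X)"
      using is_functor_Ident(1)[OF is_functor X] by (simp_all flip: comp)
    then show ?thesis
      unfolding reflexive_rel_def case_prod_beta using d
      by (intro bexI[of _ "Ga d"]) (simp_all add: hom_def)
  qed
  moreover have "symmetric_rel C (map_prod Ga Ga r)"
  proof -
    obtain d where d: "d \<in> Arr D" "Dom D d = Dom D (fst r)" "Cod D d = Dom D (fst r)"
      "fst r \<cdot>\<^bsub>D\<^esub> d = snd r" "snd r \<cdot>\<^bsub>D\<^esub> d = fst r"
      using assms by (auto simp: equivalence_rel_def symmetric_rel_def hom_def case_prod_beta)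
    then have "Ga (fst r) \<cdot>\<^bsub>C\<^esub> Ga d = Ga (snd r)" "Ga (snd r) \<cdot>\<^bsub>C\<^esub> Ga d = Ga (fst r)"
      by (simp_all flip: comp)
    then show ?thesis
      unfolding symmetric_rel_def case_prod_beta using d
      by (intro bexI[of _ "Ga d"]) (simp_all add: hom_def)
  qed
  moreover have "transitive_rel C (map_prod Ga Ga r)"
  proof -
    obtain p q t where pb: "is_pullback D (snd r) (fst r) p q"
      and t: "t \<in> hom D (Dom D p) (Dom D (fst r))"
      and eq: "fst r \<cdot>\<^bsub>D\<^esub> t = fst r \<cdot>\<^bsub>D\<^esub> p" "snd r \<cdot>\<^bsub>D\<^esub> t = snd r \<cdot>\<^bsub>D\<^esub> q"
      using assms by (auto simp: equivalence_rel_def transitive_rel_def case_prod_beta)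
    note [simp] = is_pullbackD(4-8)[OF pb]
    have [simp]: "t \<in> Arr D" "Dom D t = Dom D p" "Cod D t = Dom D (fst r)"
      using t by (auto simp: hom_def)
    have "Ga (fst r) \<cdot>\<^bsub>C\<^esub> Ga t = Ga (fst r) \<cdot>\<^bsub>C\<^esub> Ga p"
      "Ga (snd r) \<cdot>\<^bsub>C\<^esub> Ga t = Ga (snd r) \<cdot>\<^bsub>C\<^esub> Ga q"
      by (simp_all flip: comp add: eq)
    moreover have "Ga t \<in> hom C (Dom C (Ga p)) (Dom C (Ga (fst r)))"
      by (simp add: hom_def)
    ultimately show ?thesis
      using pullback[OF pb] unfolding transitive_rel_def case_prod_beta fst_map_prod snd_map_prod
      by blast
  qed
  ultimately show ?thesis
    by (simp add: equivalence_rel_def)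
qed

lemma is_rel_comp:
  assumes r: "jointly_monic D r" and s: "jointly_monic D s" and t: "is_rel_comp D s r t"
  shows "is_rel_comp C (map_prod Ga Ga s) (map_prod Ga Ga r) (map_prod Ga Ga t)"
proof -
  note [simp] = jointly_monicD[OF r] jointly_monicD[OF s]
  obtain p q e where jt: "jointly_monic D t"
    and cod [simp]: "Cod D (fst t) = Cod D (fst r)" "Cod D (snd t) = Cod D (snd s)"
    and pb: "is_pullback D (snd r) (fst s) p q" and e: "regular_epi D e"
    and [simp]: "Dom D e = Dom D p" "Cod D e = Dom D (fst t)"
    and eq: "fst t \<cdot>\<^bsub>D\<^esub> e = fst r \<cdot>\<^bsub>D\<^esub> p" "snd t \<cdot>\<^bsub>D\<^esub> e = snd s \<cdot>\<^bsub>D\<^esub> q"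
    using t D.is_rel_comp_iff[of r s t] by auto
  note [simp] = jointly_monicD[OF jt] is_pullbackD(4-8)[OF pb] D.regular_epi_arr[OF e]
  have "Ga (fst t) \<cdot>\<^bsub>C\<^esub> Ga e = Ga (fst r) \<cdot>\<^bsub>C\<^esub> Ga p" "Ga (snd t) \<cdot>\<^bsub>C\<^esub> Ga e = Ga (snd s) \<cdot>\<^bsub>C\<^esub> Ga q"
    by (simp_all flip: comp add: eq)
  moreover have "Dom C (Ga e) = Dom C (Ga p)" "Cod C (Ga e) = Dom C (Ga (fst t))"
    by simp_all
  ultimately have "\<exists>p q e. is_pullback C (Ga (snd r)) (Ga (fst s)) p q \<and> regular_epi C e \<and>
      Dom C e = Dom C p \<and> Cod C e = Dom C (Ga (fst t)) \<and>
      Ga (fst t) \<cdot>\<^bsub>C\<^esub> e = Ga (fst r) \<cdot>\<^bsub>C\<^esub> p \<and> Ga (snd t) \<cdot>\<^bsub>C\<^esub> e = Ga (snd s) \<cdot>\<^bsub>C\<^esub> q"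
    using pullback[OF pb] regular_epi[OF e] by blast
  then show ?thesis
    using jointly_monic[OF jt] by (subst C.is_rel_comp_iff) simp_all
qed

end

section \<open>Comparison of the triple composites on both levels\<close>

context goursat_category
begin

lemma regular_functor_arr0: "regular_functor (Equiv C) C (obj0 C) arr0"
proof (intro regular_functor.intro regular_functor_axioms.intro)
  show "jointly_monic C (map_prod arr0 arr0 r)" if "jointly_monic (Equiv C) r" for r
    using that Equiv_jointly_monic0[of "fst r" "snd r"] by (simp add: map_prod_def case_prod_beta)
qed (fact regular_category_Equiv regular_category_axioms functor_arr0 Equiv_pullbackD(1)
  regular_epi_EquivD(1))+

lemma regular_functor_arr1: "regular_functor (Equiv C) C (obj1 C) arr1"
proof (intro regular_functor.intro regular_functor_axioms.intro)
  show "jointly_monic C (map_prod arr1 arr1 r)" if "jointly_monic (Equiv C) r" for r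
    using Equiv_jointly_monic1[of "fst r" "snd r"] Equiv_jointly_monic0[of "fst r" "snd r"] that
      jointly_monicD[OF that] by (simp add: map_prod_def case_prod_beta)
qed (fact regular_category_Equiv regular_category_axioms functor_arr1 Equiv_pullbackD(2)
  regular_epi_EquivD(2))+

interpretation Equiv: regular_category "Equiv C"
  by (rule regular_category_Equiv)

interpretation U0: regular_functor "Equiv C" C "obj0 C" arr0
  by (rule regular_functor_arr0)

interpretation U1: regular_functor "Equiv C" C "obj1 C" arr1
  by (rule regular_functor_arr1)

text \<open>The witnesses of the two levels are found separately and could a priori be unrelated.
  They commute with the legs because this holds after the level 0 components of \<open>T\<close>,
  which are jointly monic.\<close>

lemma mem_EquivI:
  assumes T: "jointly_monic (Equiv C) T" and X: "X \<in> Arr (Equiv C)" and Y: "Y \<in> Arr (Equiv C)"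
    and [simp]: "Dom (Equiv C) Y = Dom (Equiv C) X"
      "Cod (Equiv C) X = Cod (Equiv C) (fst T)" "Cod (Equiv C) Y = Cod (Equiv C) (snd T)"
    and mem0: "mem C (map_prod arr0 arr0 T) (arr0 X) (arr0 Y)"
    and mem1: "mem C (map_prod arr1 arr1 T) (arr1 X) (arr1 Y)"
  shows "mem (Equiv C) T X Y"
proof -
  let ?n = "Dom (Equiv C) X" and ?r = "Dom (Equiv C) (fst T)"
  note T' = jointly_monicD(1,2)[OF T]
  note [simp] = X Y T' jointly_monicD(3)[OF T] Equiv_arrD(1,3-)[OF X] Equiv_arrD(3-)[OF Y]
    Equiv_arrD[OF T'(1)] Equiv_arrD(2-)[OF T'(2)]
  obtain h0 where [simp]: "h0 \<in> Arr C" "Dom C h0 = obj0 C ?n" "Cod C h0 = obj0 C ?r"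
    and h0: "arr0 (fst T) \<cdot> h0 = arr0 X" "arr0 (snd T) \<cdot> h0 = arr0 Y"
    using mem0 by (rule memE) simp
  obtain h1 where [simp]: "h1 \<in> Arr C" "Dom C h1 = obj1 C ?n" "Cod C h1 = obj1 C ?r"
    and h1: "arr1 (fst T) \<cdot> h1 = arr1 X" "arr1 (snd T) \<cdot> h1 = arr1 Y"
    using mem1 by (rule memE) simp
  have "l ?r \<cdot> h1 = h0 \<cdot> l ?n" if l: "l \<in> {fst, snd}" for l
  proof -
    note [simp] = Equiv_objD(3-5)[OF _ l]
    have leg: "arr0 A \<cdot> (l ?r \<cdot> h1) = arr0 A \<cdot> (h0 \<cdot> l ?n)"
      if A: "A \<in> Arr (Equiv C)" "Dom (Equiv C) A = ?r" and Z: "Z \<in> Arr (Equiv C)"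
        "Dom (Equiv C) Z = ?n" "Cod (Equiv C) Z = Cod (Equiv C) A"
        and h: "arr0 A \<cdot> h0 = arr0 Z" "arr1 A \<cdot> h1 = arr1 Z" for A Z
    proof -
      note [simp] = Equiv_arrD(2-)[OF A(1)] A(2)
      have nat: "arr0 A \<cdot> l ?r = l (Cod (Equiv C) A) \<cdot> arr1 A"
        using Equiv_naturality[OF A(1) l] A(2) by simp
      have "arr0 A \<cdot> (l ?r \<cdot> h1) = l (Cod (Equiv C) A) \<cdot> (arr1 A \<cdot> h1)"
        by (rule comp_eq_extend[OF nat]) simp_all
      also have "\<dots> = arr0 Z \<cdot> l ?n"
        using Equiv_naturality[OF Z(1) l] by (simp add: h Z)
      also have "\<dots> = arr0 A \<cdot> (h0 \<cdot> l ?n)"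
        by (rule comp_eq_extend1[OF h(1), symmetric]) simp_all
      finally show ?thesis .
    qed
    show ?thesis
      by (rule jointly_monic_cancel[OF U0.jointly_monic[OF T]])
        (use leg[OF T'(1) _ X] leg[OF T'(2) _ Y] h0 h1 in simp_all)
  qed
  then have H: "(?n, (h0, h1), ?r) \<in> Arr (Equiv C)"
    by (intro Equiv_arrI) simp_all
  have "fst T \<cdot>\<^bsub>Equiv C\<^esub> (?n, (h0, h1), ?r) = X"
    by (rule Equiv_arr_eqI) (use H in \<open>simp_all add: h0\<close>)
  moreover have "snd T \<cdot>\<^bsub>Equiv C\<^esub> (?n, (h0, h1), ?r) = Y"
    by (rule Equiv_arr_eqI) (use H in \<open>simp_all add: h0\<close>)
  ultimately show ?thesis
    using H by (intro memI[of "(?n, (h0, h1), ?r)"]) simp_all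
qed

lemma mem_triple_composite:
  assumes r: "equivalence_rel (Equiv C) X r" and s: "equivalence_rel (Equiv C) X s"
  defines "t \<equiv> rel_comp (Equiv C) r (rel_comp (Equiv C) s r)"
    and "u \<equiv> rel_comp (Equiv C) s (rel_comp (Equiv C) r s)"
  shows "jointly_monic (Equiv C) t" "Cod (Equiv C) (fst t) = X" "Cod (Equiv C) (snd t) = X"
    "mem (Equiv C) u (fst t) (snd t)"
proof -
  note R [simp] = Equiv.equivalence_relD(1-3)[OF r] and S [simp] = Equiv.equivalence_relD(1-3)[OF s]
  let ?a = "rel_comp (Equiv C) s r" and ?b = "rel_comp (Equiv C) r s"
  have sr: "is_rel_comp (Equiv C) s r ?a"
    by (rule Equiv.rel_comp) simp_all
  note A [simp] = Equiv.is_rel_compD[OF R(1) S(1) sr]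
  have rsr: "is_rel_comp (Equiv C) r ?a t"
    unfolding t_def by (rule Equiv.rel_comp) simp_all
  note T [simp] = Equiv.is_rel_compD[OF A(1) R(1) rsr]
  have rs: "is_rel_comp (Equiv C) r s ?b"
    by (rule Equiv.rel_comp) simp_all
  note B [simp] = Equiv.is_rel_compD[OF S(1) R(1) rs]
  have srs: "is_rel_comp (Equiv C) s ?b u"
    unfolding u_def by (rule Equiv.rel_comp) simp_all
  note U [simp] = Equiv.is_rel_compD[OF B(1) S(1) srs]
  show "jointly_monic (Equiv C) t" "Cod (Equiv C) (fst t) = X" "Cod (Equiv C) (snd t) = X"
    by simp_all
  \<comment> \<open>The universal element of a relation, witnessed by an identity; one membership of
    it expresses the whole inclusion of \<open>t\<close> in \<open>u\<close>.\<close>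
  have legs: "mem D (map_prod f f t) (f (fst t)) (f (snd t))"
    if "category D" "jointly_monic D (map_prod f f t)" for D :: "('o, 'a) cat" and f
    using that jointly_monicD[OF that(2)] category.ident_arr[OF that(1)] category.comp_ident[OF that(1)]
      category.obj_arr(1)[OF that(1)]
    by (intro memI[of "Ident D (Dom D (f (fst t)))"]) simp_all
  have "mem C (map_prod arr0 arr0 u) (arr0 (fst t)) (arr0 (snd t))"
    by (rule three_permutable_mem[OF U0.equivalence_rel[OF r] U0.equivalence_rel[OF s]
        U0.is_rel_comp[OF R(1) S(1) sr] U0.is_rel_comp[OF A(1) R(1) rsr]
        U0.is_rel_comp[OF S(1) R(1) rs] U0.is_rel_comp[OF B(1) S(1) srs]])
      (rule legs[OF category_axioms U0.jointly_monic[OF T(1)]])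
  moreover have "mem C (map_prod arr1 arr1 u) (arr1 (fst t)) (arr1 (snd t))"
    by (rule three_permutable_mem[OF U1.equivalence_rel[OF r] U1.equivalence_rel[OF s]
        U1.is_rel_comp[OF R(1) S(1) sr] U1.is_rel_comp[OF A(1) R(1) rsr]
        U1.is_rel_comp[OF S(1) R(1) rs] U1.is_rel_comp[OF B(1) S(1) srs]])
      (rule legs[OF category_axioms U1.jointly_monic[OF T(1)]])
  ultimately show "mem (Equiv C) u (fst t) (snd t)"
    using jointly_monicD[OF T(1)] by (intro mem_EquivI[OF U(1)]) simp_all
qed

text \<open>\<open>mem_triple_composite\<close> is one inclusion; exchanging \<open>r\<close> and
  \<open>s\<close> gives the other.\<close>

lemma goursat_category_Equiv: "goursat_category (Equiv C)"
proof
  fix X r s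
  assume r: "equivalence_rel (Equiv C) X r" and s: "equivalence_rel (Equiv C) X s"
  show "rel_eq (Equiv C) (rel_comp (Equiv C) r (rel_comp (Equiv C) s r))
      (rel_comp (Equiv C) s (rel_comp (Equiv C) r s))"
    using mem_triple_composite[OF r s] mem_triple_composite[OF s r] by (intro Equiv.rel_eqI)
qed

end

theorem proposition2p2:
  fixes C :: "('o, 'a) cat"
  assumes "regular_category C"
    and "goursat_category C"
  shows "goursat_category (Equiv C)"
  using assms(2) by (rule goursat_category.goursat_category_Equiv)

end
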